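(* Let $A$ be the augmented square antiprism graph. Then the straight-line RAC drawings of $A$ realize exactly two combinatorial embeddings.
   Context: The augmented square antiprism graph $A$ has the $9$ vertices $v_0, a_0,a_1,a_2,a_3, b_0,b_1,b_2,b_3$ and edges $(a_i,a_{i+1})$, $(b_i,b_{i+1})$, $(a_i,b_i)$, $(a_{i+1},b_i)$ for $i=0,1,2,3$ (indices mod $4$), together with $(v_0,x)$ for every other vertex $x$. The $4$-cycle $a_0a_1a_2a_3$ is called the quadrilateral $\mathcal{Q}_1$ and the $4$-cycle $b_0b_1b_2b_3$ the quadrilateral $\mathcal{Q}_2$; $v_0$ is the central vertex. A straight-line drawing maps vertices to distinct points and edges to straight segments between their endpoints, no edge passing through a non-incident vertex and no two edges overlapping; two edges cross if their segments meet at a point interior to both. A straight-line RAC drawing is one in which any two crossing edges are perpendicular. The combinatorial embedding of a drawing is that of its planarization (each crossing point replaced by a dummy vertex of degree four): the cyclic order of edges around each vertex and crossing, together with the outer face, with vertices labelled (embeddings that differ only by a reflection of the plane being identified). (In the two embeddings, one of $\mathcal{Q}_1,\mathcal{Q}_2$ bounds the outer face and the other lies inside it.) *)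

theory Defs
  imports "HOL-Analysis.Analysis"
begin

(* The indices live in the numeral type 4, whose addition is modulo 4. *)
datatype antiprism_vertex = v\<^sub>0 | va 4 | vb 4

definition augmented_antiprism :: "antiprism_vertex set set" where
  "augmented_antiprism =
     (\<Union>i. {{va i, va (i + 1)}, {vb i, vb (i + 1)}, {va i, vb i}, {va (i + 1), vb i}})
     \<union> {{v\<^sub>0, x} |x. x \<noteq> v\<^sub>0}"

(* Throughout, a simple graph is given by its edge set E, a set of two-element sets; its vertex
   set is the whole type 'v.  A drawing is the map D that places the vertices in the plane. *)

definition edge_segment :: "('v \<Rightarrow> complex) \<Rightarrow> 'v set \<Rightarrow> complex set" where
  "edge_segment D e = convex hull (D ` e)"

definition edge_interior :: "('v \<Rightarrow> complex) \<Rightarrow> 'v set \<Rightarrow> complex set" where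
  "edge_interior D e = edge_segment D e - D ` e"

definition straight_line_drawing :: "'v set set \<Rightarrow> ('v \<Rightarrow> complex) \<Rightarrow> bool" where
  "straight_line_drawing E D \<longleftrightarrow>
     inj D \<and>
     (\<forall>e\<in>E. \<forall>v. v \<notin> e \<longrightarrow> D v \<notin> edge_segment D e) \<and>
     (\<forall>e\<in>E. \<forall>f\<in>E. e \<noteq> f \<longrightarrow> (\<exists>z. edge_segment D e \<inter> edge_segment D f \<subseteq> {z}))"

definition edges_cross :: "('v \<Rightarrow> complex) \<Rightarrow> 'v set \<Rightarrow> 'v set \<Rightarrow> bool" where
  "edges_cross D e f \<longleftrightarrow> e \<noteq> f \<and> edge_interior D e \<inter> edge_interior D f \<noteq> {}"

definition rac_drawing :: "'v set set \<Rightarrow> ('v \<Rightarrow> complex) \<Rightarrow> bool" where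
  "rac_drawing E D \<longleftrightarrow>
     straight_line_drawing E D \<and>
     (\<forall>u v x y. {u, v} \<in> E \<and> {x, y} \<in> E \<and> edges_cross D {u, v} {x, y} \<longrightarrow>
        orthogonal (D u - D v) (D x - D y))"

definition crossing_points :: "'v set set \<Rightarrow> ('v \<Rightarrow> complex) \<Rightarrow> complex set" where
  "crossing_points E D =
     {z. \<exists>e\<in>E. \<exists>f\<in>E. e \<noteq> f \<and> z \<in> edge_interior D e \<inter> edge_interior D f}"

definition node_points :: "'v set set \<Rightarrow> ('v \<Rightarrow> complex) \<Rightarrow> complex set" where
  "node_points E D = range D \<union> crossing_points E D"

(* The darts of the planarization, i.e. its edges taken in both directions, as pairs of points. *)
definition plane_darts :: "'v set set \<Rightarrow> ('v \<Rightarrow> complex) \<Rightarrow> (complex \<times> complex) set" where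
  "plane_darts E D =
     {(p, q). p \<noteq> q \<and> (\<exists>e\<in>E. closed_segment p q \<subseteq> edge_segment D e) \<and>
              closed_segment p q \<inter> node_points E D = {p, q}}"

(* Nodes of the planarization, named independently of their position in the plane.  A dummy
   vertex is identified by the set of edges crossing there: two edges of a straight-line drawing
   cross at most once, and in a RAC drawing this set always has exactly two elements. *)
datatype 'v node = Vertex 'v | Crossing "'v set set"

definition node_of :: "'v set set \<Rightarrow> ('v \<Rightarrow> complex) \<Rightarrow> complex \<Rightarrow> 'v node" where
  "node_of E D z =
     (if z \<in> range D then Vertex (inv D z) else Crossing {e \<in> E. z \<in> edge_interior D e})"

(* (n, x, y, z) in rotation: the neighbours x, y, z of the node n are pairwise distinct and
   occur in this cyclic order counterclockwise around n.
   outer_darts: the darts that have the outer face on their left-hand side. *)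
record 'v embedding =
  darts :: "('v node \<times> 'v node) set"
  rotation :: "('v node \<times> 'v node \<times> 'v node \<times> 'v node) set"
  outer_darts :: "('v node \<times> 'v node) set"

definition embedding_of :: "'v set set \<Rightarrow> ('v \<Rightarrow> complex) \<Rightarrow> 'v embedding" where
  "embedding_of E D =
     \<lparr> darts = {(node_of E D p, node_of E D q) |p q. (p, q) \<in> plane_darts E D},
       rotation =
         {(node_of E D p, node_of E D q, node_of E D r, node_of E D s) |p q r s.
            (p, q) \<in> plane_darts E D \<and> (p, r) \<in> plane_darts E D \<and> (p, s) \<in> plane_darts E D \<and>
            0 < Arg2pi ((r - p) / (q - p)) \<and>
            Arg2pi ((r - p) / (q - p)) < Arg2pi ((s - p) / (q - p))},
       outer_darts =
         {(node_of E D p, node_of E D q) |p q. (p, q) \<in> plane_darts E D \<and>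
            (\<forall>\<^sub>F t in at_right 0.
               midpoint p q + of_real t * \<i> * (q - p) \<in> outside (\<Union>e\<in>E. edge_segment D e))} \<rparr>"

definition mirror :: "'v embedding \<Rightarrow> 'v embedding" where
  "mirror M =
     \<lparr> darts = darts M,
       rotation = {(n, x, y, z). (n, z, y, x) \<in> rotation M},
       outer_darts = (outer_darts M)\<inverse> \<rparr>"

definition combinatorial_embedding :: "'v set set \<Rightarrow> ('v \<Rightarrow> complex) \<Rightarrow> 'v embedding set" where
  "combinatorial_embedding E D = {embedding_of E D, mirror (embedding_of E D)}"

end

theory Submission
  imports Defs
begin

text \<open>
  The graph is the square of the 8-cycle a0 b0 a1 b1 a2 b2 a3 b3 together with a hub adjacent to all
  its vertices.  Perpendicularity of crossing edges enters only through two consequences: an edge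
  never crosses two edges with a common endpoint, and in a crossing all angles between an edge and a
  diagonal at one of the four endpoints are acute.  Both survive a small perturbation into general
  position, after which everything is a statement about the orientations of triples of points.

  If an edge triangle separates vertices, an outside vertex has at most one neighbour inside, and an
  inside vertex has at most three neighbours outside.  Hence no vertex lies in a triangle of three
  consecutive rim vertices, the rim vertices surround the hub in their cyclic order, and consecutive
  rim triangles have alternating orientations.  So the orientations of all edge triangles are
  determined up to a reflection and a shift of the 8-cycle.

  Conversely these orientations determine the embedding.  One quadrilateral, which need not be
  convex, is star-shaped about the hub and contains everything else; in its four sectors, seen from
  the hub, the edges can be listed explicitly.
\<close>

section \<open>Orientation of point triples\<close>

text \<open>A RAC drawing may have collinear vertices: in the symmetric model drawings constructed
  near the end, opposite corners of the outer quadrilateral are collinear with the hub. So the sign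
  of an arbitrary triple exists only after perturbation, and perpendicularity, a closed condition,
  does not survive one; open consequences of it do. Perturbed edges cross only if the original
  closed edges meet, which forces an original right-angled crossing, and the angles in question are
  strictly acute. On the way back only edge triangles are read off. A straight-line drawing keeps
  them nondegenerate, so their original and perturbed signs agree, and the embedding depends on no
  other triples. The combinatorial half is finite: 9 points have 84 triples, each a Boolean
  variable. Identities between orientations contribute the clauses of plane geometry; forbidden fan
  crossings, the bounds on edges leaving a triangle and sums of acute angles contribute those of the
  right angles. The symmetries of the 8-cycle and complex conjugation keep the number of cases
  small.\<close>

definition orient :: "complex \<Rightarrow> complex \<Rightarrow> complex \<Rightarrow> real" where
  "orient x y z = (Re y - Re x) * (Im z - Im x) - (Im y - Im x) * (Re z - Re x)"

abbreviation ccw :: "complex \<Rightarrow> complex \<Rightarrow> complex \<Rightarrow> bool" where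
  "ccw x y z \<equiv> 0 < orient x y z"

lemma orient_rotate: "orient y z x = orient x y z"
  by (simp add: orient_def algebra_simps)

lemma orient_rotate': "orient z x y = orient x y z"
  by (simp add: orient_def algebra_simps)

lemma orient_swap: "orient y x z = - orient x y z"
  by (simp add: orient_def algebra_simps)

lemma orient_swap': "orient x z y = - orient x y z"
  by (simp add: orient_def algebra_simps)

lemma orient_same [simp]: "orient x x y = 0" "orient x y x = 0" "orient y x x = 0"
  by (simp_all add: orient_def algebra_simps)

lemma orient_sum: "orient x y z = orient t y z + orient x t z + orient x y t"
  by (simp add: orient_def algebra_simps)

text \<open>The three-term Grassmann-Pluecker relation for the vectors from \<open>a\<close> to the
  other four points. Up to signs it is the identity behind both transitivity laws below.\<close>

lemma orient_pluecker:
  "orient a b c * orient a d e + orient a b e * orient a c d = orient a b d * orient a c e"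
  by (simp add: orient_def algebra_simps)

lemma ccw_interior: "ccw t q r \<Longrightarrow> ccw p t r \<Longrightarrow> ccw p q t \<Longrightarrow> ccw p q r"
  using orient_sum[of p q r t] by simp

text \<open>Turning left as seen from \<open>a\<close> is not transitive in general. It is for
  points in one open half-plane bounded by a line through \<open>a\<close>, here the left side of
  \<open>ab\<close> and in \<open>ccw_trans'\<close> the right side.\<close>

lemma ccw_trans:
  assumes "ccw a b c" "ccw a b d" "ccw a b e" "ccw a c d" "ccw a d e"
  shows "ccw a c e"
proof -
  have "0 < orient a b c * orient a d e + orient a b e * orient a c d"
    using assms by (simp add: add_pos_pos)
  then show ?thesis
    using assms(2) by (simp add: orient_pluecker zero_less_mult_iff)
qed

lemma ccw_trans':
  assumes "ccw a c b" "ccw a d b" "ccw a e b" "ccw a c d" "ccw a d e"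
  shows "ccw a c e"
proof -
  have "0 < orient a c b * orient a d e + orient a e b * orient a c d"
    using assms by (simp add: add_pos_pos)
  also have "\<dots> = orient a d b * orient a c e"
    by (simp add: orient_def algebra_simps)
  finally show ?thesis
    using assms(2) by (simp add: zero_less_mult_iff)
qed

text \<open>The vectors from \<open>b\<close> to \<open>x\<close>, \<open>y\<close>,
  \<open>z\<close> have a linear relation with the positive coefficients
  \<open>orient b y z\<close>, \<open>orient b z x\<close>, \<open>orient b x y\<close>, so no
  linear functional is positive on all three.\<close>

lemma ccw_positive_span:
  assumes "ccw b x y" "ccw b y z" "ccw b z x" "ccw b x a" "ccw b y a"
  shows "\<not> ccw b z a"
proof
  assume "ccw b z a"
  then have "0 < orient b x y * orient b z a + orient b y z * orient b x a + orient b z x * orient b y a"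
    using assms by (simp add: add_pos_pos)
  also have "\<dots> = 0" by (simp add: orient_def algebra_simps)
  finally show False by simp
qed

definition in_triangle :: "complex \<Rightarrow> complex \<Rightarrow> complex \<Rightarrow> complex \<Rightarrow> bool" where
  "in_triangle x y z d \<longleftrightarrow>
     ccw x y d \<and> ccw y z d \<and> ccw z x d \<or> ccw y x d \<and> ccw z y d \<and> ccw x z d"

text \<open>Strict convexity of the quadrilateral \<open>a u b v\<close>, in either sense, whose
  diagonals are \<open>ab\<close> and \<open>uv\<close>. In this form a crossing is a propositional
  formula in orientations.\<close>

definition crosses :: "complex \<Rightarrow> complex \<Rightarrow> complex \<Rightarrow> complex \<Rightarrow> bool" where
  "crosses a b u v \<longleftrightarrow>
     ccw a u b \<and> ccw u b v \<and> ccw b v a \<and> ccw v a u \<or>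
     ccw a v b \<and> ccw v b u \<and> ccw b u a \<and> ccw u a v"

lemma in_triangle_rotate: "in_triangle y z x d = in_triangle x y z d"
  by (auto simp: in_triangle_def)

lemma crosses_sym: "crosses a b u v = crosses u v a b" "crosses a b u v = crosses b a u v"
  "crosses a b u v = crosses a b v u"
  by (auto simp: crosses_def)

text \<open>\<open>a\<close> lies in the triangle \<open>b x y\<close>, whose corners
  \<open>b\<close> and \<open>x\<close> are left of the line \<open>yz\<close> while
  \<open>y\<close> is on it. The identity is this convex combination.\<close>

lemma ccw_subtriangle:
  assumes "ccw b x y" "ccw y z b" "ccw y z x" "ccw a x y" "ccw b a y" "ccw b x a"
  shows "ccw y z a"
proof -
  have "0 < orient a x y * orient y z b + orient b a y * orient y z x"
    using assms by (simp add: add_pos_pos)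
  also have "\<dots> = orient b x y * orient y z a"
    by (simp add: orient_def algebra_simps)
  finally show ?thesis
    using assms(1) by (simp add: zero_less_mult_iff)
qed

text \<open>Two acute angles add up to less than a half-turn. The identity is the addition formula
  of the sine, scaled by the lengths of the vectors.\<close>

lemma ccw_acute_add:
  assumes "ccw w x y" "ccw w y z" "inner (x - w) (y - w) > 0" "inner (y - w) (z - w) > 0"
  shows "ccw w x z"
proof -
  let ?n = "(Re y - Re w)^2 + (Im y - Im w)^2"
  have "0 < orient w x y * inner (y - w) (z - w) + orient w y z * inner (x - w) (y - w)"
    using assms by (simp add: add_pos_pos)
  also have "\<dots> = ?n * orient w x z"
    by (simp add: orient_def inner_complex_def power2_eq_square algebra_simps)
  finally show ?thesis
    by (metis not_sum_power2_lt_zero zero_less_mult_iff)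
qed

section \<open>Labelled configurations and their axioms\<close>

text \<open>The hub is 0; the rim vertices are 1, \<open>\<dots>\<close>, 8 in the order a0, b0, \<open>\<dots>\<close>, a3, b3.\<close>
definition adj :: "nat \<Rightarrow> nat \<Rightarrow> bool" where
  "adj i j \<longleftrightarrow> i \<le> 8 \<and> j \<le> 8 \<and> i \<noteq> j \<and> (i = 0 \<or> j = 0 \<or> (j + 8 - i) mod 8 \<in> {1, 2, 6, 7})"

abbreviation ccw_at :: "(nat \<Rightarrow> complex) \<Rightarrow> nat \<Rightarrow> nat \<Rightarrow> nat \<Rightarrow> bool" where
  "ccw_at p i j k \<equiv> ccw (p i) (p j) (p k)"

abbreviation cross_at :: "(nat \<Rightarrow> complex) \<Rightarrow> nat \<Rightarrow> nat \<Rightarrow> nat \<Rightarrow> nat \<Rightarrow> bool" where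
  "cross_at p i j k l \<equiv> crosses (p i) (p j) (p k) (p l)"

lemma le_8_cases: "(i::nat) \<le> 8 \<longleftrightarrow> i \<in> {0, 1, 2, 3, 4, 5, 6, 7, 8}"
  by auto

lemma adj_sym: "adj i j \<Longrightarrow> adj j i"
  unfolding adj_def le_8_cases by (elim conjE insertE emptyE) simp_all

lemma adj_le: "adj a b \<Longrightarrow> a \<le> 8 \<and> b \<le> 8 \<and> a \<noteq> b"
  by (auto simp: adj_def)

definition triangle :: "nat \<Rightarrow> nat \<Rightarrow> nat \<Rightarrow> bool" where
  "triangle x y z \<longleftrightarrow> adj x y \<and> adj y z \<and> adj z x"

text \<open>The symmetries of the 8-cycle that fix the hub: shift by \<open>k\<close>, after a
  reflection fixing 1 if \<open>s\<close> holds. On naturals 7 stands for -1 modulo 8, and the final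
  \<open>+ 1\<close> returns to the labels 1 to 8; \<open>dihedral 0 False\<close> is the identity
  on the labels.\<close>

definition dihedral :: "nat \<Rightarrow> bool \<Rightarrow> nat \<Rightarrow> nat" where
  "dihedral k s i = (if i = 0 then 0 else (k + (if s then 1 + 7 * i else 7 + i)) mod 8 + 1)"

text \<open>The assumption \<open>acute\<close> names one angle of a crossing. Exchanging the two
  edges and their ends gives all eight angles between an edge and a side of the convex quadrilateral
  of the four endpoints.\<close>

locale antiprism_config =
  fixes p :: "nat \<Rightarrow> complex"
  assumes general_position:
      "i \<le> 8 \<Longrightarrow> j \<le> 8 \<Longrightarrow> k \<le> 8 \<Longrightarrow> i \<noteq> j \<Longrightarrow> j \<noteq> k \<Longrightarrow> i \<noteq> k \<Longrightarrow> orient (p i) (p j) (p k) \<noteq> 0"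
    and no_fan_crossing:
      "adj a b \<Longrightarrow> adj u v \<Longrightarrow> adj u w \<Longrightarrow> v \<noteq> w \<Longrightarrow>
       \<not> (cross_at p a b u v \<and> cross_at p a b u w)"
    and acute:
      "adj a b \<Longrightarrow> adj u v \<Longrightarrow> cross_at p a b u v \<Longrightarrow> inner (p v - p u) (p a - p u) > 0"
begin

abbreviation inside :: "nat \<Rightarrow> nat \<Rightarrow> nat \<Rightarrow> nat \<Rightarrow> bool" where
  "inside x y z d \<equiv> in_triangle (p x) (p y) (p z) (p d)"

lemma ccw_neg:
  assumes "i \<le> 8" "j \<le> 8" "k \<le> 8" "i \<noteq> j" "j \<noteq> k" "i \<noteq> k"
  shows "ccw_at p j i k \<longleftrightarrow> \<not> ccw_at p i j k"
  using general_position[OF assms] orient_swap[of "p i" "p j" "p k"] by auto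

lemma ccw_neg':
  assumes "i \<le> 8" "j \<le> 8" "k \<le> 8" "i \<noteq> j" "j \<noteq> k" "i \<noteq> k"
  shows "ccw_at p i k j \<longleftrightarrow> \<not> ccw_at p i j k"
  using general_position[OF assms] orient_swap'[of "p i" "p k" "p j"] by auto

text \<open>Normal form with increasing indices: each triple contributes one propositional variable,
  so different facts simplify to clauses over common literals.\<close>

lemma ccw_sort:
  "j < i \<Longrightarrow> i \<le> 8 \<Longrightarrow> k \<le> 8 \<Longrightarrow> k \<noteq> i \<Longrightarrow> k \<noteq> j \<Longrightarrow> ccw_at p i j k \<longleftrightarrow> \<not> ccw_at p j i k"
  "k < j \<Longrightarrow> i \<le> 8 \<Longrightarrow> j \<le> 8 \<Longrightarrow> i \<noteq> j \<Longrightarrow> i \<noteq> k \<Longrightarrow> ccw_at p i j k \<longleftrightarrow> \<not> ccw_at p i k j"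
  using ccw_neg[of j i k] ccw_neg'[of i k j] by auto

section \<open>Edges that leave a triangle\<close>

lemma leaving_edge_crosses_aux:
  assumes le: "x \<le> 8" "y \<le> 8" "z \<le> 8" "a \<le> 8" "b \<le> 8" and d: "distinct [x, y, z, a, b]"
    and b: "ccw_at p x y b" "ccw_at p y z b" "ccw_at p z x b" and out: "\<not> inside x y z a"
    and w: "ccw_at p b x a" "\<not> ccw_at p b y a"
  shows "cross_at p b a x y"
proof -
  have b': "ccw_at p b x y" "ccw_at p b y z" "ccw_at p b z x"
    using b by (simp_all add: orient_rotate)
  have xyz: "ccw_at p x y z" using b ccw_interior b' by (metis orient_rotate)
  have w': "ccw_at p b a y" using w ccw_neg'[of b y a] le d by auto
  \<comment> \<open>On the inner side of \<open>xy\<close>, \<open>a\<close> would lie in the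
    triangle \<open>b x y\<close> and hence inside \<open>x y z\<close>.\<close>
  have "\<not> ccw_at p x y a"
  proof
    assume c: "ccw_at p x y a"
    have 1: "ccw_at p y z a"
      by (rule ccw_subtriangle[of "p b" "p x" "p y" "p z" "p a"])
         (use b b' c w w' xyz in \<open>simp_all add: orient_rotate\<close>)
    have "ccw_at p z x a"
    proof -
      have "0 < orient (p b) (p x) (p a) * orient (p z) (p x) (p y)
             + orient (p a) (p x) (p y) * orient (p z) (p x) (p b)"
        using b c w w' xyz by (simp add: orient_rotate add_pos_pos)
      also have "\<dots> = orient (p b) (p x) (p y) * orient (p z) (p x) (p a)"
        by (simp add: orient_def algebra_simps)
      finally show ?thesis using b'(1) by (simp add: zero_less_mult_iff)
    qed
    with 1 c out show False by (auto simp: in_triangle_def)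
  qed
  then have "ccw_at p y x a" using ccw_neg[of x y a] le d by auto
  then show ?thesis
    using w w' b by (auto simp: crosses_def orient_rotate orient_rotate')
qed

text \<open>The rays from \<open>b\<close> through the corners cut the plane into three convex
  wedges; \<open>ba\<close> leaves through the side that spans the wedge of
  \<open>a\<close>.\<close>

lemma leaving_edge_crosses_ccw:
  assumes le: "x \<le> 8" "y \<le> 8" "z \<le> 8" "a \<le> 8" "b \<le> 8" and d: "distinct [x, y, z, a, b]"
    and b: "ccw_at p x y b" "ccw_at p y z b" "ccw_at p z x b"
    and out: "\<not> inside x y z a"
  shows "cross_at p b a x y \<or> cross_at p b a y z \<or>
    cross_at p b a z x"
proof -
  have b': "ccw_at p b x y" "ccw_at p b y z" "ccw_at p b z x"
    using b by (simp_all add: orient_rotate)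
  have out': "\<not> inside y z x a" "\<not> inside z x y a"
    using out in_triangle_rotate by metis+
  have neg: "\<not> (ccw_at p b a x \<and> ccw_at p b a y \<and> ccw_at p b a z)"
  proof
    assume "ccw_at p b a x \<and> ccw_at p b a y \<and> ccw_at p b a z"
    then have "orient (p b) (p x) (p y) * orient (p b) (p a) (p z) + orient (p b) (p y) (p z) *
      orient (p b) (p a) (p x)
       + orient (p b) (p z) (p x) * orient (p b) (p a) (p y) > 0"
      using b' by (simp add: add_pos_pos)
    moreover have "orient (p b) (p x) (p y) * orient (p b) (p a) (p z) + orient (p b) (p y) (p z) *
      orient (p b) (p a) (p x)
       + orient (p b) (p z) (p x) * orient (p b) (p a) (p y) = 0" by (simp add: orient_def algebra_simps)
    ultimately show False by simp
  qed
  \<comment> \<open>The three signs are not all equal, so somewhere round the triangle a positive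
    one is followed by a negative one; this marks the wedge.\<close>
  have "ccw_at p b x a \<and> \<not> ccw_at p b y a \<or> ccw_at p b y a \<and> \<not> ccw_at p b z a
     \<or> ccw_at p b z a \<and> \<not> ccw_at p b x a"
    using ccw_positive_span[OF b'] neg ccw_neg'[of b x a] ccw_neg'[of b y a] ccw_neg'[of b z a]
      le d by auto
  then show ?thesis
    using leaving_edge_crosses_aux[of x y z a b] leaving_edge_crosses_aux[of y z x a b]
      leaving_edge_crosses_aux[of z x y a b] le d b out out' by auto
qed

lemma leaving_edge_crosses:
  assumes "x \<le> 8" "y \<le> 8" "z \<le> 8" "a \<le> 8" "b \<le> 8" "distinct [x, y, z, a, b]"
  shows "inside x y z b \<longrightarrow> inside x y z a \<or> cross_at p b a x y \<or>
    cross_at p b a y z \<or> cross_at p b a z x"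
proof (intro impI)
  assume i: "inside x y z b"
  have "\<not> inside y x z a \<longleftrightarrow> \<not> inside x y z a" by (auto simp: in_triangle_def)
  then show "inside x y z a \<or> cross_at p b a x y \<or>
    cross_at p b a y z \<or> cross_at p b a z x"
    using i leaving_edge_crosses_ccw[of x y z a b] leaving_edge_crosses_ccw[of y x z a b] assms
    unfolding in_triangle_def[of "p x" "p y" "p z" "p b"] by (auto simp: crosses_sym(3))
qed

text \<open>\<open>a\<close> lies beyond both sides at the corner \<open>x\<close>. Turning there
  from one side to the other through \<open>a\<close> goes round the exterior, which is more than a
  half-turn, yet it consists of two acute angles.\<close>

lemma no_two_sides:
  assumes "triangle x y z" "adj a b" "adj a d" "distinct [x, y, z, a, b, d]"
    and "inside x y z b" "inside x y z d"
    and "cross_at p a b x y" "cross_at p a d x z"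
  shows False
proof -
  have t: "adj x y" "adj x z" using assms(1) adj_sym by (auto simp: triangle_def)
  have "inner (p y - p x) (p a - p x) > 0" "inner (p z - p x) (p a - p x) > 0"
    using acute assms(2,3,7,8) t by blast+
  then have ac: "inner (p y - p x) (p a - p x) > 0" "inner (p a - p x) (p z - p x) > 0"
    "inner (p z - p x) (p a - p x) > 0" "inner (p a - p x) (p y - p x) > 0"
    by (simp_all add: inner_commute)
  have ori: "ccw u v w = ccw v w u" "ccw u v w \<Longrightarrow> \<not> ccw v u w" for u v w
    using orient_rotate orient_swap[of u v w] by auto
  have b: "ccw_at p x y z \<and> ccw_at p x y b \<and> ccw_at p z x d \<or>
           ccw_at p x z y \<and> ccw_at p y x b \<and> ccw_at p x z d"
    using assms(5,6) ccw_interior[of "p b" "p y" "p z" "p x"] ccw_interior[of "p b" "p z" "p y" "p x"]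
      ccw_interior[of "p d" "p y" "p z" "p x"] ccw_interior[of "p d" "p z" "p y" "p x"] ori
    unfolding in_triangle_def by smt
  show False
    using b
  proof
    assume *: "ccw_at p x y z \<and> ccw_at p x y b \<and> ccw_at p z x d"
    then have "ccw_at p x a y" "ccw_at p x z a"
      using assms(7,8) ori unfolding crosses_def by metis+
    then have "ccw_at p x z y" using ccw_acute_add ac by blast
    with * show False using ori by metis
  next
    assume *: "ccw_at p x z y \<and> ccw_at p y x b \<and> ccw_at p x z d"
    then have "ccw_at p x y a" "ccw_at p x a z"
      using assms(7,8) ori unfolding crosses_def by metis+
    then have "ccw_at p x y z" using ccw_acute_add ac by blast
    with * show False using ori by metis
  qed
qed

text \<open>Two edges from an outside vertex into the triangle would cross the same side, which is a
  fan crossing, or two sides with a common corner, the case of \<open>no_two_sides\<close>.\<close>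

lemma outside_vertex_one_neighbour_inside:
  assumes "triangle x y z" "adj a b" "adj a d" "distinct [x, y, z, a, b, d]"
  shows "inside x y z b \<longrightarrow> inside x y z d \<longrightarrow> inside x y z a"
proof (intro impI, rule ccontr)
  assume b: "inside x y z b" and d: "inside x y z d" and a: "\<not> inside x y z a"
  have t: "adj x y" "adj y z" "adj z x" "adj y x" "adj z y" "adj x z"
    using assms(1) adj_sym by (auto simp: triangle_def)
  have le: "x \<le> 8" "y \<le> 8" "z \<le> 8" "a \<le> 8" "b \<le> 8" "d \<le> 8"
    using assms(1-3) adj_le by (auto simp: triangle_def)
  have fan: "\<not> (cross_at p a b u v \<and> cross_at p a d u v)" if "adj u v" for u v
    using no_fan_crossing[of u v a b d] that assms(2-4) crosses_sym by auto
  have cb: "cross_at p a b x y \<or> cross_at p a b y z \<or> cross_at p a b z x"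
    using leaving_edge_crosses[of x y z a b] le assms(4) a b crosses_sym(2) by auto
  have cd: "cross_at p a d x y \<or> cross_at p a d y z \<or> cross_at p a d z x"
    using leaving_edge_crosses[of x y z a d] le assms(4) a d crosses_sym(2) by auto
  have two: False if "cross_at p a b u v" "cross_at p a d u w"
    and "(u, v, w) \<in> {(x, y, z), (x, z, y), (y, x, z), (y, z, x), (z, x, y), (z, y, x)}" for u v w
  proof (rule no_two_sides[OF _ assms(2,3) _ _ _ that(1,2)])
    show "triangle u v w" "distinct [u, v, w, a, b, d]" using that assms t by (auto simp: triangle_def)
    have "inside u v w q = inside x y z q" for q using that(3) by (auto simp: in_triangle_def)
    then show "inside u v w b" "inside u v w d" using b d by simp_all
  qed
  show False
    using cb cd fan[OF t(1)] fan[OF t(2)] fan[OF t(3)] two[of x y z] two[of x z y] two[of y x z]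
      two[of y z x]
      two[of z x y] two[of z y x] crosses_sym(3) by auto
qed

text \<open>Pigeonhole: of four edges leaving through three sides, two cross the same side and form
  a fan.\<close>

lemma inside_vertex_three_neighbours_outside:
  assumes "triangle x y z" "adj b a1" "adj b a2" "adj b a3" "adj b a4" "distinct [x, y, z, b, a1,
    a2, a3, a4]"
  shows "inside x y z b \<longrightarrow> inside x y z a1 \<or> inside x y z a2 \<or> inside x y z a3 \<or> inside x y z a4"
proof (intro impI, rule ccontr)
  assume b: "inside x y z b"
    and out: "\<not> (inside x y z a1 \<or> inside x y z a2 \<or> inside x y z a3 \<or> inside x y z a4)"
  have t: "adj x y" "adj y z" "adj z x" using assms(1) by (auto simp: triangle_def)
  have c: "cross_at p x y b a \<or> cross_at p y z b a \<or> cross_at p z x b a"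
    if "a \<in> {a1, a2, a3, a4}" for a
  proof -
    have "adj b a" "\<not> inside x y z a" "distinct [x, y, z, a, b]" using that assms out by auto
    then show ?thesis
      using leaving_edge_crosses[of x y z a b] b t adj_le[of b a] adj_le[of x y] adj_le[of y z]
        crosses_sym(1) by auto
  qed
  have fan: "\<not> (cross_at p u v b a \<and> cross_at p u v b a')"
    if "adj u v" "a \<in> {a1, a2, a3, a4}" "a' \<in> {a1, a2, a3, a4}" "a \<noteq> a'" for u v a a'
    using that assms by (intro no_fan_crossing) auto
  have fan2: "\<not> (cross_at p x y b a \<and> cross_at p x y b a') \<and>
      \<not> (cross_at p y z b a \<and> cross_at p y z b a') \<and>
      \<not> (cross_at p z x b a \<and> cross_at p z x b a')"
    if "a \<in> {a1, a2, a3, a4} \<and> a' \<in> {a1, a2, a3, a4} \<and> a \<noteq> a'" for a a'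
    using that by (intro conjI fan t) simp_all
  show False
    using c[of a1, simplified] c[of a2, simplified] c[of a3, simplified] c[of a4, simplified]
      fan2[of a1 a2] fan2[of a1 a3] fan2[of a1 a4] fan2[of a2 a3] fan2[of a2 a4] fan2[of a3 a4] assms(6)
    by simp sat
qed

lemma antiprism_config_relabel:
  assumes le: "\<And>i. i \<le> 8 \<Longrightarrow> f i \<le> 8" and inj: "inj_on f {..8}"
    and adj: "\<And>i j. adj i j \<Longrightarrow> adj (f i) (f j)"
  shows "antiprism_config (p \<circ> f)"
proof
  fix i j l :: nat assume "i \<le> 8" "j \<le> 8" "l \<le> 8" "i \<noteq> j" "j \<noteq> l" "i \<noteq> l"
  then show "orient ((p \<circ> f) i) ((p \<circ> f) j) ((p \<circ> f) l) \<noteq> 0"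
    using le inj by (simp add: general_position inj_on_eq_iff)
next
  fix a b u v w assume "adj a b" "adj u v" "adj u w" "v \<noteq> w"
  then show "\<not> (crosses ((p \<circ> f) a) ((p \<circ> f) b) ((p \<circ> f) u) ((p \<circ> f) v) \<and>
      crosses ((p \<circ> f) a) ((p \<circ> f) b) ((p \<circ> f) u) ((p \<circ> f) w))"
    using no_fan_crossing[OF adj adj adj, of a b u v w] inj_on_eq_iff[OF inj, of v w] adj_le by auto
next
  fix a b u v assume "adj a b" "adj u v"
    "crosses ((p \<circ> f) a) ((p \<circ> f) b) ((p \<circ> f) u) ((p \<circ> f) v)"
  then show "0 < inner ((p \<circ> f) v - (p \<circ> f) u) ((p \<circ> f) a - (p \<circ> f) u)"
    using acute[OF adj adj] by simp
qed

end

section \<open>Symmetry reductions by relabelling and conjugation\<close>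

lemma dihedral_Suc: "dihedral (Suc k) s = dihedral 1 False \<circ> dihedral k s"
  by (auto simp: dihedral_def fun_eq_iff mod_simps)

lemma dihedral_le: "dihedral k s i \<le> 8"
  by (simp add: dihedral_def Suc_le_eq)

text \<open>Adjacency is checked for shift zero and for the shift by one; the induction composes
  shifts.\<close>

lemma antiprism_config_dihedral:
  assumes "antiprism_config p"
  shows "antiprism_config (p \<circ> dihedral k s)"
  using assms
proof (induction k arbitrary: p)
  case 0
  have "adj (dihedral 0 s i) (dihedral 0 s j)" if "adj i j" for i j
    using that unfolding adj_def le_8_cases dihedral_def by (elim insertE emptyE conjE; cases s) simp_all
  moreover have "inj_on (dihedral 0 s) {..8}"
    unfolding inj_on_def atMost_iff Ball_def le_8_cases dihedral_def
    by (intro allI impI, elim insertE emptyE; cases s) simp_all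
  ultimately show ?case
    by (intro antiprism_config.antiprism_config_relabel[OF 0]) (simp_all add: dihedral_le)
next
  case (Suc k)
  have "adj (dihedral 1 False i) (dihedral 1 False j)" if "adj i j" for i j
    using that unfolding adj_def le_8_cases dihedral_def by (elim insertE emptyE conjE) simp_all
  moreover have "inj_on (dihedral 1 False) {..8}"
    unfolding inj_on_def atMost_iff Ball_def le_8_cases dihedral_def
    by (intro allI impI, elim insertE emptyE) simp_all
  ultimately have "antiprism_config (p \<circ> dihedral 1 False)"
    by (intro antiprism_config.antiprism_config_relabel[OF Suc.prems]) (simp_all add: dihedral_le)
  from Suc.IH[OF this] show ?case by (simp only: dihedral_Suc o_assoc)
qed

lemma orient_cnj: "orient (cnj x) (cnj y) (cnj z) = - orient x y z"
  by (simp add: orient_def algebra_simps)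

lemma crosses_cnj: "crosses (cnj a) (cnj b) (cnj u) (cnj v) = crosses a b u v"
proof -
  have "orient b u a = - orient a u b" "orient v b u = - orient u b v"
    "orient a v b = - orient b v a" "orient u a v = - orient v a u"
    by (simp_all add: orient_def algebra_simps)
  then show ?thesis by (simp add: crosses_def orient_cnj disj_commute conj_ac)
qed

lemma (in antiprism_config) antiprism_config_cnj: "antiprism_config (cnj \<circ> p)"
proof
  fix i j l :: nat assume "i \<le> 8" "j \<le> 8" "l \<le> 8" "i \<noteq> j" "j \<noteq> l" "i \<noteq> l"
  then show "orient ((cnj \<circ> p) i) ((cnj \<circ> p) j) ((cnj \<circ> p) l) \<noteq> 0"
    by (simp add: general_position orient_cnj)
next
  fix a b u v w assume "adj a b" "adj u v" "adj u w" "v \<noteq> w"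
  then show "\<not> (crosses ((cnj \<circ> p) a) ((cnj \<circ> p) b) ((cnj \<circ> p) u) ((cnj \<circ> p) v) \<and>
      crosses ((cnj \<circ> p) a) ((cnj \<circ> p) b) ((cnj \<circ> p) u) ((cnj \<circ> p) w))"
    using no_fan_crossing by (simp add: crosses_cnj)
next
  fix a b u v assume "adj a b" "adj u v"
    "crosses ((cnj \<circ> p) a) ((cnj \<circ> p) b) ((cnj \<circ> p) u) ((cnj \<circ> p) v)"
  then show "0 < inner ((cnj \<circ> p) v - (cnj \<circ> p) u) ((cnj \<circ> p) a - (cnj \<circ> p) u)"
    using acute[of a b u v] by (simp add: crosses_cnj inner_complex_def algebra_simps)
qed

text \<open>Conjugation reverses all orientations and preserves the axioms, so the triangle may be
  taken counterclockwise.\<close>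

lemma not_in_triangle_wlog:
  assumes "\<And>p. antiprism_config p \<Longrightarrow> ccw_at p x y d \<Longrightarrow> ccw_at p y z d \<Longrightarrow>
      ccw_at p z x d \<Longrightarrow> False"
    and "antiprism_config p"
  shows "\<not> in_triangle (p x) (p y) (p z) (p d)"
proof
  assume "in_triangle (p x) (p y) (p z) (p d)"
  then show False
    using assms(1)[OF assms(2)] assms(1)[OF antiprism_config.antiprism_config_cnj[OF assms(2)]]
      orient_swap[of "p x" "p y" "p d"] orient_swap[of "p y" "p z" "p d"] orient_swap[of "p z" "p x"
        "p d"]
    by (auto simp: in_triangle_def orient_cnj)
qed

lemma not_crosses_wlog:
  assumes "\<And>p. antiprism_config p \<Longrightarrow> ccw_at p a u b \<Longrightarrow> ccw_at p u b v \<Longrightarrow>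
      ccw_at p b v a \<Longrightarrow> ccw_at p v a u \<Longrightarrow> False"
    and "antiprism_config p"
  shows "\<not> cross_at p a b u v"
proof -
  have "orient (p b) (p u) (p a) = - orient (p a) (p u) (p b)" "orient (p v) (p b) (p u) =
    - orient (p u) (p b) (p v)"
    "orient (p a) (p v) (p b) = - orient (p b) (p v) (p a)" "orient (p u) (p a) (p v) =
      - orient (p v) (p a) (p u)"
    by (simp_all add: orient_def algebra_simps)
  then show ?thesis
    using assms(1)[OF assms(2)] assms(1)[OF antiprism_config.antiprism_config_cnj[OF assms(2)]]
    by (auto simp: crosses_def orient_cnj)
qed

section \<open>Excluded positions of single vertices and spokes\<close>

context antiprism_config
begin

text \<open>Replaces the two senses in \<open>in_triangle\<close> by agreement with the sign of the
  triangle. Equal signs at the three sides pass to the triangle because the signed areas add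
  up.\<close>

lemma inside_iff:
  assumes "x \<le> 8" "y \<le> 8" "z \<le> 8" "d \<le> 8" "distinct [x, y, z, d]"
  shows "inside x y z d \<longleftrightarrow> (ccw_at p x y d \<longleftrightarrow> ccw_at p x y z) \<and>
     (ccw_at p y z d \<longleftrightarrow> ccw_at p x y z) \<and> (ccw_at p z x d \<longleftrightarrow> ccw_at p x y z)"
proof -
  have "orient (p x) (p y) (p z) = orient (p x) (p y) (p d) + orient (p y) (p z) (p d) + orient (p
    z) (p x) (p d)"
    by (simp add: orient_def algebra_simps)
  then show ?thesis
    using ccw_neg[of x y d] ccw_neg[of y z d] ccw_neg[of z x d] assms
    unfolding in_triangle_def by auto
qed

lemma sides_sign:
  assumes "x \<le> 8" "y \<le> 8" "z \<le> 8" "d \<le> 8" "distinct [x, y, z, d]"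
  shows "(ccw_at p x y d \<and> ccw_at p y z d \<and> ccw_at p z x d \<longrightarrow> ccw_at p x y z) \<and>
    (\<not> ccw_at p x y d \<and> \<not> ccw_at p y z d \<and> \<not> ccw_at p z x d \<longrightarrow> \<not> ccw_at p x y z)"
proof -
  have "orient (p x) (p y) (p z) = orient (p x) (p y) (p d) + orient (p y) (p z) (p d) + orient (p
    z) (p x) (p d)"
    by (simp add: orient_def algebra_simps)
  then show ?thesis by auto
qed

lemma trans:
  "ccw_at p a b c \<and> ccw_at p a b d \<and> ccw_at p a b e \<and> ccw_at p a c d \<and>
   ccw_at p a d e \<longrightarrow> ccw_at p a c e"
  using ccw_trans by blast

lemma trans':
  "ccw_at p a c b \<and> ccw_at p a d b \<and> ccw_at p a e b \<and> ccw_at p a c d \<and>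
   ccw_at p a d e \<longrightarrow> ccw_at p a c e"
  using ccw_trans' by blast

lemma interior:
  "ccw_at p t j k \<and> ccw_at p i t k \<and> ccw_at p i j t \<longrightarrow> ccw_at p i j k"
  using ccw_interior by blast

lemmas one_inside = outside_vertex_one_neighbour_inside
lemmas three_outside = inside_vertex_three_neighbours_outside

text \<open>Makes the sign of an inner product an opaque atom for the propositional
  arguments.\<close>

definition acute_angle :: "nat \<Rightarrow> nat \<Rightarrow> nat \<Rightarrow> bool" where
  "acute_angle w x y \<longleftrightarrow> 0 < inner (p x - p w) (p y - p w)"

lemma acute_angle_sort: "y < x \<Longrightarrow> acute_angle w x y = acute_angle w y x"
  by (simp add: acute_angle_def inner_commute)

lemma acute_at:
  assumes "adj a b" "adj w v"
  shows "cross_at p a b w v \<longrightarrow> acute_angle w v a"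
  using acute[OF assms] by (simp add: acute_angle_def)

lemma acute_add:
  "acute_angle w x y \<and> acute_angle w y z \<and> ccw_at p w x y \<and> ccw_at p w y z \<longrightarrow>
   ccw_at p w x z"
  unfolding acute_angle_def using ccw_acute_add by blast

context
  notes ccw_sort [simp] and acute_angle_sort [simp] and adj_def [simp] and triangle_def [simp]
    and inside_iff [simp] and crosses_def [simp] and dihedral_def [simp]
      and numeral_2_eq_2 [symmetric, simp]
begin

text \<open>In each of the following proofs the listed instances form an unsatisfiable set of clauses
  in the orientations of the triples.\<close>
lemma not_all_inside:
  assumes "\<forall>d\<in>{0, 4, 5, 6, 7, 8}. ccw_at p 1 2 d \<and> ccw_at p 2 3 d \<and> ccw_at p 3 1 d"
  shows False
proof -
  note F =
      one_inside[of 0 1 2 3 4 5] one_inside[of 0 1 2 4 5 6] one_inside[of 0 1 2 5 4 6]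
      one_inside[of 0 1 2 5 6 7] one_inside[of 0 1 2 7 6 8] one_inside[of 0 1 3 2 4 8]
      one_inside[of 0 1 3 4 5 6] one_inside[of 0 1 3 5 4 6] one_inside[of 0 1 3 5 6 7]
      one_inside[of 0 1 3 7 5 6] one_inside[of 0 1 3 7 6 8] one_inside[of 0 1 3 8 6 7]
      one_inside[of 0 2 3 1 7 8] one_inside[of 0 2 3 5 4 6] one_inside[of 0 2 3 7 5 6]
      one_inside[of 0 2 3 7 6 8] one_inside[of 0 2 3 8 6 7] three_outside[of 0 1 2 6 4 5 7 8]
      three_outside[of 0 1 3 6 4 5 7 8] three_outside[of 0 2 3 6 4 5 7 8] sides_sign[of 0 1 2 6]
      sides_sign[of 0 1 3 6] sides_sign[of 0 2 3 6] trans[of 6 0 1 2 3] trans'[of 6 2 0 3 1]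
  show False using assms[simplified] F[simplified] by satx
qed

text \<open>At least one of the hub's neighbours 4, 5, 6, 7 is inside. Together with the hub each of
  them draws in the next in the cycle 4, 5, 7, 6, and 7 draws in 8. So everything would be inside,
  against \<open>not_all_inside\<close>.\<close>

lemma hub_not_inside_ccw:
  assumes "ccw_at p 1 2 0" "ccw_at p 2 3 0" "ccw_at p 3 1 0"
  shows False
proof -
  note F =
      not_all_inside one_inside[of 1 2 3 4 0 6] one_inside[of 1 2 3 5 0 4]
      one_inside[of 1 2 3 6 0 7] one_inside[of 1 2 3 7 0 5] one_inside[of 1 2 3 8 0 7]
      three_outside[of 1 2 3 0 4 5 6 7] interior[of 2 1 3 0] sides_sign[of 1 2 3 0]
  show False using assms[simplified] F[simplified] by satx
qed

lemma hub_not_inside: "\<not> inside (dihedral k s 1) (dihedral k s 2) (dihedral k s 3) (dihedral k s 0)"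
  using not_in_triangle_wlog[of 1 2 0 3, OF antiprism_config.hub_not_inside_ccw
      antiprism_config_dihedral[OF antiprism_config_axioms]]
  by (simp only: o_apply not_False_eq_True)

text \<open>With 4 or 7 inside too, the outside hub would have two neighbours inside; with 6 inside,
  4 would follow. So 5 would have its four neighbours 0, 4, 6, 7 outside, one too many.\<close>

lemma distance_two_not_inside_ccw:
  assumes "ccw_at p 1 2 5" "ccw_at p 2 3 5" "ccw_at p 3 1 5"
  shows False
proof -
  note F =
      hub_not_inside[of 0 False] one_inside[of 1 2 3 0 4 5] one_inside[of 1 2 3 0 5 7]
      one_inside[of 1 2 3 4 5 6] three_outside[of 1 2 3 5 0 4 6 7] interior[of 1 5 3 2]
      sides_sign[of 1 2 3 0] sides_sign[of 1 2 3 5]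
  show False using assms[simplified] F[simplified] by satx
qed

lemma distance_two_not_inside: "\<not> inside (dihedral k s 1) (dihedral k s 2) (dihedral k s 3)
  (dihedral k s 5)"
  using not_in_triangle_wlog[of 1 2 5 3, OF antiprism_config.distance_two_not_inside_ccw
      antiprism_config_dihedral[OF antiprism_config_axioms]]
  by (simp only: o_apply not_False_eq_True)

text \<open>The outside vertex 5 is adjacent to 6, hence to nothing else inside; this puts 0, 4, 7
  outside. Then 6 has the four neighbours 0, 4, 5, 7 outside.\<close>

lemma distance_three_not_inside_ccw:
  assumes "ccw_at p 1 2 6" "ccw_at p 2 3 6" "ccw_at p 3 1 6"
  shows False
proof -
  note F =
      distance_two_not_inside[of 0 False] one_inside[of 1 2 3 5 0 6] one_inside[of 1 2 3 5 4 6]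
      one_inside[of 1 2 3 5 6 7] three_outside[of 1 2 3 6 0 4 5 7] interior[of 2 3 6 1]
      sides_sign[of 1 2 3 5] sides_sign[of 1 2 3 6]
  show False using assms[simplified] F[simplified] by satx
qed

lemma distance_three_not_inside: "\<not> inside (dihedral k s 1) (dihedral k s 2) (dihedral k s 3)
  (dihedral k s 6)"
  using not_in_triangle_wlog[of 1 2 6 3, OF antiprism_config.distance_three_not_inside_ccw
      antiprism_config_dihedral[OF antiprism_config_axioms]]
  by (simp only: o_apply not_False_eq_True)

text \<open>Two neighbours of 4 are corners of the triangle, and the remaining three, 0, 5, 6, may
  all be outside without violating the count. The contradiction therefore also needs individual
  crossings and the transitivity of signs.\<close>

lemma next_not_inside_ccw:
  assumes "ccw_at p 1 2 4" "ccw_at p 2 3 4" "ccw_at p 3 1 4"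
  shows False
proof -
  note F =
      hub_not_inside[of 2 False] distance_two_not_inside[of 0 False]
      distance_two_not_inside[of 4 True] distance_two_not_inside[of 5 True]
      distance_three_not_inside[of 0 False] distance_three_not_inside[of 3 False]
      one_inside[of 0 1 3 6 4 5] one_inside[of 0 2 3 6 4 5] one_inside[of 0 3 4 1 2 8]
      one_inside[of 0 3 4 2 1 8] one_inside[of 0 3 4 8 1 6] one_inside[of 0 3 4 8 2 6]
      one_inside[of 1 2 3 6 0 4] leaving_edge_crosses[of 0 2 3 5 4]
      leaving_edge_crosses[of 1 2 3 0 4] no_fan_crossing[of 0 2 5 3 4] no_fan_crossing[of 1 2 0 3 4]
      no_fan_crossing[of 1 2 4 5 6] no_fan_crossing[of 1 2 5 3 4] no_fan_crossing[of 1 2 5 4 6]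
      no_fan_crossing[of 1 2 6 4 5] no_fan_crossing[of 1 3 4 0 5] no_fan_crossing[of 1 3 4 0 6]
      no_fan_crossing[of 1 3 4 5 6] no_fan_crossing[of 1 3 5 4 6] no_fan_crossing[of 2 3 4 0 5]
      no_fan_crossing[of 2 3 4 0 6] no_fan_crossing[of 2 3 4 5 6] no_fan_crossing[of 2 3 5 4 6]
      no_fan_crossing[of 4 5 3 0 1] no_fan_crossing[of 4 5 3 0 2] no_fan_crossing[of 4 6 3 0 1]
      no_fan_crossing[of 4 6 3 0 2] interior[of 3 5 6 4] interior[of 4 2 3 1] sides_sign[of 0 1 3 4]
      sides_sign[of 0 1 3 5] sides_sign[of 0 2 3 4] sides_sign[of 0 2 3 5] sides_sign[of 0 3 4 1]
      sides_sign[of 0 3 4 2] sides_sign[of 0 3 4 6] sides_sign[of 1 2 3 0] sides_sign[of 1 2 3 4]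
      sides_sign[of 1 2 3 5] sides_sign[of 1 2 3 6] sides_sign[of 3 4 5 0] sides_sign[of 3 4 5 1]
      sides_sign[of 4 5 6 1] sides_sign[of 4 5 6 2] trans[of 0 3 1 5 4] trans[of 1 2 3 6 4]
      trans[of 1 5 2 4 6] trans[of 2 3 1 5 4] trans[of 2 3 1 6 4] trans[of 2 5 3 4 6]
      trans[of 2 6 3 4 5] trans[of 3 0 2 5 4] trans[of 3 1 0 4 2] trans[of 3 1 2 6 4]
      trans[of 3 1 4 2 5] trans[of 3 4 2 5 6] trans[of 4 0 1 2 3] trans[of 4 3 0 6 1]
      trans[of 5 1 3 6 4] trans[of 6 4 1 3 5] trans'[of 1 2 3 4 6] trans'[of 1 4 3 5 2]
      trans'[of 2 3 1 4 5] trans'[of 2 3 1 4 6] trans'[of 2 3 6 4 5] trans'[of 3 0 2 1 4]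
      trans'[of 3 1 0 2 5] trans'[of 3 1 2 4 6] trans'[of 3 4 2 5 1] trans'[of 4 0 3 2 6]
      trans'[of 4 1 2 6 5] trans'[of 4 1 6 5 3] trans'[of 4 2 3 5 0] trans'[of 4 3 0 1 2]
  show False using assms[simplified] F[simplified] by satx
qed

lemma next_not_inside: "\<not> inside (dihedral k s 1) (dihedral k s 2) (dihedral k s 3) (dihedral k s 4)"
  using not_in_triangle_wlog[of 1 2 4 3, OF antiprism_config.next_not_inside_ccw
      antiprism_config_dihedral[OF antiprism_config_axioms]]
  by (simp only: o_apply not_False_eq_True)

text \<open>All three corners are neighbours of 1, which leaves only 7 and 8, so the count of
  leaving edges is again of no help.\<close>

lemma not_inside_hub_triangle_ccw:
  assumes "ccw_at p 0 2 1" "ccw_at p 2 3 1" "ccw_at p 3 0 1"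
  shows False
proof -
  note F =
      hub_not_inside[of 0 False] hub_not_inside[of 0 True] hub_not_inside[of 1 True]
      distance_two_not_inside[of 3 True] distance_two_not_inside[of 7 False]
      next_not_inside[of 0 False] next_not_inside[of 3 True] next_not_inside[of 6 False]
      next_not_inside[of 7 False] one_inside[of 0 2 3 4 5 6] one_inside[of 0 2 3 5 6 7]
      one_inside[of 0 2 3 6 7 8] one_inside[of 0 2 3 7 1 8] one_inside[of 0 2 4 3 1 5]
      one_inside[of 0 2 4 5 6 7] one_inside[of 0 2 4 6 7 8] one_inside[of 0 2 4 7 1 8]
      one_inside[of 0 3 4 1 7 8] one_inside[of 0 3 4 2 1 8] one_inside[of 0 3 4 7 6 8]
      three_outside[of 0 3 4 8 1 2 6 7] no_fan_crossing[of 0 2 1 7 8] no_fan_crossing[of 0 2 8 1 7]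
      no_fan_crossing[of 0 3 8 1 2] no_fan_crossing[of 1 8 0 2 7] no_fan_crossing[of 1 8 2 3 4]
      no_fan_crossing[of 1 8 3 2 4] no_fan_crossing[of 1 8 4 2 3] sides_sign[of 0 2 3 1]
      sides_sign[of 0 2 3 8] sides_sign[of 0 2 4 1] sides_sign[of 0 2 4 8] sides_sign[of 0 3 4 8]
      sides_sign[of 1 2 3 0] sides_sign[of 1 2 3 4] sides_sign[of 1 2 8 0] sides_sign[of 1 2 8 3]
      sides_sign[of 1 2 8 4] sides_sign[of 1 7 8 0] sides_sign[of 1 7 8 2] sides_sign[of 2 3 4 1]
      sides_sign[of 2 3 4 8] trans[of 0 2 1 3 8] trans[of 0 8 1 7 2] trans[of 1 0 2 7 8]
      trans[of 1 4 2 3 8] trans[of 2 1 7 0 8] trans[of 2 3 0 8 1] trans[of 2 8 1 4 3]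
      trans[of 3 1 2 8 4] trans[of 4 1 0 2 3] trans[of 8 2 0 7 1] trans[of 8 3 1 2 4]
      trans[of 8 4 0 2 3] trans'[of 0 2 1 7 8] trans'[of 1 2 3 8 4] trans'[of 2 1 0 4 8]
      trans'[of 2 1 0 8 3] trans'[of 2 3 1 4 8] trans'[of 3 0 2 1 8] trans'[of 3 1 8 2 4]
      trans'[of 4 2 1 3 8] trans'[of 8 3 4 0 2]
  show False using assms[simplified] F[simplified] by satx
qed

lemma not_inside_hub_triangle: "\<not> inside (dihedral k s 0) (dihedral k s 2) (dihedral k s 3)
  (dihedral k s 1)"
  using not_in_triangle_wlog[of 0 2 1 3, OF antiprism_config.not_inside_hub_triangle_ccw
      antiprism_config_dihedral[OF antiprism_config_axioms]]
  by (simp only: o_apply not_False_eq_True)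

lemma spoke_not_across_rim_ccw:
  assumes "ccw_at p 0 2 1" "ccw_at p 2 1 3" "ccw_at p 1 3 0" "ccw_at p 3 0 2"
  shows False
proof -
  note F =
      hub_not_inside[of 1 False] next_not_inside[of 3 True] not_inside_hub_triangle[of 1 False]
      no_fan_crossing[of 0 1 2 3 4] no_fan_crossing[of 0 1 3 2 4] no_fan_crossing[of 2 3 0 1 4]
      sides_sign[of 0 3 4 2] sides_sign[of 2 3 4 0] sides_sign[of 2 3 4 1] trans[of 0 2 1 3 4]
      trans[of 1 3 4 0 2] trans[of 3 0 2 1 4] trans'[of 0 1 3 4 2]
  show False using assms[simplified] F[simplified] by satx
qed

lemma spoke_not_across_rim:
  "\<not> crosses (p (dihedral k s 0)) (p (dihedral k s 1)) (p (dihedral k s 2)) (p (dihedral k s 3))"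
  using not_crosses_wlog[of 0 2 1 3, OF antiprism_config.spoke_not_across_rim_ccw
      antiprism_config_dihedral[OF antiprism_config_axioms]]
  by (simp only: o_apply not_False_eq_True)

text \<open>The two crossings force 1-3 to cross 2-4 as well. Then the edges from 2 to 0 and to 4
  form a fan crossing of 1-3.\<close>

lemma no_consecutive_spoke_crossings_ccw:
  assumes "ccw_at p 0 2 3" "cross_at p 0 2 1 3" "cross_at p 0 3 2 4"
  shows False
proof -
  note F =
      no_fan_crossing[of 1 3 2 0 4] trans[of 2 3 4 0 1] trans'[of 3 0 2 1 4]
  show False using assms[simplified] F[simplified] by satx
qed

end

lemma no_consecutive_spoke_crossings_aux:
  "\<not> (cross_at p 0 2 1 3 \<and> cross_at p 0 3 2 4)"
proof
  assume c: "cross_at p 0 2 1 3 \<and> cross_at p 0 3 2 4"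
  have "ccw_at p 0 2 3 \<or> orient (p 0) (p 2) (p 3) < 0"
    using general_position[of 0 2 3] by auto
  then show False
    using c no_consecutive_spoke_crossings_ccw
      antiprism_config.no_consecutive_spoke_crossings_ccw[OF antiprism_config_cnj]
    by (auto simp: crosses_cnj orient_cnj simp del: One_nat_def)
qed

lemma no_consecutive_spoke_crossings:
  "\<not> (crosses (p (dihedral k s 0)) (p (dihedral k s 2)) (p (dihedral k s 1)) (p (dihedral k s 3)) \<and>
      crosses (p (dihedral k s 0)) (p (dihedral k s 3)) (p (dihedral k s 2)) (p (dihedral k s 4)))"
  using antiprism_config.no_consecutive_spoke_crossings_aux[OF antiprism_config_dihedral[OF
    antiprism_config_axioms]]
  by (simp only: o_apply not_False_eq_True)

section \<open>Cyclic order about the hub and alternation of the rim triangles\<close>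

context
  notes ccw_sort [simp] and acute_angle_sort [simp] and adj_def [simp] and triangle_def [simp]
    and inside_iff [simp] and crosses_def [simp] and dihedral_def [simp]
      and numeral_2_eq_2 [symmetric, simp]
begin

text \<open>Four points have seven types: one inside the triangle of the others, or one of three
  pairs of crossing diagonals. The exclusions leave 2 inside 0 1 3, or 0-2 crossing 1-3; in both the
  spoke to 2 runs between the spokes to 1 and 3.\<close>

lemma same_sense_aux: "(ccw_at p 0 2 3 \<longleftrightarrow> ccw_at p 0 1 2) \<and> (ccw_at p 0 1 3 \<longleftrightarrow> ccw_at p 0 1 2)"
proof -
  note F = hub_not_inside[of 0 False] not_inside_hub_triangle[of 0 False]
    not_inside_hub_triangle[of 2 True]
      spoke_not_across_rim[of 0 False] spoke_not_across_rim[of 2 True]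
      sides_sign[of 1 2 3 0] sides_sign[of 0 2 3 1] sides_sign[of 0 1 2 3]
  show ?thesis by (simp, insert F[simplified], satx)
qed

lemma same_sense:
  "(ccw (p (dihedral k s 0)) (p (dihedral k s 2)) (p (dihedral k s 3)) \<longleftrightarrow>
      ccw (p (dihedral k s 0)) (p (dihedral k s 1)) (p (dihedral k s 2))) \<and>
   (ccw (p (dihedral k s 0)) (p (dihedral k s 1)) (p (dihedral k s 3)) \<longleftrightarrow>
      ccw (p (dihedral k s 0)) (p (dihedral k s 1)) (p (dihedral k s 2)))"
  using antiprism_config.same_sense_aux[OF antiprism_config_dihedral[OF antiprism_config_axioms]]
  by (simp only: o_apply)

lemma angular_order:
  assumes "ccw_at p 0 1 2"
  shows "ccw_at p 0 1 2 \<and> ccw_at p 0 2 3 \<and> ccw_at p 0 3 4 \<and> ccw_at p 0 4 5 \<and> ccw_at p 0 5 6 \<and>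
    ccw_at p 0 6 7 \<and> ccw_at p 0 7 8 \<and> ccw_at p 0 8 1 \<and>
    ccw_at p 0 1 3 \<and> ccw_at p 0 2 4 \<and> ccw_at p 0 3 5 \<and> ccw_at p 0 4 6 \<and> ccw_at p 0 5 7 \<and>
      ccw_at p 0 6 8 \<and> ccw_at p 0 7 1 \<and> ccw_at p 0 8 2"
proof -
  note F = same_sense[of 0 False] same_sense[of 1 False] same_sense[of 2 False] same_sense[of 3 False]
    same_sense[of 4 False] same_sense[of 5 False] same_sense[of 6 False] same_sense[of 7 False]
  show ?thesis by (simp, insert assms[simplified] F[simplified], satx)
qed

text \<open>Given the angular order, \<open>ccw_at p 1 2 3\<close> says that the spoke 0-2 crosses
  1-3, and its negation that 2 lies in the triangle 0 1 3. So exactly one of two consecutive spokes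
  crosses the chord of its end's rim neighbours.\<close>

lemma alternating_aux:
  assumes "ccw_at p 0 1 2"
  shows "ccw_at p 2 3 4 \<longleftrightarrow> \<not> ccw_at p 1 2 3"
proof -
  note F =
      not_inside_hub_triangle[of 0 False] not_inside_hub_triangle[of 1 False]
      no_consecutive_spoke_crossings[of 1 True] no_consecutive_spoke_crossings[of 2 False]
      no_consecutive_spoke_crossings[of 4 False] leaving_edge_crosses[of 0 2 8 3 1]
      leaving_edge_crosses[of 0 3 5 2 4] leaving_edge_crosses[of 0 4 6 7 5]
      no_fan_crossing[of 0 4 5 3 7] no_fan_crossing[of 1 3 2 0 4] no_fan_crossing[of 1 3 2 4 8]
      no_fan_crossing[of 2 4 3 0 1] no_fan_crossing[of 2 4 3 1 5] acute_add[of 2 1 4 0]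
      acute_add[of 3 0 1 4] acute_add[of 3 1 4 5] acute_add[of 5 3 4 7] acute_add[of 6 7 0 5]
      acute_add[of 7 5 6 1] acute_at[of 0 5 2 4] acute_at[of 0 8 3 1] acute_at[of 1 3 2 4]
      acute_at[of 4 0 3 5] acute_at[of 4 0 5 3] acute_at[of 4 2 3 1] acute_at[of 4 6 5 7]
      acute_at[of 5 7 6 0] acute_at[of 6 0 7 5] acute_at[of 6 8 7 1] acute_at[of 7 5 6 0]
      interior[of 3 1 5 0] sides_sign[of 0 1 7 5] sides_sign[of 0 2 3 1] sides_sign[of 0 2 8 1]
      sides_sign[of 0 3 4 2] sides_sign[of 0 3 5 4] sides_sign[of 0 4 6 5] trans[of 2 4 0 1 3]
      trans[of 5 7 0 4 6] trans[of 7 1 6 8 0] trans'[of 3 2 1 4 0] trans'[of 5 0 1 3 7]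
      trans'[of 8 0 6 7 1]
  have "\<not> (ccw_at p 1 2 3 \<and> ccw_at p 2 3 4)"
    unfolding One_nat_def
    using angular_order[OF assms, simplified] no_consecutive_spoke_crossings[of 0 False, simplified]
      by satx
  \<comment> \<open>The remaining possibility is that 2 lies in 0 1 3 and 3 lies in 0 2 4. Here the
    angles themselves enter: acute angles at further crossings are added up.\<close>
  moreover have "ccw_at p 1 2 3 \<or> ccw_at p 2 3 4"
    unfolding One_nat_def
    using angular_order[OF assms, simplified] F[simplified] by satx
  ultimately show ?thesis by blast
qed

lemma alternating:
  assumes "ccw_at p 0 1 2"
  shows "(ccw_at p 2 3 4 \<longleftrightarrow> \<not> ccw_at p 1 2 3) \<and> (ccw_at p 3 4 5 \<longleftrightarrow> \<not> ccw_at p 2 3 4) \<and>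
    (ccw_at p 4 5 6 \<longleftrightarrow> \<not> ccw_at p 3 4 5) \<and> (ccw_at p 5 6 7 \<longleftrightarrow> \<not> ccw_at p 4 5 6) \<and> (ccw_at p 6 7 8 \<longleftrightarrow>
    \<not> ccw_at p 5 6 7) \<and> (ccw_at p 7 8 1 \<longleftrightarrow> \<not> ccw_at p 6 7 8) \<and> (ccw_at p 8 1 2 \<longleftrightarrow> \<not> ccw_at p 7 8 1)"
proof -
  have *: "ccw (p 0) (p (dihedral k False 1)) (p (dihedral k False 2)) \<Longrightarrow>
      ccw (p (dihedral k False 2)) (p (dihedral k False 3)) (p (dihedral k False 4)) \<longleftrightarrow>
      \<not> ccw (p (dihedral k False 1)) (p (dihedral k False 2)) (p (dihedral k False 3))" for k
    using antiprism_config.alternating_aux[OF antiprism_config_dihedral[OF antiprism_config_axioms],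
      of k False]
    by simp
  note F = *[of 0] *[of 1] *[of 2] *[of 3] *[of 4] *[of 5] *[of 6]
  show ?thesis by (simp, insert angular_order[OF assms, simplified] F[simplified], satx)
qed

end
end

section \<open>Perturbation into general position\<close>

lemma crosses_imp_segments_meet:
  assumes "crosses a b u v"
  shows "closed_segment a b \<inter> closed_segment u v \<noteq> {}"
proof -
  have *: "\<exists>z. z \<in> closed_segment a b \<and> z \<in> closed_segment u v"
    if "ccw a u b" "ccw u b v" "ccw b v a" "ccw v a u" for a b u v
  proof -
    \<comment> \<open>The denominator is twice the area of the quadrilateral. \<open>s\<close>
      divides \<open>ab\<close> in the ratio of the distances of its ends from the line
      \<open>uv\<close>, and \<open>r\<close> does the same for \<open>uv\<close>.\<close>
    define s where "s = orient v a u / (orient u b v + orient v a u)"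
    define r where "r = orient a u b / (orient u b v + orient v a u)"
    have sum: "orient b v a = orient u b v + orient v a u - orient a u b"
      by (simp add: orient_def algebra_simps)
    have pos: "orient u b v + orient v a u \<noteq> 0" using that by simp
    have "s \<in> {0..1}" "r \<in> {0..1}" using that sum by (auto simp: s_def r_def)
    moreover have "(1 - s) *\<^sub>R a + s *\<^sub>R b = (1 - r) *\<^sub>R u + r *\<^sub>R v"
    proof (rule complex_eqI)
      show "Re ((1 - s) *\<^sub>R a + s *\<^sub>R b) = Re ((1 - r) *\<^sub>R u + r *\<^sub>R v)"
        using pos unfolding s_def r_def by (simp add: field_simps) (simp add: orient_def algebra_simps)
      show "Im ((1 - s) *\<^sub>R a + s *\<^sub>R b) = Im ((1 - r) *\<^sub>R u + r *\<^sub>R v)"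
        using pos unfolding s_def r_def by (simp add: field_simps) (simp add: orient_def algebra_simps)
    qed
    ultimately show ?thesis by (auto simp: closed_segment_def)
  qed
  show ?thesis
    using assms *[of a u b v] *[of a v b u] unfolding crosses_def
    by (auto simp: closed_segment_commute)
qed

text \<open>Moving the \<open>n\<close>-th point along the vector with coordinates \<open>n\<close> and \<open>n\<^sup>2\<close> adds a
  Vandermonde determinant times \<open>t\<^sup>2\<close> to each orientation, so no orientation stays zero.\<close>
lemma perturbation:
  fixes p :: "nat \<Rightarrow> complex"
  obtains q :: "nat \<Rightarrow> complex" where
    "\<And>i j k. i \<le> N \<Longrightarrow> j \<le> N \<Longrightarrow> k \<le> N \<Longrightarrow> i \<noteq> j \<Longrightarrow> j \<noteq> k \<Longrightarrow> i \<noteq> k \<Longrightarrow> orient (q i) (q j) (q k) \<noteq> 0"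
    "\<And>i j k. i \<le> N \<Longrightarrow> j \<le> N \<Longrightarrow> k \<le> N \<Longrightarrow> ccw_at p i j k \<Longrightarrow> ccw (q i) (q j) (q k)"
    "\<And>i j k. i \<le> N \<Longrightarrow> j \<le> N \<Longrightarrow> k \<le> N \<Longrightarrow> inner (p j - p i) (p k - p i) > 0 \<Longrightarrow>
      inner (q j - q i) (q k - q i) > 0"
    "\<And>a b u v. a \<le> N \<Longrightarrow> b \<le> N \<Longrightarrow> u \<le> N \<Longrightarrow> v \<le> N \<Longrightarrow>
       closed_segment (p a) (p b) \<inter> closed_segment (p u) (p v) = {} \<Longrightarrow> \<not> crosses (q a) (q b) (q u) (q v)"
proof -
  define q where "q t n = p n + Complex (t * real n) (t * (real n)^2)" for t n
  have q: "((\<lambda>t. q t n) \<longlongrightarrow> p n) (at_right 0)" for n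
  proof -
    have "((\<lambda>t. p n + Complex (t * real n) (t * (real n)^2)) \<longlongrightarrow> p n + Complex (0 * real n) (0 * (real
      n)^2)) (at_right 0)"
      by (intro tendsto_intros)
    then show ?thesis by (simp add: q_def zero_complex.code[symmetric])
  qed
  have orient: "((\<lambda>t. orient (q t i) (q t j) (q t k)) \<longlongrightarrow> orient (p i) (p j) (p k)) (at_right 0)" for i j k
    unfolding orient_def by (intro tendsto_intros q)
  have 1: "\<forall>\<^sub>F t in at_right 0. i \<noteq> j \<longrightarrow> j \<noteq> k \<longrightarrow> i \<noteq> k \<longrightarrow> orient (q t i) (q t j) (q t k) \<noteq> 0" for i j k
  proof -
    define A where "A = orient (p i) (p j) (p k)"
    \<comment> \<open>The coefficient of \<open>t\<close>: each summand moves a single point by its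
      full vector and thus equals \<open>A\<close> plus that point's linear contribution.\<close>
    define B where "B = orient (p i) (p j) (p k + Complex (real k) ((real k)^2)) + orient (p i) (p j
      + Complex (real j) ((real j)^2)) (p k)
       + orient (p i + Complex (real i) ((real i)^2)) (p j) (p k) - 3 * A"
    define V where "V = (real j - real i) * (real k - real i) * (real k - real j)"
    have e: "orient (q t i) (q t j) (q t k) = A + t * (B + V * t)" for t
      by (simp add: q_def A_def B_def V_def orient_def algebra_simps power2_eq_square)
    have pos: "\<forall>\<^sub>F t in at_right (0::real). t > 0" by (simp add: eventually_at_right_less)
    show ?thesis
    proof (cases "A = 0")
      case False
      then have "\<forall>\<^sub>F t in at_right 0. orient (q t i) (q t j) (q t k) \<noteq> 0"
        using orient[of i j k] unfolding A_def by (rule tendsto_imp_eventually_ne[rotated])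
      then show ?thesis by (rule eventually_mono) simp
    next
      case True
      have "((\<lambda>t. B + V * t) \<longlongrightarrow> B + V * 0) (at_right 0)" by (intro tendsto_intros)
      then have "\<forall>\<^sub>F t in at_right 0. B \<noteq> 0 \<longrightarrow> B + V * t \<noteq> 0"
        by (cases "B = 0") (auto dest: tendsto_imp_eventually_ne)
      with pos show ?thesis
        by eventually_elim (auto simp: e True V_def)
    qed
  qed
  have 2: "\<forall>\<^sub>F t in at_right 0. ccw_at p i j k \<longrightarrow> ccw (q t i) (q t j) (q t k)" for i j k
    using order_tendstoD(1)[OF orient[of i j k], of 0] by (cases "ccw_at p i j k") auto
  have 3: "\<forall>\<^sub>F t in at_right 0. inner (p j - p i) (p k - p i) > 0 \<longrightarrow>
    inner (q t j - q t i) (q t k - q t i) > 0" for i j k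
  proof -
    have "((\<lambda>t. inner (q t j - q t i) (q t k - q t i)) \<longlongrightarrow> inner (p j - p i) (p k - p i)) (at_right 0)"
      by (intro tendsto_intros q)
    from order_tendstoD(1)[OF this, of 0] show ?thesis
      by (cases "inner (p j - p i) (p k - p i) > 0") auto
  qed
  have 4: "\<forall>\<^sub>F t in at_right 0. closed_segment (p a) (p b) \<inter> closed_segment (p u) (p v) = {} \<longrightarrow>
     \<not> crosses (q t a) (q t b) (q t u) (q t v)" for a b u v
  proof (cases "closed_segment (p a) (p b) \<inter> closed_segment (p u) (p v) = {}")
    case True
    \<comment> \<open>A strictly separating line remains separating for small
      \<open>t\<close>.\<close>
    obtain n c where nc: "\<forall>x\<in>closed_segment (p a) (p b). inner n x < c"
      "\<forall>x\<in>closed_segment (p u) (p v). inner n x > c"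
      using separating_hyperplane_closed_compact[OF _ _ _ _ _ True] by auto
    have lt: "\<forall>\<^sub>F t in at_right 0. inner n (q t i) < c" if "inner n (p i) < c" for i
      using order_tendstoD(2)[OF tendsto_inner[OF tendsto_const q] that] .
    have gt: "\<forall>\<^sub>F t in at_right 0. inner n (q t i) > c" if "inner n (p i) > c" for i
      using order_tendstoD(1)[OF tendsto_inner[OF tendsto_const q] that] .
    have "\<forall>\<^sub>F t in at_right 0. inner n (q t a) < c \<and> inner n (q t b) < c \<and> inner n (q t u) > c \<and>
      inner n (q t v) > c"
      using nc by (intro eventually_conj lt gt) auto
    then show ?thesis
    proof eventually_elim
      case (elim t)
      have "closed_segment (q t a) (q t b) \<subseteq> {x. inner n x < c}"
        "closed_segment (q t u) (q t v) \<subseteq> {x. inner n x > c}"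
        using elim convex_halfspace_lt[of n c] convex_halfspace_gt[of c n]
        by (intro closed_segment_subset; simp)+
      then show ?case using crosses_imp_segments_meet by fastforce
    qed
  qed simp
  let ?good = "\<lambda>t. \<forall>i\<in>{..N}. \<forall>j\<in>{..N}. \<forall>k\<in>{..N}.
     (i \<noteq> j \<longrightarrow> j \<noteq> k \<longrightarrow> i \<noteq> k \<longrightarrow> orient (q t i) (q t j) (q t k) \<noteq> 0) \<and>
     (ccw_at p i j k \<longrightarrow> ccw (q t i) (q t j) (q t k)) \<and>
     (inner (p j - p i) (p k - p i) > 0 \<longrightarrow> inner (q t j - q t i) (q t k - q t i) > 0) \<and>
     (\<forall>l\<in>{..N}. closed_segment (p i) (p j) \<inter> closed_segment (p k) (p l) = {} \<longrightarrow>
        \<not> crosses (q t i) (q t j) (q t k) (q t l))"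
  have "eventually ?good (at_right 0)"
    by (intro eventually_ball_finite ballI eventually_conj 1 2 3 4 finite_atMost)
  from eventually_happens'[OF trivial_limit_at_right_real this] obtain t where "?good t" by (rule exE)
  then show ?thesis by (intro that[of "q t"]) simp_all
qed

section \<open>From RAC drawings to configurations\<close>

definition label :: "nat \<Rightarrow> antiprism_vertex" where
  "label n = (if n = 0 then v\<^sub>0 else if odd n then va (of_nat (n div 2)) else vb (of_nat (n div 2 - 1)))"

lemma label_simps:
  "label 0 = v\<^sub>0" "label 1 = va 0" "label 2 = vb 0" "label 3 = va 1" "label 4 = vb 1"
  "label 5 = va 2" "label 6 = vb 2" "label 7 = va 3" "label 8 = vb 3"
  by (simp_all add: label_def)

lemma augmented_antiprism_iff:
  "{v\<^sub>0, va i} \<in> augmented_antiprism" "{va i, v\<^sub>0} \<in> augmented_antiprism"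
  "{v\<^sub>0, vb i} \<in> augmented_antiprism" "{vb i, v\<^sub>0} \<in> augmented_antiprism"
  "{va i, va j} \<in> augmented_antiprism \<longleftrightarrow> j = i + 1 \<or> i = j + 1"
  "{vb i, vb j} \<in> augmented_antiprism \<longleftrightarrow> j = i + 1 \<or> i = j + 1"
  "{va i, vb j} \<in> augmented_antiprism \<longleftrightarrow> j = i \<or> i = j + 1"
  "{vb j, va i} \<in> augmented_antiprism \<longleftrightarrow> j = i \<or> i = j + 1"
  by (auto simp: augmented_antiprism_def doubleton_eq_iff)

lemma label_adj:
  assumes "adj i j"
  shows "{label i, label j} \<in> augmented_antiprism"
  using assms unfolding adj_def le_8_cases
  by (elim insertE emptyE conjE)
    (simp_all add: label_simps label_simps(2)[unfolded One_nat_def] augmented_antiprism_iff)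

lemma label_inj: "inj_on label {..8}"
  unfolding inj_on_def atMost_iff Ball_def le_8_cases
  by (intro allI impI, elim insertE emptyE) (simp_all add: label_simps label_simps(2)[unfolded
    One_nat_def])

lemma rac_drawing_perturbation:
  assumes rac: "rac_drawing augmented_antiprism D"
  obtains q where "antiprism_config q"
    "\<And>i j k. i \<le> 8 \<Longrightarrow> j \<le> 8 \<Longrightarrow> k \<le> 8 \<Longrightarrow> ccw (D (label i)) (D (label j)) (D (label k)) \<Longrightarrow>
      ccw (q i) (q j) (q k)"
proof -
  let ?E = augmented_antiprism
  let ?p = "\<lambda>i. D (label i)"
  have sld: "straight_line_drawing ?E D" using rac by (simp add: rac_drawing_def)
  obtain q where q:
    "\<And>i j k. i \<le> 8 \<Longrightarrow> j \<le> 8 \<Longrightarrow> k \<le> 8 \<Longrightarrow> i \<noteq> j \<Longrightarrow> j \<noteq> k \<Longrightarrow> i \<noteq> k \<Longrightarrow> orient (q i) (q j) (q k) \<noteq> 0"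
    "\<And>i j k. i \<le> 8 \<Longrightarrow> j \<le> 8 \<Longrightarrow> k \<le> 8 \<Longrightarrow> ccw (?p i) (?p j) (?p k) \<Longrightarrow> ccw (q i) (q j) (q k)"
    "\<And>i j k. i \<le> 8 \<Longrightarrow> j \<le> 8 \<Longrightarrow> k \<le> 8 \<Longrightarrow> inner (?p j - ?p i) (?p k - ?p i) > 0 \<Longrightarrow>
      inner (q j - q i) (q k - q i) > 0"
    "\<And>a b u v. a \<le> 8 \<Longrightarrow> b \<le> 8 \<Longrightarrow> u \<le> 8 \<Longrightarrow> v \<le> 8 \<Longrightarrow>
       closed_segment (?p a) (?p b) \<inter> closed_segment (?p u) (?p v) = {} \<Longrightarrow>
         \<not> crosses (q a) (q b) (q u) (q v)"
    using perturbation[of 8 ?p] by blast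
  have seg: "edge_segment D {label a, label b} = closed_segment (?p a) (?p b)" for a b
    by (simp add: edge_segment_def segment_convex_hull)
  \<comment> \<open>The original closed edges meet, and neither contains an end of the other; so the
    common point is interior to both, and the edges cross at a right angle.\<close>
  have meet: "\<exists>z. z \<in> open_segment (?p a) (?p b) \<and> z \<in> open_segment (?p u) (?p v) \<and>
    inner (?p a - ?p b) (?p u - ?p v) = 0"
    if c: "adj a b" "adj u v" "crosses (q a) (q b) (q u) (q v)" for a b u v
  proof -
    have le: "a \<le> 8" "b \<le> 8" "u \<le> 8" "v \<le> 8" using c by (auto simp: adj_def)
    have ne: "a \<noteq> u" "a \<noteq> v" "b \<noteq> u" "b \<noteq> v" using c(3) by (auto simp: crosses_def)
    have ne': "label a \<noteq> label u" "label a \<noteq> label v" "label b \<noteq> label u" "label b \<noteq> label v"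
      using ne le inj_onD[OF label_inj] by auto
    obtain z where z: "z \<in> closed_segment (?p a) (?p b)" "z \<in> closed_segment (?p u) (?p v)"
      using q(4)[OF le] c(3) by blast
    have "?p a \<notin> closed_segment (?p u) (?p v)" "?p b \<notin> closed_segment (?p u) (?p v)"
      "?p u \<notin> closed_segment (?p a) (?p b)" "?p v \<notin> closed_segment (?p a) (?p b)"
      using sld label_adj[OF c(1)] label_adj[OF c(2)] ne' unfolding straight_line_drawing_def
        seg[symmetric]
      by auto
    then have open_z: "z \<in> open_segment (?p a) (?p b)" "z \<in> open_segment (?p u) (?p v)"
      using z by (auto simp: open_segment_def)
    then have "edges_cross D {label a, label b} {label u, label v}"
      using ne' unfolding edges_cross_def edge_interior_def seg open_segment_def by auto
    then have "orthogonal (?p a - ?p b) (?p u - ?p v)"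
      using rac label_adj[OF c(1)] label_adj[OF c(2)] unfolding rac_drawing_def by blast
    then show ?thesis using open_z by (auto simp: orthogonal_def)
  qed
  have "antiprism_config q"
  proof
    fix a b u v w assume adj: "adj a b" "adj u v" "adj u w" and "v \<noteq> w"
    show "\<not> (crosses (q a) (q b) (q u) (q v) \<and> crosses (q a) (q b) (q u) (q w))"
    proof
      assume c: "crosses (q a) (q b) (q u) (q v) \<and> crosses (q a) (q b) (q u) (q w)"
      obtain z z' where z: "z \<in> open_segment (?p a) (?p b)" "z \<in> open_segment (?p u) (?p v)"
          "inner (?p a - ?p b) (?p u - ?p v) = 0"
        and z': "z' \<in> open_segment (?p a) (?p b)" "z' \<in> open_segment (?p u) (?p w)"
          "inner (?p a - ?p b) (?p u - ?p w) = 0"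
        using meet[of a b u v] meet[of a b u w] c adj by blast
      obtain s s' where s: "z = ?p a + s *\<^sub>R (?p b - ?p a)" "z' = ?p a + s' *\<^sub>R (?p b - ?p a)"
        using z(1) z'(1) by (auto simp: in_segment algebra_simps)
      obtain r r' where r: "z = ?p u + r *\<^sub>R (?p v - ?p u)" "z' = ?p u + r' *\<^sub>R (?p w - ?p u)"
        using z(2) z'(2) by (auto simp: in_segment algebra_simps)
      \<comment> \<open>Both crossing points are the foot of the perpendicular from \<open>u\<close>
        to the line \<open>ab\<close>, so the two edges at \<open>u\<close> would overlap.\<close>
      have "inner (?p a - ?p b) (z - z') = 0"
        using z(3) z'(3) unfolding r by (simp add: inner_add_right inner_diff_right)
      then have "(s' - s) * inner (?p a - ?p b) (?p a - ?p b) = 0"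
        unfolding s by (simp add: inner_diff_right inner_add_right algebra_simps inner_commute)
      moreover have "?p a \<noteq> ?p b" using z(1) by auto
      ultimately have "z = z'" using s by simp
      have lw: "{label u, label v} \<noteq> {label u, label w}"
        using \<open>v \<noteq> w\<close> adj(2,3)[THEN adj_le] inj_on_eq_iff[OF label_inj, of v w]
          by (auto simp: doubleton_eq_iff)
      then obtain y where "closed_segment (?p u) (?p v) \<inter> closed_segment (?p u) (?p w) \<subseteq> {y}"
        using sld label_adj[OF adj(2)] label_adj[OF adj(3)] unfolding straight_line_drawing_def
          seg[symmetric] by meson
      moreover have "z \<in> closed_segment (?p u) (?p v) \<inter> closed_segment (?p u) (?p w)" "z \<noteq> ?p u"
        using z(2) z'(2) \<open>z = z'\<close> by (auto simp: open_segment_def)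
      moreover have "?p u \<in> closed_segment (?p u) (?p v) \<inter> closed_segment (?p u) (?p w)" by simp
      ultimately show False by blast
    qed
  next
    fix a b u v assume adj: "adj a b" "adj u v" and c: "crosses (q a) (q b) (q u) (q v)"
    have le: "a \<le> 8" "b \<le> 8" "u \<le> 8" "v \<le> 8" using adj by (auto simp: adj_def)
    obtain z where z: "z \<in> open_segment (?p a) (?p b)" "z \<in> open_segment (?p u) (?p v)"
      and o: "inner (?p a - ?p b) (?p u - ?p v) = 0"
      using meet[OF adj c] by blast
    obtain s where s: "z = ?p a + s *\<^sub>R (?p b - ?p a)"
      using z(1) by (auto simp: in_segment algebra_simps)
    obtain r where r: "z = ?p u + r *\<^sub>R (?p v - ?p u)" "r > 0" "?p u \<noteq> ?p v"
      using z(2) by (auto simp: in_segment algebra_simps)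
    \<comment> \<open>Going through the crossing point splits this vector into a part along
      \<open>ab\<close>, orthogonal to \<open>uv\<close>, and a positive multiple of the direction
      of \<open>uv\<close>.\<close>
    have "?p a - ?p u = s *\<^sub>R (?p a - ?p b) + r *\<^sub>R (?p v - ?p u)"
      using s r(1) by (simp add: algebra_simps)
    then have "inner (?p v - ?p u) (?p a - ?p u) = s * inner (?p v - ?p u) (?p a - ?p b) + r * inner
      (?p v - ?p u) (?p v - ?p u)"
      by (simp only: inner_add_right inner_scaleR_right)
    also have "inner (?p v - ?p u) (?p a - ?p b) = 0"
      using o by (simp add: inner_commute inner_diff_left inner_diff_right)
    finally have "inner (?p v - ?p u) (?p a - ?p u) > 0" using r by simp
    then show "inner (q v - q u) (q a - q u) > 0" by (rule q(3)[OF le(3,4,1)])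
  qed (use q(1) in blast)
  then show ?thesis using q(2) that by blast
qed

section \<open>Drawings with the orientations of an antiprism\<close>

text \<open>The four directions wind once round \<open>h\<close>, so only \<open>h\<close> is weakly
  to the left of all of them. The sign of \<open>?d\<close> is unknown, since opposite directions
  are not compared; either sign makes one of the first two Pluecker relations equate a nonnegative
  and a nonpositive number.\<close>

lemma cyclic_signs_vanish:
  assumes w: "ccw h w0 w1" "ccw h w1 w2" "ccw h w2 w3" "ccw h w3 w0"
    and z: "orient h w0 z \<ge> 0" "orient h w1 z \<ge> 0" "orient h w2 z \<ge> 0" "orient h w3 z \<ge> 0"
  shows "orient h w0 z = 0 \<and> orient h w1 z = 0"
proof -
  let ?u0 = "orient h w0 z" and ?u1 = "orient h w1 z" and ?u2 = "orient h w2 z" and ?u3 = "orient h w3 z"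
  let ?d = "orient h w0 w2"
  have 1: "?u0 * orient h w1 w2 + ?u2 * orient h w0 w1 = ?u1 * ?d"
    and 2: "?u2 * orient h w3 w0 + ?u0 * orient h w2 w3 = - ?u3 * ?d"
    and 3: "?u1 * orient h w2 w3 + ?u3 * orient h w1 w2 = ?u2 * orient h w1 w3"
    by (simp_all add: orient_def algebra_simps)
  have n: "?u0 * orient h w1 w2 \<ge> 0" "?u2 * orient h w0 w1 \<ge> 0" "?u2 * orient h w3 w0 \<ge> 0"
    "?u0 * orient h w2 w3 \<ge> 0"
    "?u1 * orient h w2 w3 \<ge> 0" "?u3 * orient h w1 w2 \<ge> 0"
    using w z by simp_all
  have "?u1 * ?d = 0 \<or> ?u3 * ?d = 0"
  proof (cases "?d \<ge> 0")
    case True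
    then have "?u3 * ?d \<ge> 0" using z by simp
    then show ?thesis using 2 n by linarith
  next
    case False
    then have "?u1 * ?d \<le> 0" using z by (simp add: mult_nonneg_nonpos)
    then show ?thesis using 1 n by linarith
  qed
  then have "?u0 * orient h w1 w2 = 0 \<and> ?u2 * orient h w0 w1 = 0 \<or> ?u2 * orient h w3 w0 = 0 \<and>
    ?u0 * orient h w2 w3 = 0"
    using 1 2 n by linarith
  then have "?u0 = 0" "?u2 = 0" using w by auto
  then have "?u1 * orient h w2 w3 + ?u3 * orient h w1 w2 = 0" using 3 by simp
  then have "?u1 * orient h w2 w3 = 0" using n by linarith
  then show ?thesis using \<open>?u0 = 0\<close> w by auto
qed

lemma cyclic_signs_not_negative:
  assumes w: "ccw h w0 w1" "ccw h w1 w2" "ccw h w2 w3" "ccw h w3 w0"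
  shows "\<not> (orient h w0 z < 0 \<and> orient h w1 z < 0 \<and> orient h w2 z < 0 \<and> orient h w3 z < 0)"
proof
  assume "orient h w0 z < 0 \<and> orient h w1 z < 0 \<and> orient h w2 z < 0 \<and> orient h w3 z < 0"
  \<comment> \<open>Point reflection in \<open>h\<close> reverses the signs and reduces to the
    nonnegative case.\<close>
  moreover have "orient h w (2 * h - z) = - orient h w z" for w
    by (simp add: orient_def algebra_simps)
  ultimately show False
    using cyclic_signs_vanish[OF w, of "2 * h - z"] by simp
qed

lemma orient_zero_two:
  assumes "ccw h w0 w1" "orient h w0 z = 0" "orient h w1 z = 0"
  shows "z = h"
proof -
  have "orient h w0 w1 *\<^sub>R (z - h) = orient h w0 z *\<^sub>R (w1 - h) - orient h w1 z *\<^sub>R (w0 - h)"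
    by (simp add: complex_eq_iff orient_def algebra_simps)
  then show ?thesis using assms by simp
qed

text \<open>A point also before \<open>w3\<close> would lie in two opposite sectors. The first two
  relations then force \<open>w0\<close>, \<open>h\<close>, \<open>w2\<close> to be collinear, and
  the third excludes this.\<close>

lemma opposite_sectors_disjoint:
  assumes w: "ccw h w0 w1" "ccw h w1 w2" "ccw h w2 w3" "ccw h w3 w0"
    and z: "orient h w0 z \<ge> 0" "orient h w1 z < 0" "orient h w2 z \<ge> 0"
  shows "orient h w3 z \<ge> 0"
proof (rule ccontr)
  let ?u0 = "orient h w0 z" and ?u1 = "orient h w1 z" and ?u2 = "orient h w2 z" and ?u3 = "orient h w3 z"
  let ?d = "orient h w0 w2"
  assume "\<not> ?u3 \<ge> 0"
  have 1: "?u0 * orient h w1 w2 + ?u2 * orient h w0 w1 = ?u1 * ?d"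
    and 2: "?u2 * orient h w3 w0 + ?u0 * orient h w2 w3 = - ?u3 * ?d"
    and 3: "?u1 * orient h w2 w3 + ?u3 * orient h w1 w2 = ?u2 * orient h w1 w3"
    by (simp_all add: orient_def algebra_simps)
  have n: "?u0 * orient h w1 w2 \<ge> 0" "?u2 * orient h w0 w1 \<ge> 0" "?u2 * orient h w3 w0 \<ge> 0"
    "?u0 * orient h w2 w3 \<ge> 0"
    using w z by simp_all
  have "?d \<le> 0" using 1 n z(2) by (smt (verit) mult_neg_pos)
  moreover have "?d \<ge> 0" using 2 n \<open>\<not> ?u3 \<ge> 0\<close> by (smt (verit) mult_pos_neg)
  ultimately have "?u0 * orient h w1 w2 + ?u2 * orient h w0 w1 = 0" using 1 by simp
  then have "?u2 * orient h w0 w1 = 0" using n by linarith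
  then have "?u2 = 0" using w by simp
  then have "?u1 * orient h w2 w3 + ?u3 * orient h w1 w2 = 0" using 3 by simp
  moreover have "?u1 * orient h w2 w3 < 0" "?u3 * orient h w1 w2 < 0"
    using w z(2) \<open>\<not> ?u3 \<ge> 0\<close> by (simp_all add: mult_neg_pos)
  ultimately show False by simp
qed

lemma add_4: "(i::4) + 4 = i"
  by simp

lemma four_cases: "(j::4) = i \<or> j = i + 1 \<or> j = i + 2 \<or> j = i + 3"
  using exhaust_4[of i] exhaust_4[of j] by auto

lemma orient_segment:
  "orient u v ((1 - t) *\<^sub>R x + t *\<^sub>R y) = (1 - t) * orient u v x + t * orient u v y"
  "orient u ((1 - t) *\<^sub>R x + t *\<^sub>R y) v = (1 - t) * orient u x v + t * orient u y v"
  "orient ((1 - t) *\<^sub>R x + t *\<^sub>R y) u v = (1 - t) * orient x u v + t * orient y u v"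
  by (simp_all add: orient_def algebra_simps)

text \<open>Both segments lie on one ray from \<open>x\<close>, and the shorter one ends on the
  longer.\<close>

lemma open_segments_common_endpoint:
  fixes x :: "'a :: real_vector"
  assumes "z \<in> open_segment x y" "z \<in> open_segment x y'"
  shows "y \<in> closed_segment x y' \<or> y' \<in> closed_segment x y"
proof -
  have *: "y' \<in> closed_segment x y"
    if "z = (1 - t) *\<^sub>R x + t *\<^sub>R y" "z = (1 - s) *\<^sub>R x + s *\<^sub>R y'" "0 < t" "t \<le> s" for t s y y'
  proof -
    have "s *\<^sub>R (y' - x) = t *\<^sub>R (y - x)" using that(1,2) by (simp add: algebra_simps)
    then have "(1 / s) *\<^sub>R s *\<^sub>R (y' - x) = (1 / s) *\<^sub>R t *\<^sub>R (y - x)" by simp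
    then have "y' - x = (t / s) *\<^sub>R (y - x)" using that by simp
    then have "y' = (1 - t / s) *\<^sub>R x + (t / s) *\<^sub>R y" by (simp add: algebra_simps)
    moreover have "0 \<le> t / s" "t / s \<le> 1" using that by auto
    ultimately show ?thesis unfolding closed_segment_def by blast
  qed
  obtain t where t: "z = (1 - t) *\<^sub>R x + t *\<^sub>R y" "0 < t" using assms(1) by (auto simp: in_segment)
  obtain s where s: "z = (1 - s) *\<^sub>R x + s *\<^sub>R y'" "0 < s" using assms(2) by (auto simp: in_segment)
  show ?thesis using *[OF t(1) s(1) t(2)] *[OF s(1) t(1) s(2)] by (cases "t \<le> s") auto
qed

lemma edge_interior_pair: "edge_interior D {x, y} = open_segment (D x) (D y)"
  by (simp add: edge_interior_def edge_segment_def open_segment_def segment_convex_hull)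

lemma edge_segment_pair: "edge_segment D {x, y} = closed_segment (D x) (D y)"
  by (simp add: edge_segment_def segment_convex_hull)

text \<open>Here \<open>a\<close> is the outer quadrilateral, running counterclockwise, and
  \<open>b i\<close> lies angularly between \<open>a i\<close> and \<open>a (i + 1)\<close>.
  Abstracting from the names of the vertices lets both choices of the outer quadrilateral and their
  reflections be instances. Right angles no longer occur: the signs determine the embedding.\<close>

locale antiprism_drawing =
  fixes E :: "'v set set" and D :: "'v \<Rightarrow> complex" and h :: 'v and a b :: "4 \<Rightarrow> 'v"
  assumes edges: "E = (\<Union>i. {{h, a i}, {h, b i}, {a i, a (i + 1)}, {b i, b (i + 1)}, {a i, b i},
    {a (i + 1), b i}})"
    and vertices: "UNIV = insert h (range a \<union> range b)"
    and ccw_ab: "ccw (D h) (D (a i)) (D (b i))"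
    and ccw_ba: "ccw (D h) (D (b i)) (D (a (i + 1)))"
    and ccw_aa: "ccw (D h) (D (a i)) (D (a (i + 1)))"
    and ccw_bb: "ccw (D h) (D (b i)) (D (b (i + 1)))"
    and ccw_aab: "ccw (D (a i)) (D (a (i + 1))) (D (b i))"
    and ccw_bab: "ccw (D (b i)) (D (a (i + 1))) (D (b (i + 1)))"
begin

abbreviation H where "H \<equiv> D h"
abbreviation A where "A i \<equiv> D (a i)"
abbreviation B where "B i \<equiv> D (b i)"

lemma vertex_cases:
  obtains "v = h" | i where "v = a i" | i where "v = b i"
  using vertices by blast

lemma edge_cases:
  assumes "e \<in> E"
  obtains i where "e = {h, a i}" | i where "e = {h, b i}" | i where "e = {a i, a (i + 1)}"
    | i where "e = {b i, b (i + 1)}" | i where "e = {a i, b i}" | i where "e = {a (i + 1), b i}"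
  using assms unfolding edges by blast

text \<open>The cone is closed at its first ray and open at the next, so that the four sectors
  partition the plane without the hub.\<close>

definition sector :: "4 \<Rightarrow> complex \<Rightarrow> bool" where
  "sector i z \<longleftrightarrow> 0 \<le> orient H (A i) z \<and> 0 < orient H z (A (i + 1))"

lemma ccw_aa4: "ccw H (A i) (A (i + 1))" "ccw H (A (i + 1)) (A (i + 2))" "ccw H (A (i + 2)) (A (i + 3))"
  "ccw H (A (i + 3)) (A i)"
  using ccw_aa[of i] ccw_aa[of "i + 1"] ccw_aa[of "i + 2"] ccw_aa[of "i + 3"]
    by (simp_all add: add.assoc add_4)

lemma sector_unique:
  assumes "sector i z" "sector j z"
  shows "i = j"
proof -
  have adjacent: False if "sector i z" "sector (i + 1) z" for i
    using that orient_swap'[of H z "A (i + 1)"] by (simp add: sector_def)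
  have opposite: False if "sector i z" "sector (i + 2) z" for i
  proof -
    have "orient H (A i) z \<ge> 0" "orient H (A (i + 1)) z < 0" "orient H (A (i + 2)) z \<ge> 0"
      "orient H (A (i + 3)) z < 0"
      using that orient_swap'[of H z "A (i + 1)"] orient_swap'[of H z "A (i + 3)"]
        by (auto simp: sector_def add.assoc)
    then show False using opposite_sectors_disjoint[OF ccw_aa4[of i]] by fastforce
  qed
  show ?thesis
    using four_cases[of j i] assms adjacent[of i] opposite[of i] adjacent[of "i + 3"]
    by (auto simp: add.assoc add_4)
qed

text \<open>In the absence of a sector, a nonnegative sign at one ray passes to the next. So the
  four signs are all nonnegative or all negative, and both are impossible.\<close>

lemma sector_exists:
  assumes "z \<noteq> H"
  shows "\<exists>i. sector i z"
proof (rule ccontr)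
  assume "\<nexists>i. sector i z"
  then have step: "orient H (A i) z \<ge> 0 \<Longrightarrow> orient H (A (i + 1)) z \<ge> 0" for i
    using orient_swap'[of H z "A (i + 1)"] by (auto simp: sector_def not_less)
  show False
  proof (cases "\<exists>i. orient H (A i) z \<ge> 0")
    case True
    then obtain i where "orient H (A i) z \<ge> 0" by blast
    then have "orient H (A (i + 1)) z \<ge> 0" "orient H (A (i + 2)) z \<ge> 0" "orient H (A (i + 3)) z \<ge> 0"
      using step[of i] step[of "i + 1"] step[of "i + 2"] by (simp_all add: add.assoc)
    with \<open>orient H (A i) z \<ge> 0\<close> show False
      using cyclic_signs_vanish[OF ccw_aa4[of i]] orient_zero_two[OF ccw_aa[of i]] assms by blast
  next
    case False
    then show False using cyclic_signs_not_negative[OF ccw_aa4[of 0], of z] by (auto simp: not_le)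
  qed
qed

lemma sector_a: "sector i (A i)" and sector_b: "sector i (B i)"
  using ccw_aa ccw_ab ccw_ba by (simp_all add: sector_def less_imp_le)

lemma not_sector_H: "\<not> sector i H"
  by (simp add: sector_def)

lemma inj_D: "inj D"
proof (rule injI)
  fix x y assume e: "D x = D y"
  have aa: "i = j" if "A i = A j" for i j using sector_unique[of i "A i" j] sector_a[of i]
    sector_a[of j] that by simp
  have bb: "i = j" if "B i = B j" for i j using sector_unique[of i "B i" j] sector_b[of i]
    sector_b[of j] that by simp
  have ab: "A i \<noteq> B j" for i j
  proof
    assume "A i = B j"
    with sector_unique[of i "A i" j] sector_a[of i] sector_b[of j] have "i = j" by simp
    with \<open>A i = B j\<close> ccw_ab[of i] show False by simp
  qed
  have h: "H \<noteq> A i" "H \<noteq> B i" for i using ccw_aa[of i] ccw_ab[of i]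
    by (auto; metis orient_same less_irrefl)+
  show "x = y"
    by (rule vertex_cases[of x]; rule vertex_cases[of y]) (use e aa bb ab h in metis)+
qed

lemma a_inj: "a i = a j \<longleftrightarrow> i = j" and b_inj: "b i = b j \<longleftrightarrow> i = j" and a_neq_b: "a i \<noteq> b j" "b j \<noteq> a i"
  and h_neq: "h \<noteq> a i" "a i \<noteq> h" "h \<noteq> b i" "b i \<noteq> h"
proof -
  show "a i = a j \<longleftrightarrow> i = j" using sector_unique[of i "A i" j] sector_a[of i] sector_a[of j] by metis
  show "b i = b j \<longleftrightarrow> i = j" using sector_unique[of i "B i" j] sector_b[of i] sector_b[of j] by metis
  show "a i \<noteq> b j"
  proof
    assume e: "a i = b j"
    with sector_unique[of i "A i" j] sector_a[of i] sector_b[of j] have "i = j" by simp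
    with e ccw_ab[of i] show False by (metis orient_same(3) less_irrefl)
  qed
  then show "b j \<noteq> a i" by simp
  show "h \<noteq> a i" using ccw_aa[of i] by (metis orient_same(1) less_irrefl)
  then show "a i \<noteq> h" by simp
  show "h \<noteq> b i" using ccw_bb[of i] by (metis orient_same(1) less_irrefl)
  then show "b i \<noteq> h" by simp
qed

text \<open>Localizes crossings: edges with interior points in common appear under the same sector,
  and on its first ray only two edges are possible. The edges of the inner quadrilateral are the
  only ones that pass from one sector to the next.\<close>

lemma edge_interior_sector:
  assumes "e \<in> E" "z \<in> edge_interior D e"
  obtains i where "sector i z" "orient H (A i) z = 0" "e = {h, a i} \<or> e = {b (i - 1), b i}"
    | i where "sector i z" "orient H (A i) z > 0"
      "e \<in> {{h, b i}, {a i, a (i + 1)}, {a i, b i}, {a (i + 1), b i}, {b i, b (i + 1)}, {b (i - 1),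
        b i}}"
  using assms(1)
proof (cases rule: edge_cases)
  case (1 i)
  with assms obtain t where t: "z = (1 - t) *\<^sub>R H + t *\<^sub>R A i" "0 < t" "t < 1"
    by (auto simp: edge_interior_pair in_segment)
  then have "orient H (A i) z = 0" "orient H z (A (i + 1)) > 0"
    using ccw_aa[of i] by (simp_all add: orient_segment)
  then show ?thesis using that(1)[of i] 1 by (auto simp: sector_def)
next
  case (2 i)
  with assms obtain t where t: "z = (1 - t) *\<^sub>R H + t *\<^sub>R B i" "0 < t" "t < 1"
    by (auto simp: edge_interior_pair in_segment)
  then have "orient H (A i) z > 0" "orient H z (A (i + 1)) > 0"
    using ccw_ab[of i] ccw_ba[of i] by (simp_all add: orient_segment)
  then show ?thesis using that(2)[of i] 2 by (auto simp: sector_def)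
next
  case (3 i)
  with assms obtain t where t: "z = (1 - t) *\<^sub>R A i + t *\<^sub>R A (i + 1)" "0 < t" "t < 1"
    by (auto simp: edge_interior_pair in_segment)
  then have "orient H (A i) z > 0" "orient H z (A (i + 1)) > 0"
    using ccw_aa[of i] by (simp_all add: orient_segment)
  then show ?thesis using that(2)[of i] 3 by (auto simp: sector_def)
next
  case (5 i)
  with assms obtain t where t: "z = (1 - t) *\<^sub>R A i + t *\<^sub>R B i" "0 < t" "t < 1"
    by (auto simp: edge_interior_pair in_segment)
  then have "orient H (A i) z > 0" "orient H z (A (i + 1)) > 0"
    using ccw_aa[of i] ccw_ab[of i] ccw_ba[of i] by (simp_all add: orient_segment add_pos_pos)
  then show ?thesis using that(2)[of i] 5 by (auto simp: sector_def)
next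
  case (6 i)
  with assms obtain t where t: "z = (1 - t) *\<^sub>R A (i + 1) + t *\<^sub>R B i" "0 < t" "t < 1"
    by (auto simp: edge_interior_pair in_segment)
  then have "orient H (A i) z > 0" "orient H z (A (i + 1)) > 0"
    using ccw_aa[of i] ccw_ab[of i] ccw_ba[of i] by (simp_all add: orient_segment add_pos_pos)
  then show ?thesis using that(2)[of i] 6 by (auto simp: sector_def)
next
  case (4 i)
  with assms obtain t where t: "z = (1 - t) *\<^sub>R B i + t *\<^sub>R B (i + 1)" "0 < t" "t < 1"
    by (auto simp: edge_interior_pair in_segment)
  then have z: "ccw H (B i) z" "ccw H z (B (i + 1))"
    using ccw_bb[of i] by (simp_all add: orient_segment)
  show ?thesis
  proof (cases "ccw H z (A (i + 1))")
    case True
    then have "ccw H (A i) z"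
      using ccw_trans'[of H "A i" "A (i + 1)" "B i" z] ccw_aa[of i] ccw_ba[of i] ccw_ab[of i] z by simp
    then show ?thesis using that(2)[of i] True 4 by (auto simp: sector_def)
  next
    case False
    then have ge: "orient H (A (i + 1)) z \<ge> 0" using orient_swap'[of H z "A (i + 1)"] by simp
    \<comment> \<open>Beyond the ray to \<open>a (i + 1)\<close> the edge ends at
      \<open>b (i + 1)\<close>; the relation shows that it stays before the ray to
      \<open>a (i + 2)\<close>.\<close>
    have "orient H z (A (i + 1 + 1)) * orient H (A (i + 1)) (B (i + 1)) =
        orient H (A (i + 1)) z * orient H (B (i + 1)) (A (i + 1 + 1)) + orient H z (B (i + 1)) *
          orient H (A (i + 1)) (A (i + 1 + 1))"
      by (simp add: orient_def algebra_simps)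
    also have "\<dots> > 0"
      using ge z ccw_ba[of "i + 1"] ccw_aa[of "i + 1"] by (intro add_nonneg_pos) simp_all
    finally have "orient H z (A (i + 1 + 1)) > 0"
      using ccw_ab[of "i + 1"] by (simp add: zero_less_mult_iff)
    with ge have "sector (i + 1) z" by (simp add: sector_def)
    then show ?thesis using that[of "i + 1"] 4 ge by (cases "orient H (A (i + 1)) z = 0") auto
  qed
qed

end

section \<open>Vertices on edges and crossings of edges\<close>

context antiprism_drawing
begin

text \<open>A sector contains two vertices, \<open>a i\<close> on its first ray and
  \<open>b i\<close> in its interior. This leaves \<open>a j\<close> on
  \<open>{b (j - 1), b j}\<close> and \<open>b j\<close> on \<open>{a j, a (j + 1)}\<close>,
  excluded by \<open>ccw_bab\<close> and \<open>ccw_aab\<close>.\<close>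

lemma vertex_not_on_edge:
  assumes e: "e \<in> E" and v: "v \<notin> e"
  shows "D v \<notin> edge_segment D e"
proof
  assume "D v \<in> edge_segment D e"
  then have z: "D v \<in> edge_interior D e"
    using v inj_D by (auto simp: edge_interior_def inj_eq)
  show False
    using e z
  proof (cases rule: edge_interior_sector)
    case (1 i)
    show False
    proof (cases v rule: vertex_cases)
      case 1 with \<open>sector i (D v)\<close> not_sector_H show False by simp
    next
      case (3 j)
      with 1 sector_unique[OF \<open>sector i (D v)\<close>, of j] sector_b[of j] have "i = j" by simp
      with 1 3 ccw_ab[of j] show False by simp
    next
      case (2 j)
      with 1 sector_unique[OF \<open>sector i (D v)\<close>, of j] sector_a[of j] have "i = j" by simp
      with 1 2 v have "e = {b (j - 1), b j}" by auto
      with z 2 obtain t where "A j = (1 - t) *\<^sub>R B (j - 1) + t *\<^sub>R B j"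
        by (auto simp: edge_interior_pair in_segment)
      then have "orient (B (j - 1)) (A j) (B j) = 0"
        by (simp add: orient_segment)
      with ccw_bab[of "j - 1"] show False by simp
    qed
  next
    case (2 i)
    show False
    proof (cases v rule: vertex_cases)
      case 1 with \<open>sector i (D v)\<close> not_sector_H show False by simp
    next
      case (2 j)
      with \<open>orient H (A i) (D v) > 0\<close> sector_unique[OF \<open>sector i (D v)\<close>, of j] sector_a[of j]
        show False by simp
    next
      case (3 j)
      with sector_unique[OF \<open>sector i (D v)\<close>, of j] sector_b[of j] have "i = j" by simp
      with 2 3 v have "e = {a j, a (j + 1)}" by auto
      with z 3 obtain t where "B j = (1 - t) *\<^sub>R A j + t *\<^sub>R A (j + 1)"
        by (auto simp: edge_interior_pair in_segment)
      then have "orient (A j) (A (j + 1)) (B j) = 0"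
        by (simp add: orient_segment)
      with ccw_aab[of j] show False by simp
    qed
  qed
qed

lemma adjacent_edges_disjoint_interiors:
  assumes "{x, y} \<in> E" "{x, y'} \<in> E" "y \<noteq> y'" "x \<noteq> y" "x \<noteq> y'"
  shows "open_segment (D x) (D y) \<inter> open_segment (D x) (D y') = {}"
  using open_segments_common_endpoint[of _ "D x" "D y" "D y'"] vertex_not_on_edge[of "{x, y}" y']
    vertex_not_on_edge[of "{x, y'}" y] assms by (auto simp: edge_segment_pair)

lemma edges_mem:
  "{h, a i} \<in> E" "{h, b i} \<in> E" "{a i, a (i + 1)} \<in> E" "{b i, b (i + 1)} \<in> E" "{a i, b i} \<in> E"
    "{a (i + 1), b i} \<in> E"
  "{b (i - 1), b i} \<in> E"
  unfolding edges by (blast, blast, blast, blast, blast, blast, intro UN_I[of "i - 1"]) simp_all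

definition crossing_pair :: "4 \<Rightarrow> 'v set set" where
  "crossing_pair i = {{h, a i}, {b (i - 1), b i}}"

text \<open>Edges with a common end are disjoint otherwise. In the other cases a line separates: the
  rim line for the spoke, and the line through \<open>b i\<close> and \<open>a (i + 1)\<close> or
  \<open>a i\<close> for the two inner edges at \<open>b i\<close>.\<close>

lemma rim_edge_not_crossed:
  assumes "sector i z" "z \<in> open_segment (A i) (A (i + 1))"
    and "e \<in> {{h, b i}, {a i, b i}, {a (i + 1), b i}, {b i, b (i + 1)}, {b (i - 1), b i}}"
  shows "z \<notin> edge_interior D e"
proof
  assume z: "z \<in> edge_interior D e"
  obtain s where s: "z = (1 - s) *\<^sub>R A i + s *\<^sub>R A (i + 1)" "0 < s" "s < 1"
    using assms(2) by (auto simp: in_segment)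
  consider "e = {h, b i}" | "e = {a i, b i}" | "e = {a (i + 1), b i}" | "e = {b i, b (i + 1)}"
    | "e = {b (i - 1), b i}"
    using assms(3) by auto
  then show False
  proof cases
    case 1
    then obtain t where t: "z = (1 - t) *\<^sub>R H + t *\<^sub>R B i" "0 < t" "t < 1"
      using z by (auto simp: edge_interior_pair in_segment)
    have "orient (A i) (A (i + 1)) H > 0" using ccw_aa[of i] by (simp add: orient_rotate)
    then have "orient (A i) (A (i + 1)) z > 0" unfolding t(1) orient_segment using t ccw_aab[of i]
      by (simp add: add_pos_pos)
    moreover have "orient (A i) (A (i + 1)) z = 0" unfolding s(1) orient_segment by simp
    ultimately show False by simp
  next
    case 2
    with z assms(2) adjacent_edges_disjoint_interiors[of "a i" "b i" "a (i + 1)"] edges_mem[of i]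
      a_neq_b a_inj show False
      by (auto simp: edge_interior_pair)
  next
    case 3
    with z assms(2) adjacent_edges_disjoint_interiors[of "a (i + 1)" "b i" "a i"] edges_mem[of i]
      a_neq_b a_inj show False
      by (auto simp: edge_interior_pair insert_commute open_segment_commute)
  next
    case 4
    then obtain t where t: "z = (1 - t) *\<^sub>R B i + t *\<^sub>R B (i + 1)" "0 < t" "t < 1"
      using z by (auto simp: edge_interior_pair in_segment)
    have "orient (B i) (A (i + 1)) z > 0" unfolding t(1) orient_segment using t ccw_bab[of i] by simp
    moreover have "orient (B i) (A (i + 1)) (A i) < 0"
      using ccw_aab[of i] orient_swap'[of "B i" "A i" "A (i + 1)"] orient_rotate[of "A i"
        "A (i + 1)" "B i"] by simp
    then have "orient (B i) (A (i + 1)) z < 0" unfolding s(1) orient_segment using s by (simp add: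
      mult_pos_neg)
    ultimately show False by simp
  next
    case 5
    then obtain t where t: "z = (1 - t) *\<^sub>R B (i - 1) + t *\<^sub>R B i" "0 < t" "t < 1"
      using z by (auto simp: edge_interior_pair in_segment)
    have "orient (A i) (B i) (B (i - 1)) > 0" using ccw_bab[of "i - 1"] by (simp add: orient_rotate)
    then have "orient (A i) (B i) z > 0" unfolding t(1) orient_segment using t by simp
    moreover have "orient (A i) (B i) (A (i + 1)) < 0"
      using ccw_aab[of i] orient_swap'[of "A i" "B i" "A (i + 1)"] by simp
    then have "orient (A i) (B i) z < 0" unfolding s(1) orient_segment using s by (simp add:
      mult_pos_neg)
    ultimately show False by simp
  qed
qed

text \<open>On the first ray of a sector only the two edges of \<open>crossing_pair\<close> occur.
  Off this ray, with the rim edge set aside, all candidates end in \<open>b i\<close> and so share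
  no interior point.\<close>

lemma crossing_edges:
  assumes e: "e \<in> E" "z \<in> edge_interior D e" and f: "f \<in> E" "z \<in> edge_interior D f" and "e \<noteq> f"
  obtains i where "{e, f} = crossing_pair i"
  using e
proof (cases rule: edge_interior_sector)
  case (1 i)
  note e' = 1
  show ?thesis
    using f
  proof (cases rule: edge_interior_sector)
    case (1 j)
    with e' sector_unique have "j = i" by blast
    with e' 1 \<open>e \<noteq> f\<close> show ?thesis using that[of i] by (auto simp: crossing_pair_def)
  next
    case (2 j)
    with e' sector_unique have "j = i" by blast
    with e' 2 show ?thesis by simp
  qed
next
  case (2 i)
  note e' = 2
  show ?thesis
    using f
  proof (cases rule: edge_interior_sector)
    case (1 j)
    with e' sector_unique have "j = i" by blast
    with e' 1 show ?thesis by simp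
  next
    case (2 j)
    with e' sector_unique have "j = i" by blast
    note f' = 2[unfolded this]
    have rim: "z \<notin> open_segment (A i) (A (i + 1))"
    proof
      assume "z \<in> open_segment (A i) (A (i + 1))"
      then show False
        using rim_edge_not_crossed[OF f'(1), of e] rim_edge_not_crossed[OF f'(1), of f]
          e f e'(3) f'(3) \<open>e \<noteq> f\<close>
        by (elim insertE emptyE) simp_all
    qed
    have at_b: "\<exists>y. g = {b i, y} \<and> y \<noteq> b i" if "z \<in> edge_interior D g"
      "g \<in> {{h, b i}, {a i, a (i + 1)}, {a i, b i}, {a (i + 1), b i}, {b i, b (i + 1)}, {b (i - 1),
        b i}}" for g
    proof -
      have "g \<in> {{b i, h}, {b i, a i}, {b i, a (i + 1)}, {b i, b (i + 1)}, {b i, b (i - 1)}}"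
        using that rim by (auto simp: edge_interior_pair insert_commute)
      then show ?thesis using a_neq_b h_neq b_inj by auto
    qed
    obtain y y' where y: "e = {b i, y}" "y \<noteq> b i" "f = {b i, y'}" "y' \<noteq> b i"
      using at_b[OF e(2) e'(3)] at_b[OF f(2) f'(3)] by auto
    with e f \<open>e \<noteq> f\<close> adjacent_edges_disjoint_interiors[of "b i" y y'] show ?thesis
      by (auto simp: edge_interior_pair)
  qed
qed

lemma edge_vertices:
  assumes "e \<in> E"
  obtains x y where "e = {x, y}" "x \<noteq> y"
  using assms by (cases rule: edge_cases) (use a_neq_b h_neq a_inj b_inj that in auto)

text \<open>Along the edge from \<open>b (i - 1)\<close> to \<open>b i\<close> the affine function
  \<open>orient H (A i)\<close> has end values of opposite sign, hence one zero.\<close>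

lemma crossing_point_unique:
  assumes "z \<in> open_segment H (A i)" "z \<in> open_segment (B (i - 1)) (B i)"
    "z' \<in> open_segment H (A i)" "z' \<in> open_segment (B (i - 1)) (B i)"
  shows "z = z'"
proof -
  obtain t where t: "z = (1 - t) *\<^sub>R B (i - 1) + t *\<^sub>R B i" using assms(2) by (auto simp: in_segment)
  obtain s where s: "z' = (1 - s) *\<^sub>R B (i - 1) + s *\<^sub>R B i" using assms(4) by (auto simp: in_segment)
  have "orient H (A i) z = 0" "orient H (A i) z' = 0"
    using assms(1,3) by (auto simp: in_segment orient_segment)
  then have "(t - s) * (orient H (A i) (B i) - orient H (A i) (B (i - 1))) = 0"
    unfolding t s orient_segment by (simp add: algebra_simps)
  moreover have "orient H (A i) (B (i - 1)) < 0"
    using ccw_ba[of "i - 1"] orient_swap'[of H "A i" "B (i - 1)"] by simp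
  ultimately show ?thesis using ccw_ab[of i] t s by simp
qed

lemma straight_line: "straight_line_drawing E D"
  unfolding straight_line_drawing_def
proof (intro conjI ballI impI allI)
  fix e f assume e: "e \<in> E" and f: "f \<in> E" and "e \<noteq> f"
  show "\<exists>z. edge_segment D e \<inter> edge_segment D f \<subseteq> {z}"
  proof (cases "e \<inter> f = {}")
    case False
    then obtain x y y' where xy: "e = {x, y}" "f = {x, y'}" "y \<noteq> y'" "x \<noteq> y" "x \<noteq> y'"
      using edge_vertices[OF e] edge_vertices[OF f] \<open>e \<noteq> f\<close> by (smt (verit) Int_iff all_not_in_conv
        doubleton_eq_iff insertE singletonD)
    have "D y \<notin> edge_segment D f" "D y' \<notin> edge_segment D e"
      using vertex_not_on_edge e f xy by auto
    then have "edge_segment D e \<inter> edge_segment D f \<subseteq> {D x}"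
      using adjacent_edges_disjoint_interiors[of x y y'] e f xy(3-5) unfolding xy(1,2)
        edge_segment_pair open_segment_def by auto
    then show ?thesis by blast
  next
    case True
    have int: "z \<in> edge_interior D e \<and> z \<in> edge_interior D f"
      if "z \<in> edge_segment D e \<inter> edge_segment D f" for z
      using that True vertex_not_on_edge[OF e] vertex_not_on_edge[OF f] by (auto simp: edge_interior_def)
    show ?thesis
    proof (cases "edge_segment D e \<inter> edge_segment D f = {}")
      case False
      then obtain z where z: "z \<in> edge_segment D e \<inter> edge_segment D f" by blast
      then obtain i where i: "{e, f} = crossing_pair i"
        using crossing_edges[of e z f] int[OF z] e f \<open>e \<noteq> f\<close> by blast
      have "z' = z" if "z' \<in> edge_segment D e \<inter> edge_segment D f" for z'
        using int[OF z] int[OF that] i crossing_point_unique[of z i z']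
        by (auto simp: crossing_pair_def doubleton_eq_iff edge_interior_pair)
      then show ?thesis by blast
    qed simp
  qed
qed (use inj_D vertex_not_on_edge in auto)

end

section \<open>Angles and cyclic orders\<close>

definition cyclic_triple :: "'a list \<Rightarrow> 'a \<Rightarrow> 'a \<Rightarrow> 'a \<Rightarrow> bool" where
  "cyclic_triple L x y z \<longleftrightarrow>
     (\<exists>i j k. i < j \<and> j < k \<and> k < length L \<and>
        (x, y, z) \<in> {(L ! i, L ! j, L ! k), (L ! j, L ! k, L ! i), (L ! k, L ! i, L ! j)})"

lemma cyclic_triple_sorted:
  fixes f :: "'a \<Rightarrow> real"
  assumes s: "sorted_wrt (<) (map f L)" and "x \<in> set L" "y \<in> set L" "z \<in> set L"
  shows "cyclic_triple L x y z \<longleftrightarrow> f x < f y \<and> f y < f z \<or> f y < f z \<and> f z < f x \<or> f z < f x \<and> f x < f y"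
proof -
  have less: "f (L ! i) < f (L ! j)" if "i < j" "j < length L" for i j
    using sorted_wrt_nth_less[OF s, of i j] that by simp
  have iff: "f (L ! i) < f (L ! j) \<longleftrightarrow> i < j" if "i < length L" "j < length L" for i j
    using less[of i j] less[of j i] that by (cases i j rule: linorder_cases) auto
  have inj: "L ! i = L ! j \<longleftrightarrow> i = j" if "i < length L" "j < length L" for i j
    using less[of i j] less[of j i] that by (cases i j rule: linorder_cases) auto
  obtain i j k where ijk: "i < length L" "j < length L" "k < length L" "x = L ! i" "y = L ! j" "z =
    L ! k"
    using assms(2-4) by (metis in_set_conv_nth)
  have "cyclic_triple L x y z \<longleftrightarrow> i < j \<and> j < k \<or> j < k \<and> k < i \<or> k < i \<and> i < j"
  proof
    assume "cyclic_triple L x y z"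
    then obtain i' j' k' where *: "i' < j'" "j' < k'" "k' < length L"
      "(x, y, z) \<in> {(L ! i', L ! j', L ! k'), (L ! j', L ! k', L ! i'), (L ! k', L ! i', L ! j')}"
      unfolding cyclic_triple_def by blast
    then show "i < j \<and> j < k \<or> j < k \<and> k < i \<or> k < i \<and> i < j"
      using ijk inj[of i i'] inj[of i j'] inj[of i k'] inj[of j i'] inj[of j j'] inj[of j k']
        inj[of k i'] inj[of k j'] inj[of k k'] by auto
  next
    assume "i < j \<and> j < k \<or> j < k \<and> k < i \<or> k < i \<and> i < j"
    then show "cyclic_triple L x y z"
      unfolding cyclic_triple_def ijk(4-6) using ijk(1-3) by blast
  qed
  then show ?thesis unfolding ijk(4-6) by (simp add: iff ijk(1-3))
qed

text \<open>The angle at \<open>p\<close>, counterclockwise from the direction of \<open>u\<close>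
  to that of \<open>q\<close>; this is the quantity compared in \<open>rotation\<close>.\<close>

definition angle :: "complex \<Rightarrow> complex \<Rightarrow> complex \<Rightarrow> real" where
  "angle p u q = Arg2pi ((q - p) / (u - p))"

lemma angle_bounds: "0 \<le> angle p u q" "angle p u q < 2 * pi"
  by (simp_all add: angle_def Arg2pi_ge_0 Arg2pi_lt_2pi)

lemma Im_quotient_orient: "q \<noteq> p \<Longrightarrow> Im ((r - p) / (q - p)) > 0 \<longleftrightarrow> ccw p q r"
proof -
  assume "q \<noteq> p"
  then have "(Re (q - p))\<^sup>2 + (Im (q - p))\<^sup>2 > 0"
    by (metis cmod_power2 right_minus_eq zero_less_norm_iff zero_less_power)
  then show ?thesis by (simp add: Im_divide orient_def zero_less_divide_iff mult.commute)
qed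

lemma ccw_distinct: "ccw p q r \<Longrightarrow> q \<noteq> p \<and> r \<noteq> p \<and> q \<noteq> r"
  by auto

lemma angle_ccw:
  assumes "ccw p q r"
  shows "0 < angle p q r" "angle p q r < pi"
  using Arg2pi_lt_pi[of "(r - p) / (q - p)"] Im_quotient_orient[of q p r] assms ccw_distinct[OF assms]
  by (simp_all add: angle_def)

lemma angle_gt_pi:
  assumes "ccw p r u"
  shows "pi < angle p u r"
proof -
  have "Im ((r - p) / (u - p)) < 0"
  proof -
    have "u \<noteq> p" using ccw_distinct[OF assms] by simp
    then have "(Re (u - p))\<^sup>2 + (Im (u - p))\<^sup>2 > 0"
      by (metis cmod_power2 right_minus_eq zero_less_norm_iff zero_less_power)
    then show ?thesis using assms by (simp add: Im_divide orient_def divide_less_0_iff mult.commute)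
  qed
  then show ?thesis using Arg2pi_le_pi[of "(r - p) / (u - p)"] by (auto simp: angle_def)
qed

lemma angle_add:
  assumes "u \<noteq> p" "q \<noteq> p" "r \<noteq> p"
  shows "angle p u r = angle p u q + angle p q r \<or> angle p u r = angle p u q + angle p q r - 2 * pi"
proof -
  have "(r - p) / (u - p) = ((q - p) / (u - p)) * ((r - p) / (q - p))" using assms by simp
  then show ?thesis
    using Arg2pi_times[of "(q - p) / (u - p)" "(r - p) / (q - p)"] assms by (simp add: angle_def)
qed

text \<open>Angles add unless the sum passes the direction of \<open>u\<close>. A step of less than
  a half-turn cannot do so if it starts in the first half-turn or ends in the second.\<close>

lemma angle_step:
  assumes "u \<noteq> p" "ccw p q s" "angle p u q < pi \<or> pi < angle p u s"
  shows "angle p u s = angle p u q + angle p q s"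
  using angle_add[of u p q s] ccw_distinct[OF assms(2)] angle_ccw[OF assms(2)] assms(1,3)
    angle_bounds[of p u q] angle_bounds[of p u s] by auto

lemma angle_less:
  assumes "u \<noteq> p" "ccw p q s" "angle p u q < pi \<or> pi < angle p u s"
  shows "angle p u q < angle p u s"
  using angle_step[OF assms] angle_ccw[OF assms(2)] by simp

lemma angle_between:
  assumes u: "u \<noteq> p" and qs: "ccw p q s" "angle p u q < pi \<or> pi < angle p u s" and r: "ccw p q r"
    "ccw p r s"
  shows "angle p u q < angle p u r" "angle p u r < angle p u s"
proof -
  have "angle p q s = angle p q r + angle p r s"
    using angle_add[of q p r s] ccw_distinct[OF r(1)] ccw_distinct[OF r(2)] angle_ccw[OF r(1)]
      angle_ccw[OF r(2)]
      angle_bounds[of p q s] by auto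
  moreover have "angle p u r = angle p u q + angle p q r"
    using angle_add[of u p q r] u ccw_distinct[OF r(1)] angle_step[OF u qs] angle_bounds[of p u s]
      angle_bounds[of p u r]
      calculation angle_ccw[OF r(2)] by auto
  ultimately show "angle p u q < angle p u r" "angle p u r < angle p u s"
    using angle_step[OF u qs] angle_ccw[OF r(1)] angle_ccw[OF r(2)] by simp_all
qed

lemma angle_self: "u \<noteq> p \<Longrightarrow> angle p u u = 0"
  by (simp add: angle_def Arg2pi_eq_0)

lemma angle_scale:
  assumes "c > 0" "q' - p = of_real c * (q - p)"
  shows "angle p u q' = angle p u q" "angle p q' u = angle p q u"
proof -
  have "(q' - p) / (u - p) = of_real c * ((q - p) / (u - p))" using assms(2) by simp
  then show "angle p u q' = angle p u q"
    unfolding angle_def using assms(1) by (metis Arg2pi_times_of_real)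
  have "(u - p) / (q' - p) = of_real (1 / c) * ((u - p) / (q - p))" using assms by simp
  then show "angle p q' u = angle p q u"
    unfolding angle_def using assms(1) by (metis Arg2pi_times_of_real zero_less_divide_1_iff)
qed

text \<open>\<open>rotation\<close> measures angles from the first of three neighbours, while the
  list is sorted by angles from a fixed \<open>u\<close>. Changing the reference is a shift modulo a
  full turn, which preserves cyclic order.\<close>

lemma cyclic_triple_iff_angle:
  assumes s: "sorted_wrt (<) (map (\<lambda>m. angle p u (f m)) L)" and u: "u \<noteq> p"
    and L: "\<And>m. m \<in> set L \<Longrightarrow> f m \<noteq> p" and xyz: "x \<in> set L" "y \<in> set L" "z \<in> set L"
  shows "0 < angle p (f x) (f y) \<and> angle p (f x) (f y) < angle p (f x) (f z) \<longleftrightarrow> cyclic_triple L x y z"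
proof -
  have add: "angle p (f m) (f m') = (if angle p u (f m) \<le> angle p u (f m') then angle p u (f m') -
    angle p u (f m)
      else angle p u (f m') - angle p u (f m) + 2 * pi)" if "m \<in> set L" "m' \<in> set L" for m m'
    using angle_add[OF u L L, OF that] angle_bounds[of p "f m" "f m'"] angle_bounds[of p u "f m"]
      angle_bounds[of p u "f m'"]
    by auto
  show ?thesis
    unfolding cyclic_triple_sorted[OF s xyz] add[OF xyz(1,2)] add[OF xyz(1,3)]
    using angle_bounds[of p u "f x"] angle_bounds[of p u "f y"] angle_bounds[of p u "f z"] by auto
qed

section \<open>The planarization and its embedding\<close>

lemma darts_on_uncrossed_segment:
  fixes x y :: "'a :: euclidean_space"
  assumes "N \<inter> closed_segment x y = {x, y}" "x \<noteq> y"
  shows "p \<noteq> q \<and> closed_segment p q \<subseteq> closed_segment x y \<and> closed_segment p q \<inter> N = {p, q} \<longleftrightarrow>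
    (p, q) \<in> {(x, y), (y, x)}"
proof
  assume d: "p \<noteq> q \<and> closed_segment p q \<subseteq> closed_segment x y \<and> closed_segment p q \<inter> N = {p, q}"
  then have "p \<in> closed_segment p q \<inter> N" "q \<in> closed_segment p q \<inter> N" by simp_all
  then have "p \<in> N \<inter> closed_segment x y" "q \<in> N \<inter> closed_segment x y" using d by blast+
  then have "p \<in> {x, y}" "q \<in> {x, y}" by (simp_all only: assms(1))
  with conjunct1[OF d] show "(p, q) \<in> {(x, y), (y, x)}" by auto
next
  have e: "closed_segment y x = closed_segment x y" "closed_segment x y \<inter> N = {x, y}" "{y, x} = {x, y}"
    using assms(1) by (simp_all add: closed_segment_commute Int_commute insert_commute)
  assume "(p, q) \<in> {(x, y), (y, x)}"
  then show "p \<noteq> q \<and> closed_segment p q \<subseteq> closed_segment x y \<and> closed_segment p q \<inter> N = {p, q}"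
    using assms(2) by (elim insertE emptyE) (simp_all add: e)
qed

lemma darts_on_crossed_segment:
  fixes x y :: "'a :: euclidean_space"
  assumes N: "N \<inter> closed_segment x y = {x, y, c}" and c: "c \<in> open_segment x y"
  shows "p \<noteq> q \<and> closed_segment p q \<subseteq> closed_segment x y \<and> closed_segment p q \<inter> N = {p, q} \<longleftrightarrow>
    (p, q) \<in> {(x, c), (c, x), (y, c), (c, y)}"
proof
  assume d: "p \<noteq> q \<and> closed_segment p q \<subseteq> closed_segment x y \<and> closed_segment p q \<inter> N = {p, q}"
  then have "p \<in> closed_segment p q \<inter> N" "q \<in> closed_segment p q \<inter> N" by simp_all
  then have "p \<in> N \<inter> closed_segment x y" "q \<in> N \<inter> closed_segment x y" using d by blast+
  then have pq: "p \<in> {x, y, c}" "q \<in> {x, y, c}" by (simp_all only: N)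
  have "c \<in> N \<inter> closed_segment x y" unfolding N by simp
  moreover have "c \<noteq> x" "c \<noteq> y" using c by (auto simp: open_segment_def)
  ultimately have cN: "c \<in> closed_segment x y \<inter> N" "c \<noteq> x" "c \<noteq> y" by simp_all
  have "(p, q) \<noteq> (x, y)"
  proof
    assume e: "(p, q) = (x, y)"
    then have "closed_segment x y \<inter> N = {x, y}" using d by simp
    with cN show False by simp
  qed
  moreover have "(p, q) \<noteq> (y, x)"
  proof
    assume e: "(p, q) = (y, x)"
    then have "closed_segment x y \<inter> N = {y, x}" using d by (simp add: closed_segment_commute)
    with cN show False by simp
  qed
  ultimately show "(p, q) \<in> {(x, c), (c, x), (y, c), (c, y)}" using pq conjunct1[OF d] by auto
next
  have *: "x \<noteq> c \<and> closed_segment x c \<subseteq> closed_segment x y \<and> closed_segment x c \<inter> N = {x, c}"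
    if "N \<inter> closed_segment x y = {x, y, c}" "c \<in> open_segment x y" for x y
  proof -
    have sub: "closed_segment x c \<subseteq> closed_segment x y"
      using that(2) by (simp add: subset_closed_segment open_segment_def)
    have "y \<notin> closed_segment x c"
      using dist_in_closed_segment[of y x c] dist_in_open_segment[OF that(2)]
        by (auto simp: dist_commute)
    moreover have "x \<noteq> c" using that(2) by (auto simp: open_segment_def)
    moreover have "closed_segment x c \<inter> N = closed_segment x c \<inter> {x, y, c}"
      using sub that(1) by blast
    ultimately show ?thesis using sub by auto
  qed
  have y: "N \<inter> closed_segment y x = {y, x, c}" "c \<in> open_segment y x"
    using N c closed_segment_commute[of x y] open_segment_commute[of x y]
      by (simp_all add: insert_commute)
  assume "(p, q) \<in> {(x, c), (c, x), (y, c), (c, y)}"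
  then show "p \<noteq> q \<and> closed_segment p q \<subseteq> closed_segment x y \<and> closed_segment p q \<inter> N = {p, q}"
    using *[OF N c] *[OF y] not_sym[of x c] not_sym[of y c]
    by (elim insertE emptyE) (simp_all add: closed_segment_commute[of y x]
      closed_segment_commute[of c] insert_commute[of c])
qed

definition crossing_node :: "'v \<Rightarrow> (4 \<Rightarrow> 'v) \<Rightarrow> (4 \<Rightarrow> 'v) \<Rightarrow> 4 \<Rightarrow> 'v node" where
  "crossing_node h a b i = Crossing {{h, a i}, {b (i - 1), b i}}"

text \<open>The neighbours of each node are listed counterclockwise, for a drawing in which \<open>a\<close> runs
  counterclockwise around the outer face.\<close>
definition antiprism_rotation :: "'v \<Rightarrow> (4 \<Rightarrow> 'v) \<Rightarrow> (4 \<Rightarrow> 'v) \<Rightarrow> ('v node \<times> 'v node list) set" where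
  "antiprism_rotation h a b = (let X = crossing_node h a b in
     insert (Vertex h, [X 0, Vertex (b 0), X 1, Vertex (b 1), X 2, Vertex (b 2), X 3, Vertex (b 3)])
     (\<Union>i. {(Vertex (a i), [Vertex (a (i + 1)), Vertex (b i), X i, Vertex (b (i - 1)),
       Vertex (a (i - 1))]),
           (Vertex (b i), [Vertex h, X i, Vertex (a i), Vertex (a (i + 1)), X (i + 1)]),
           (X i, [Vertex h, Vertex (b (i - 1)), Vertex (a i), Vertex (b i)])}))"

text \<open>Outer darts descend in the index because the outer face is on the left of a dart that
  goes clockwise along the rim.\<close>

definition antiprism_embedding :: "'v \<Rightarrow> (4 \<Rightarrow> 'v) \<Rightarrow> (4 \<Rightarrow> 'v) \<Rightarrow> 'v embedding" where
  "antiprism_embedding h a b =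
     \<lparr> darts = {(n, m). \<exists>L. (n, L) \<in> antiprism_rotation h a b \<and> m \<in> set L},
       rotation = {(n, x, y, z). \<exists>L. (n, L) \<in> antiprism_rotation h a b \<and> cyclic_triple L x y z},
       outer_darts = range (\<lambda>i. (Vertex (a (i + 1)), Vertex (a i))) \<rparr>"

section \<open>Nodes and darts of the planarization\<close>

context antiprism_drawing
begin

abbreviation xn :: "4 \<Rightarrow> 'v node" where "xn \<equiv> crossing_node h a b"

definition X :: "4 \<Rightarrow> complex" where
  "X i = (THE z. z \<in> open_segment H (A i) \<and> z \<in> open_segment (B (i - 1)) (B i))"

text \<open>The signs put \<open>h\<close>, \<open>b (i - 1)\<close>, \<open>a i\<close>,
  \<open>b i\<close> in convex position, so all four crossings are present in every such
  drawing.\<close>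

lemma X_mem: "X i \<in> open_segment H (A i)" "X i \<in> open_segment (B (i - 1)) (B i)"
proof -
  have "crosses H (A i) (B (i - 1)) (B i)"
    using ccw_ba[of "i - 1"] ccw_bab[of "i - 1"] ccw_ab[of i] ccw_bb[of "i - 1"]
    by (simp add: crosses_def orient_rotate orient_rotate')
  then obtain z where z: "z \<in> closed_segment H (A i)" "z \<in> closed_segment (B (i - 1)) (B i)"
    using crosses_imp_segments_meet by blast
  have "H \<notin> closed_segment (B (i - 1)) (B i)" "A i \<notin> closed_segment (B (i - 1)) (B i)"
    "B (i - 1) \<notin> closed_segment H (A i)" "B i \<notin> closed_segment H (A i)"
    using vertex_not_on_edge[OF edges_mem(7)[of i]] vertex_not_on_edge[OF edges_mem(1)[of i]]
      h_neq a_neq_b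
    by (auto simp: edge_segment_pair)
  then have "z \<in> open_segment H (A i) \<and> z \<in> open_segment (B (i - 1)) (B i)"
    using z by (auto simp: open_segment_def)
  then have "X i \<in> open_segment H (A i) \<and> X i \<in> open_segment (B (i - 1)) (B i)"
    unfolding X_def by (rule theI) (use crossing_point_unique \<open>z \<in> open_segment H (A i) \<and> _\<close> in blast)
  then show "X i \<in> open_segment H (A i)" "X i \<in> open_segment (B (i - 1)) (B i)" by auto
qed

lemma crossing_pair_eq_iff: "{h, a i} \<in> crossing_pair j \<longleftrightarrow> i = j" "{b (i - 1),
  b i} \<in> crossing_pair j \<longleftrightarrow> i = j"
proof -
  have "i - 1 \<noteq> i" by simp
  \<comment> \<open>Two inner edges could also coincide with their ends exchanged; this would
    require 2 = 0 modulo 4.\<close>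
  have "i = j" if "i - 1 = j" "i = j - 1"
  proof -
    have "j - 1 - 1 = j" using that by simp
    then show ?thesis by (simp add: diff_diff_eq)
  qed
  then show "{h, a i} \<in> crossing_pair j \<longleftrightarrow> i = j" "{b (i - 1), b i} \<in> crossing_pair j \<longleftrightarrow> i = j"
    using h_neq a_neq_b a_inj b_inj by (auto simp: crossing_pair_def doubleton_eq_iff)
qed

lemma crossing_pair_subset: "crossing_pair i \<subseteq> E"
  using edges_mem by (auto simp: crossing_pair_def)

lemma X_interior_iff:
  assumes "e \<in> E"
  shows "X i \<in> edge_interior D e \<longleftrightarrow> e \<in> crossing_pair i"
proof
  assume X: "X i \<in> edge_interior D e"
  show "e \<in> crossing_pair i"
  proof (cases "e = {h, a i}")
    case True
    then show ?thesis by (simp add: crossing_pair_def)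
  next
    case False
    have "X i \<in> edge_interior D {h, a i}" using X_mem(1) by (simp add: edge_interior_pair)
    then obtain j where j: "{e, {h, a i}} = crossing_pair j"
      using crossing_edges[OF assms X edges_mem(1) _ False] by metis
    have "{h, a i} \<in> crossing_pair j" by (simp flip: j)
    then have "i = j" by (simp add: crossing_pair_eq_iff)
    then show ?thesis by (simp flip: j)
  qed
next
  assume "e \<in> crossing_pair i"
  then show "X i \<in> edge_interior D e" using X_mem[of i] by (auto simp: crossing_pair_def
    edge_interior_pair)
qed

lemma X_not_vertex: "X i \<noteq> D v"
proof
  assume e: "X i = D v"
  have "X i \<in> edge_interior D {h, a i}" using X_mem by (simp add: edge_interior_pair)
  then have "v \<notin> {h, a i}" "X i \<in> edge_segment D {h, a i}" unfolding edge_interior_def e by auto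
  then show False using vertex_not_on_edge[OF edges_mem(1)] e by metis
qed

lemma X_segment_iff: "e \<in> E \<Longrightarrow> X i \<in> edge_segment D e \<longleftrightarrow> e \<in> crossing_pair i"
  using X_interior_iff[of e i] X_not_vertex[of i] by (auto simp: edge_interior_def)

lemma crossing_points_eq: "crossing_points E D = range X"
proof (intro equalityI subsetI)
  fix z assume "z \<in> crossing_points E D"
  then obtain e f where ef: "e \<in> E" "f \<in> E" "e \<noteq> f" "z \<in> edge_interior D e" "z \<in> edge_interior D f"
    by (auto simp: crossing_points_def)
  then obtain i where i: "{e, f} = crossing_pair i" using crossing_edges by blast
  then have "z \<in> open_segment H (A i)" "z \<in> open_segment (B (i - 1)) (B i)"
    using ef by (auto simp: crossing_pair_def doubleton_eq_iff edge_interior_pair)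
  then have "z = X i" using X_mem crossing_point_unique by blast
  then show "z \<in> range X" by blast
next
  fix z assume "z \<in> range X"
  then obtain i where "z = X i" by blast
  moreover have "{h, a i} \<noteq> {b (i - 1), b i}" using h_neq by (auto simp: doubleton_eq_iff)
  ultimately have "{h, a i} \<noteq> {b (i - 1), b i} \<and> z \<in> edge_interior D {h,
    a i} \<inter> edge_interior D {b (i - 1), b i}"
    using X_mem[of i] by (simp add: edge_interior_pair)
  then have "\<exists>f\<in>E. {h, a i} \<noteq> f \<and> z \<in> edge_interior D {h, a i} \<inter> edge_interior D f"
    by (rule bexI[OF _ edges_mem(7)])
  then show "z \<in> crossing_points E D"
    unfolding crossing_points_def mem_Collect_eq by (rule bexI[OF _ edges_mem(1)])
qed

lemma node_of_vertex: "node_of E D (D v) = Vertex v"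
  using inj_D by (simp add: node_of_def)

lemma node_of_X: "node_of E D (X i) = xn i"
proof -
  have "{e \<in> E. X i \<in> edge_interior D e} = crossing_pair i"
    using X_interior_iff[of _ i] crossing_pair_subset[of i] by fast
  moreover have "X i \<notin> range D" using X_not_vertex[of i] by blast
  ultimately show ?thesis by (simp add: node_of_def crossing_node_def crossing_pair_def)
qed

lemma nodes_on_edge:
  assumes "{x, y} \<in> E"
  shows "node_points E D \<inter> closed_segment (D x) (D y) = {D x, D y} \<union> X ` {i. {x, y} \<in> crossing_pair i}"
proof -
  have "D v \<in> closed_segment (D x) (D y) \<longleftrightarrow> v = x \<or> v = y" for v
    using vertex_not_on_edge[OF assms, of v] by (auto simp: edge_segment_pair)
  then show ?thesis
    using X_segment_iff[OF assms] unfolding node_points_def crossing_points_eq edge_segment_pair by auto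
qed

text \<open>Inverts \<open>node_of\<close> on the nodes of the planarization, so that darts can be
  handled by name.\<close>

definition point :: "'v node \<Rightarrow> complex" where
  "point n = (case n of Vertex v \<Rightarrow> D v | Crossing S \<Rightarrow> X (THE i. S = crossing_pair i))"

lemma point_vertex [simp]: "point (Vertex v) = D v"
  by (simp add: point_def)

lemma point_xn [simp]: "point (xn i) = X i"
proof -
  have "(THE j. crossing_pair i = crossing_pair j) = i"
    using crossing_pair_eq_iff by (intro the_equality) (auto, blast)
  then show ?thesis by (simp add: point_def crossing_node_def crossing_pair_def)
qed

definition node_darts :: "('v node \<times> 'v node) set" where
  "node_darts = (\<Union>i. {(Vertex h, Vertex (b i)), (Vertex (b i), Vertex h),
     (Vertex (a i), Vertex (a (i + 1))), (Vertex (a (i + 1)), Vertex (a i)),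
     (Vertex (a i), Vertex (b i)), (Vertex (b i), Vertex (a i)),
     (Vertex (a (i + 1)), Vertex (b i)), (Vertex (b i), Vertex (a (i + 1))),
     (Vertex h, xn i), (xn i, Vertex h), (Vertex (a i), xn i), (xn i, Vertex (a i)),
     (Vertex (b (i - 1)), xn i), (xn i, Vertex (b (i - 1))), (Vertex (b i), xn i), (xn i,
       Vertex (b i))})"

lemma plane_darts_eq: "plane_darts E D = (\<lambda>(n, m). (point n, point m)) ` node_darts"
proof -
  let ?N = "node_points E D"
  let ?d = "\<lambda>x y. {(p, q). p \<noteq> q \<and> closed_segment p q \<subseteq> closed_segment (D x) (D y) \<and>
    closed_segment p q \<inter> ?N = {p, q}}"
  have un: "?d x y = {(D x, D y), (D y, D x)}" if "{x, y} \<in> E" "\<And>i. {x, y} \<notin> crossing_pair i"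
    "x \<noteq> y" for x y
    using darts_on_uncrossed_segment[of ?N "D x" "D y"] nodes_on_edge[OF that(1)]
      that inj_D by (auto simp: inj_eq)
  have cr: "?d x y = {(D x, X i), (X i, D x), (D y, X i), (X i, D y)}"
    if "{x, y} \<in> E" "{x, y} \<in> crossing_pair i" "\<And>j. {x, y} \<in> crossing_pair j \<longleftrightarrow> i = j" for x y i
  proof -
    have "{j. {x, y} \<in> crossing_pair j} = {i}" using that by auto
    then have "?N \<inter> closed_segment (D x) (D y) = {D x, D y, X i}" using nodes_on_edge[OF that(1)] by auto
    moreover have "X i \<in> open_segment (D x) (D y)"
      using X_interior_iff[OF that(1), of i] that(2) by (simp add: edge_interior_pair)
    ultimately show ?thesis using darts_on_crossed_segment[of ?N "D x" "D y" "X i"] by auto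
  qed
  have nc: "{h, b i} \<notin> crossing_pair j" "{a i, a (i + 1)} \<notin> crossing_pair j" "{a i,
    b i} \<notin> crossing_pair j"
     "{a (i + 1), b i} \<notin> crossing_pair j" for i j
    using h_neq a_neq_b a_inj b_inj by (auto simp: crossing_pair_def doubleton_eq_iff)
  have bb: "{b i, b (i + 1)} \<in> crossing_pair j \<longleftrightarrow> i + 1 = j" for i j
    using crossing_pair_eq_iff(2)[of "i + 1" j] by simp
  let ?F = "\<lambda>i. {(H, B i), (B i, H), (A i, A (i + 1)), (A (i + 1), A i), (A i, B i), (B i, A i),
    (A (i + 1), B i), (B i, A (i + 1)),
     (H, X i), (X i, H), (A i, X i), (X i, A i)}"
  let ?G = "\<lambda>i. {(B (i - 1), X i), (X i, B (i - 1)), (B i, X i), (X i, B i)}"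
  have "plane_darts E D = (\<Union>i. ?d h (b i) \<union> ?d (a i) (a (i + 1)) \<union> ?d (a i) (b i) \<union> ?d (a (i + 1)) (b i)
      \<union> ?d h (a i) \<union> ?d (b i) (b (i + 1)))"
    unfolding plane_darts_def edges by (auto simp: edge_segment_pair)
  also have "\<dots> = (\<Union>i. ?F i \<union> ?G (i + 1))"
  proof -
    have "?d h (a i) = {(H, X i), (X i, H), (A i, X i), (X i, A i)}" for i
      by (rule cr) (simp_all add: edges_mem crossing_pair_eq_iff)
    moreover have "?d (b i) (b (i + 1)) = ?G (i + 1)" for i
      unfolding add_diff_cancel_right' by (rule cr) (simp_all add: edges_mem bb)
    moreover have "?d h (b i) = {(H, B i), (B i, H)}" "?d (a i) (a (i + 1)) = {(A i, A (i + 1)),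
      (A (i + 1), A i)}"
      "?d (a i) (b i) = {(A i, B i), (B i, A i)}" "?d (a (i + 1)) (b i) = {(A (i + 1), B i), (B i,
        A (i + 1))}" for i
      by (rule un[OF edges_mem(2) nc(1)] un[OF edges_mem(3) nc(2)] un[OF edges_mem(5) nc(3)]
        un[OF edges_mem(6) nc(4)],
          simp add: h_neq a_inj a_neq_b)+
    ultimately show ?thesis by (simp only: Un_insert_left Un_empty_left)
  qed
  also have "\<dots> = (\<Union>i. ?F i) \<union> (\<Union>i. ?G (i + 1))"
    by (rule UN_Un_distrib)
  \<comment> \<open>The edge from \<open>b i\<close> to \<open>b (i + 1)\<close> carries the
    crossing with index \<open>i + 1\<close>.\<close>
  also have "(\<Union>i. ?G (i + 1)) = (\<Union>i. ?G i)"
  proof -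
    have "range (\<lambda>i::4. i + 1) = UNIV" by (rule surjI[of _ "\<lambda>i. i - 1"]) simp
    then have "(\<Union>i\<in>range (\<lambda>i::4. i + 1). ?G i) = (\<Union>i. ?G i)" by (simp only:)
    then show ?thesis by (simp only: image_image)
  qed
  also have "(\<Union>i. ?F i) \<union> (\<Union>i. ?G i) = (\<Union>i. ?F i \<union> ?G i)"
    by (rule UN_Un_distrib[symmetric])
  also have "\<dots> = (\<lambda>(n, m). (point n, point m)) ` node_darts"
    unfolding node_darts_def image_UN
    by (simp only: image_insert image_empty prod.case point_vertex point_xn Un_insert_left Un_empty_left)
  finally show ?thesis .
qed

end

section \<open>Rotation around the nodes\<close>

lemma four_eq_0: "(4::4) = 0"
  by simp

lemma open_segment_scale:
  fixes x y :: complex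
  assumes "z \<in> open_segment x y"
  obtains c where "c > 0" "z - x = of_real c * (y - x)"
proof -
  obtain t where "z = (1 - t) *\<^sub>R x + t *\<^sub>R y" "0 < t" using assms by (auto simp: in_segment)
  then show ?thesis by (intro that[of t]) (simp_all add: scaleR_conv_of_real algebra_simps)
qed

text \<open>Seen from one end of an edge, its crossing point may be replaced by the other end, which
  turns angles at vertices into orientations of vertices.\<close>

lemma angle_open_segment:
  assumes "z \<in> open_segment p q"
  shows "angle p u z = angle p u q" "angle p z u = angle p q u"
  using open_segment_scale[OF assms] angle_scale by metis+

lemma angle_opposite:
  assumes "p \<in> open_segment u q"
  shows "angle p u q = pi"
proof -
  obtain t where t: "p = (1 - t) *\<^sub>R u + t *\<^sub>R q" "0 < t" "t < 1" "u \<noteq> q"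
    using assms by (auto simp: in_segment)
  have e: "q - p = of_real (1 - t) * (q - u)" "u - p = of_real (- t) * (q - u)"
    unfolding t(1) by (simp_all add: scaleR_conv_of_real algebra_simps)
  have "(q - p) / (u - p) = of_real (- ((1 - t) / t))" unfolding e using t(4) by simp
  then show ?thesis using t by (simp add: angle_def Arg2pi_eq_pi)
qed

context antiprism_drawing
begin

abbreviation rot :: "('v node \<times> 'v node list) set" where "rot \<equiv> antiprism_rotation h a b"

lemma rotation_cases:
  assumes "(n, L) \<in> rot"
  obtains "n = Vertex h" "L = [xn 0, Vertex (b 0), xn 1, Vertex (b 1), xn 2, Vertex (b 2), xn 3,
    Vertex (b 3)]"
    | i where "n = Vertex (a i)" "L = [Vertex (a (i + 1)), Vertex (b i), xn i, Vertex (b (i - 1)),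
      Vertex (a (i - 1))]"
    | i where "n = Vertex (b i)" "L = [Vertex h, xn i, Vertex (a i), Vertex (a (i + 1)), xn (i + 1)]"
    | i where "n = xn i" "L = [Vertex h, Vertex (b (i - 1)), Vertex (a i), Vertex (b i)]"
  using assms unfolding antiprism_rotation_def Let_def by blast

lemma rotation_mem:
  "(Vertex h, [xn 0, Vertex (b 0), xn 1, Vertex (b 1), xn 2, Vertex (b 2), xn 3,
    Vertex (b 3)]) \<in> rot"
  "(Vertex (a i), [Vertex (a (i + 1)), Vertex (b i), xn i, Vertex (b (i - 1)),
    Vertex (a (i - 1))]) \<in> rot"
  "(Vertex (b i), [Vertex h, xn i, Vertex (a i), Vertex (a (i + 1)),
    xn (i + 1)]) \<in> rot"
  "(xn i, [Vertex h, Vertex (b (i - 1)), Vertex (a i), Vertex (b i)]) \<in> rot"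
  unfolding antiprism_rotation_def Let_def by blast+

lemma xn_inj: "xn i = xn j \<longleftrightarrow> i = j"
proof
  assume "xn i = xn j"
  then have e: "crossing_pair i = crossing_pair j" by (simp add: crossing_node_def crossing_pair_def)
  have "{h, a i} \<in> crossing_pair j" unfolding e[symmetric] by (simp add: crossing_pair_def)
  then show "i = j" by (simp add: crossing_pair_eq_iff)
qed simp

lemma xn_neq: "xn i \<noteq> Vertex v" "Vertex v \<noteq> xn i"
  by (simp_all add: crossing_node_def)

lemma rotation_functional:
  assumes "(n, L) \<in> rot" "(n, L') \<in> rot"
  shows "L = L'"
  using assms(1)
proof (cases rule: rotation_cases)
  case 1
  show ?thesis using assms(2) by (cases rule: rotation_cases) (use 1 h_neq xn_neq in auto)
next
  case (2 i)
  show ?thesis using assms(2) by (cases rule: rotation_cases) (use 2 h_neq a_neq_b a_inj xn_neq in auto)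
next
  case (3 i)
  show ?thesis using assms(2) by (cases rule: rotation_cases) (use 3 h_neq a_neq_b b_inj xn_neq in auto)
next
  case (4 i)
  show ?thesis using assms(2) by (cases rule: rotation_cases) (use 4 xn_inj xn_neq in auto)
qed

lemma node_darts_iff: "(n, m) \<in> node_darts \<longleftrightarrow> (\<exists>L. (n, L) \<in> rot \<and> m \<in> set L)"
proof
  assume "(n, m) \<in> node_darts"
  then obtain i where i: "(n, m) \<in> {(Vertex h, Vertex (b i)), (Vertex (b i), Vertex h),
     (Vertex (a i), Vertex (a (i + 1))), (Vertex (a (i + 1)), Vertex (a i)),
     (Vertex (a i), Vertex (b i)), (Vertex (b i), Vertex (a i)),
     (Vertex (a (i + 1)), Vertex (b i)), (Vertex (b i), Vertex (a (i + 1))),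
     (Vertex h, xn i), (xn i, Vertex h), (Vertex (a i), xn i), (xn i, Vertex (a i)),
     (Vertex (b (i - 1)), xn i), (xn i, Vertex (b (i - 1))), (Vertex (b i), xn i), (xn i, Vertex (b i))}"
    unfolding node_darts_def by blast
  have hub: "Vertex (b i) \<in> set [xn 0, Vertex (b 0), xn 1, Vertex (b 1), xn 2, Vertex (b 2), xn 3,
    Vertex (b 3)]"
     "xn i \<in> set [xn 0, Vertex (b 0), xn 1, Vertex (b 1), xn 2, Vertex (b 2), xn 3, Vertex (b 3)]"
    using exhaust_4[of i] by (auto simp: four_eq_0)
  show "\<exists>L. (n, L) \<in> rot \<and> m \<in> set L"
    using i hub rotation_mem(1) rotation_mem(2)[of i] rotation_mem(2)[of "i + 1"] rotation_mem(3)[of i]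
      rotation_mem(3)[of "i - 1"] rotation_mem(4)[of i]
    by (elim insertE emptyE) (simp; rule exI; rule conjI; assumption?; simp)+
next
  assume "\<exists>L. (n, L) \<in> rot \<and> m \<in> set L"
  then obtain L where L: "(n, L) \<in> rot" "m \<in> set L" by blast
  have nd: "(Vertex h, Vertex (b i)) \<in> node_darts" "(Vertex (b i), Vertex h) \<in> node_darts"
     "(Vertex (a i), Vertex (a (i + 1))) \<in> node_darts" "(Vertex (a (i + 1)), Vertex (a i)) \<in> node_darts"
     "(Vertex (a i), Vertex (b i)) \<in> node_darts" "(Vertex (b i), Vertex (a i)) \<in> node_darts"
     "(Vertex (a (i + 1)), Vertex (b i)) \<in> node_darts" "(Vertex (b i), Vertex (a (i + 1))) \<in> node_darts"
     "(Vertex h, xn i) \<in> node_darts" "(xn i, Vertex h) \<in> node_darts" "(Vertex (a i), xn i) \<in> node_darts"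
     "(xn i, Vertex (a i)) \<in> node_darts" "(Vertex (b (i - 1)), xn i) \<in> node_darts" "(xn i,
       Vertex (b (i - 1))) \<in> node_darts"
     "(Vertex (b i), xn i) \<in> node_darts" "(xn i, Vertex (b i)) \<in> node_darts" for i
    unfolding node_darts_def by blast+
  show "(n, m) \<in> node_darts"
    using L(1)
  proof (cases rule: rotation_cases)
    case 1 then show ?thesis using L(2) nd by auto
  next
    case (2 i) then show ?thesis using L(2) nd(3,5,11)[of i] nd(4)[of "i - 1"] nd(7)[of "i - 1"] by auto
  next
    case (3 i) then show ?thesis using L(2) nd(2,6,8,15)[of i] nd(13)[of "i + 1"] by auto
  next
    case (4 i) then show ?thesis using L(2) nd(10,12,14,16)[of i] by auto
  qed
qed

lemma plane_dart_point: "(n, m) \<in> node_darts \<Longrightarrow> (point n, point m) \<in> plane_darts E D"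
  unfolding plane_darts_eq by (rule image_eqI[of _ _ "(n, m)"]) simp_all

lemma node_darts_point_neq: "(n, m) \<in> node_darts \<Longrightarrow> point m \<noteq> point n"
  using plane_dart_point[of n m] by (auto simp: plane_darts_def)

lemma node_of_point:
  assumes "(n, m) \<in> node_darts"
  shows "node_of E D (point n) = n" "node_of E D (point m) = m"
  using assms unfolding node_darts_def by (auto simp: node_of_vertex node_of_X)

text \<open>Consecutive comparisons are orientations of vertex triples. Each is placed before or
  after the half-turn to exclude wrapping; the total angle at \<open>a i\<close> may exceed pi,
  since the outer quadrilateral need not be convex.\<close>

lemma angles_sorted:
  assumes "(n, L) \<in> rot"
  shows "sorted_wrt (<) (map (\<lambda>m. angle (point n) (point (hd L)) (point m)) L)"
  using assms
proof (cases rule: rotation_cases)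
  case 1
  have u: "A 0 \<noteq> H" using ccw_distinct[OF ccw_aa[of 0]] by simp
  have z: "angle H (A 0) (A 0) = 0" using u by (rule angle_self)
  \<comment> \<open>The angles of \<open>a 1\<close> and \<open>a 3\<close> lie on different sides
    of pi, which excludes wrapping in all later steps.\<close>
  have pi: "angle H (A 0) (A 1) < pi" "pi < angle H (A 0) (A 3)" "pi < angle H (A 0) (B 3)"
    using angle_ccw[OF ccw_aa[of 0]] angle_gt_pi[of H "A 3" "A 0"] ccw_aa[of 3]
      angle_gt_pi[of H "B 3" "A 0"] ccw_ba[of 3]
    by (simp_all add: four_eq_0)
  have "angle H (A 0) (A 0) < angle H (A 0) (B 0)" "angle H (A 0) (B 0) < angle H (A 0) (A 1)"
    using angle_between[OF u, of "A 0" "A 1" "B 0"] ccw_aa[of 0] ccw_ab[of 0] ccw_ba[of 0]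
      z pi_gt_zero by simp_all
  moreover have "angle H (A 0) (A 1) < angle H (A 0) (B 1)" "angle H (A 0) (B 1) < angle H (A 0) (A 2)"
    using angle_between[OF u, of "A 1" "A 2" "B 1"] ccw_aa[of 1] ccw_ab[of 1] ccw_ba[of 1] pi by simp_all
  moreover have "angle H (A 0) (A 2) < angle H (A 0) (B 2)" "angle H (A 0) (B 2) < angle H (A 0) (A 3)"
    using angle_between[OF u, of "A 2" "A 3" "B 2"] ccw_aa[of 2] ccw_ab[of 2] ccw_ba[of 2] pi by simp_all
  moreover have "angle H (A 0) (A 3) < angle H (A 0) (B 3)"
    using angle_less[OF u, of "A 3" "B 3"] ccw_ab[of 3] pi by simp
  ultimately show ?thesis using 1 by (simp add: angle_open_segment[OF X_mem(1)])
next
  case (2 i)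
  note signs = ccw_aa[of i] ccw_aab[of i] ccw_ab[of i] ccw_aa[of "i - 1"] ccw_ba[of "i - 1"]
    ccw_aab[of "i - 1"]
  have c: "ccw (A i) (A (i + 1)) H" "ccw (A i) (A (i + 1)) (B i)" "ccw (A i) (B i) H"
    "ccw (A i) H (A (i - 1))" "ccw (A i) H (B (i - 1))" "ccw (A i) (B (i - 1)) (A (i - 1))"
    using signs by (simp_all add: orient_rotate orient_rotate')
  have u: "A (i + 1) \<noteq> A i" using ccw_distinct[OF c(1)] by simp
  have z: "angle (A i) (A (i + 1)) (A (i + 1)) = 0" using u by (rule angle_self)
  have "angle (A i) (A (i + 1)) (A (i + 1)) < angle (A i) (A (i + 1)) (B i)"
    "angle (A i) (A (i + 1)) (B i) < angle (A i) (A (i + 1)) H"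
    using angle_between[OF u c(1) _ c(2,3)] z pi_gt_zero by simp_all
  moreover have "angle (A i) (A (i + 1)) H < angle (A i) (A (i + 1)) (B (i - 1))"
    "angle (A i) (A (i + 1)) (B (i - 1)) < angle (A i) (A (i + 1)) (A (i - 1))"
    using angle_between[OF u c(4) _ c(5,6)] angle_ccw[OF c(1)] by simp_all
  ultimately show ?thesis
    using 2 X_mem(1)[of i] by (simp add: angle_open_segment[of "X i" "A i" H] open_segment_commute)
next
  case (3 i)
  note signs = ccw_ab[of i] ccw_bb[of "i - 1"] ccw_bab[of "i - 1"] ccw_aab[of i] ccw_bab[of i]
    ccw_ba[of i] ccw_bb[of i]
  have c: "ccw (B i) H (A i)" "ccw (B i) H (B (i - 1))" "ccw (B i) (B (i - 1)) (A i)"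
    "ccw (B i) (A i) (A (i + 1))"
     "ccw (B i) (A (i + 1)) (B (i + 1))" "ccw (B i) (A (i + 1)) H" "ccw (B i) (B (i + 1)) H"
    using signs by (simp_all add: orient_rotate orient_rotate')
  have u: "H \<noteq> B i" using ccw_distinct[OF c(1)] by simp
  have z: "angle (B i) H H = 0" using u by (rule angle_self)
  have "angle (B i) H H < angle (B i) H (B (i - 1))" "angle (B i) H (B (i - 1)) < angle (B i) H (A i)"
    using angle_between[OF u c(1) _ c(2,3)] z pi_gt_zero by simp_all
  moreover have "angle (B i) H (A i) < angle (B i) H (A (i + 1))"
    using angle_less[OF u c(4)] angle_ccw[OF c(1)] by simp
  moreover have "angle (B i) H (A (i + 1)) < angle (B i) H (B (i + 1))"
    using angle_less[OF u c(5)] angle_gt_pi[OF c(7)] by simp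
  moreover have "X i \<in> open_segment (B i) (B (i - 1))" "X (i + 1) \<in> open_segment (B i) (B (i + 1))"
    using X_mem(2)[of i] X_mem(2)[of "i + 1"] by (simp_all add: open_segment_commute)
  ultimately show ?thesis
    using 3 by (simp add: angle_open_segment[of "X i" "B i" "B (i - 1)"]
      angle_open_segment[of "X (i + 1)" "B i" "B (i + 1)"])
next
  case (4 i)
  \<comment> \<open>Both edges run straight through the crossing: \<open>a i\<close> is seen at
    angle pi, and the other two neighbours are on the two sides of the line.\<close>
  obtain t where t: "X i = (1 - t) *\<^sub>R H + t *\<^sub>R A i" "0 < t" "t < 1" using X_mem(1)[of i]
    by (auto simp: in_segment)
  have "ccw (X i) H (B (i - 1))" "ccw (X i) (B i) H"
    unfolding t(1) orient_segment using t ccw_ba[of "i - 1"] ccw_ab[of i]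
      by (simp_all add: orient_rotate orient_rotate')
  then have "0 < angle (X i) H (B (i - 1))" "angle (X i) H (B (i - 1)) < pi"
    "pi < angle (X i) H (B i)" "angle (X i) H H = 0"
    using angle_ccw angle_gt_pi angle_self ccw_distinct by blast+
  then show ?thesis using 4 angle_opposite[OF X_mem(1)[of i]] by simp
qed

lemma rotation_embedding_of:
  "rotation (embedding_of E D) = rotation (antiprism_embedding h a b)"
proof -
  have iff: "0 < Arg2pi ((point y - point n) / (point x - point n)) \<and>
      Arg2pi ((point y - point n) / (point x - point n)) < Arg2pi ((point z - point n) / (point x -
        point n)) \<longleftrightarrow>
      cyclic_triple L x y z"
    if L: "(n, L) \<in> rot" and xyz: "x \<in> set L" "y \<in> set L" "z \<in> set L" for n L x y z
  proof -
    have neq: "point m \<noteq> point n" if "m \<in> set L" for m using L that node_darts_iff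
      node_darts_point_neq by blast
    have "hd L \<in> set L" using xyz(1) by (cases L) auto
    then show ?thesis
      using cyclic_triple_iff_angle[OF angles_sorted[OF L] neq neq xyz] unfolding angle_def by blast
  qed
  have mem: "x \<in> set L \<and> y \<in> set L \<and> z \<in> set L" if "cyclic_triple L x y z" for L :: "'v node list"
    and x y z
    using that unfolding cyclic_triple_def by auto
  show ?thesis
  proof (intro equalityI subsetI)
    fix w assume "w \<in> rotation (embedding_of E D)"
    then obtain p q r s where w: "w = (node_of E D p, node_of E D q, node_of E D r, node_of E D s)"
      and d: "(p, q) \<in> plane_darts E D" "(p, r) \<in> plane_darts E D" "(p, s) \<in> plane_darts E D"
      and ang: "0 < Arg2pi ((r - p) / (q - p)) \<and> Arg2pi ((r - p) / (q - p)) < Arg2pi ((s - p) / (q - p))"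
      unfolding embedding_of_def by auto
    obtain n x where x: "(n, x) \<in> node_darts" "p = point n" "q = point x"
      using d(1) unfolding plane_darts_eq by auto
    obtain n' y where y: "(n', y) \<in> node_darts" "p = point n'" "r = point y"
      using d(2) unfolding plane_darts_eq by auto
    obtain n'' z where z: "(n'', z) \<in> node_darts" "p = point n''" "s = point z"
      using d(3) unfolding plane_darts_eq by auto
    have "n' = n" "n'' = n" using node_of_point(1) x y z by metis+
    then obtain L where L: "(n, L) \<in> rot" "x \<in> set L" "y \<in> set L" "z \<in> set L"
      using x(1) y(1) z(1) rotation_functional unfolding node_darts_iff by metis
    have "cyclic_triple L x y z" using iff[OF L] ang x y z \<open>n' = n\<close> by simp
    moreover have "w = (n, x, y, z)" using w node_of_point x y z by metis
    ultimately show "w \<in> rotation (antiprism_embedding h a b)"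
      using L(1) by (auto simp: antiprism_embedding_def)
  next
    fix w assume "w \<in> rotation (antiprism_embedding h a b)"
    then obtain n L x y z where w: "w = (n, x, y, z)" and L: "(n, L) \<in> rot"
      and c: "cyclic_triple L x y z"
      by (auto simp: antiprism_embedding_def)
    have m: "x \<in> set L" "y \<in> set L" "z \<in> set L" using mem[OF c] by auto
    then have nd: "(n, x) \<in> node_darts" "(n, y) \<in> node_darts" "(n, z) \<in> node_darts"
      using L node_darts_iff by blast+
    then have "(point n, point x) \<in> plane_darts E D" "(point n, point y) \<in> plane_darts E D"
      "(point n, point z) \<in> plane_darts E D"
      using plane_dart_point by blast+
    moreover have "w = (node_of E D (point n), node_of E D (point x), node_of E D (point y),
      node_of E D (point z))"
      using w node_of_point nd by simp
    ultimately show "w \<in> rotation (embedding_of E D)"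
      using iff[OF L m] c unfolding embedding_of_def by (simp only: embedding.simps mem_Collect_eq) blast
  qed
qed

lemma darts_embedding_of: "darts (embedding_of E D) = darts (antiprism_embedding h a b)"
proof -
  have "darts (embedding_of E D) = (\<lambda>(p, q). (node_of E D p, node_of E D q)) ` plane_darts E D"
    unfolding embedding_of_def by auto
  also have "\<dots> = (\<lambda>(n, m). (node_of E D (point n), node_of E D (point m))) ` node_darts"
    unfolding plane_darts_eq image_image by (rule image_cong) auto
  also have "\<dots> = (\<lambda>x. x) ` node_darts"
    by (rule image_cong) (auto simp: node_of_point)
  also have "\<dots> = darts (antiprism_embedding h a b)"
    using node_darts_iff by (auto simp: antiprism_embedding_def)
  finally show ?thesis .
qed

end

section \<open>The outer face\<close>

lemma continuous_orient: "continuous_on UNIV (\<lambda>z. orient x y z)" "continuous_on UNIV (\<lambda>z. orient x z y)"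
  unfolding orient_def by (intro continuous_intros)+

lemma triangle_subset_hull:
  assumes c: "ccw h x y" and z: "0 \<le> orient h x z" "0 \<le> orient h z y" "0 \<le> orient x y z"
  shows "z \<in> convex hull {h, x, y}"
proof -
  let ?d = "orient h x y"
  have sum: "orient x y z + orient h z y + orient h x z = ?d" by (simp add: orient_def algebra_simps)
  have "?d *\<^sub>R z = orient x y z *\<^sub>R h + orient h z y *\<^sub>R x + orient h x z *\<^sub>R y"
    by (simp add: complex_eq_iff orient_def algebra_simps)
  then have "(1 / ?d) *\<^sub>R (?d *\<^sub>R z) = (1 / ?d) *\<^sub>R (orient x y z *\<^sub>R h + orient h z y *\<^sub>R x +
    orient h x z *\<^sub>R y)" by simp
  then have e: "z = (orient x y z / ?d) *\<^sub>R h + (orient h z y / ?d) *\<^sub>R x + (orient h x z / ?d) *\<^sub>R y"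
    using c by (simp add: scaleR_add_right)
  have s: "orient x y z / ?d + orient h z y / ?d + orient h x z / ?d = 1"
    using sum c by (simp add: add_divide_distrib[symmetric])
  show ?thesis
    unfolding convex_hull_3 mem_Collect_eq
    by (intro exI[of _ "orient x y z / ?d"] exI[of _ "orient h z y / ?d"] exI[of _ "orient h x z / ?d"])
       (use e s z c in auto)
qed

lemma hull_subset_triangle:
  assumes c: "ccw h x y" and z: "z \<in> convex hull {h, x, y}"
  shows "0 \<le> orient h x z" "0 \<le> orient h z y" "0 \<le> orient x y z"
proof -
  have conv: "convex {z. 0 \<le> orient p q z}" for p q
    unfolding convex_alt by (auto simp: orient_segment)
  have "convex ({z. 0 \<le> orient h x z} \<inter> {z. 0 \<le> orient y h z} \<inter> {z. 0 \<le> orient x y z})"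
    by (intro convex_Int conv)
  moreover have "{h, x, y} \<subseteq> {z. 0 \<le> orient h x z} \<inter> {z. 0 \<le> orient y h z} \<inter> {z. 0 \<le> orient x y z}"
    using c orient_rotate[of x y h] orient_rotate'[of y h x] by simp
  ultimately have "z \<in> {z. 0 \<le> orient h x z} \<inter> {z. 0 \<le> orient y h z} \<inter> {z. 0 \<le> orient x y z}"
    using z hull_minimal by blast
  then show "0 \<le> orient h x z" "0 \<le> orient h z y" "0 \<le> orient x y z"
    using orient_rotate[of h z y] by simp_all
qed

text \<open>The ray from \<open>z\<close> away from \<open>h\<close> is connected, unbounded and
  disjoint from \<open>S\<close>.\<close>

lemma ray_in_outside:
  fixes S :: "complex set"
  assumes "\<And>s. s \<ge> 1 \<Longrightarrow> h + of_real s * (z - h) \<notin> S" "z \<noteq> h"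
  shows "z \<in> outside S"
proof -
  let ?R = "(\<lambda>s. h + of_real s * (z - h)) ` {1..}"
  have "connected ?R"
    by (intro connected_continuous_image continuous_intros) auto
  moreover have "?R \<subseteq> - S" using assms(1) by auto
  moreover have zR: "z \<in> ?R" by (rule image_eqI[of _ _ 1]) auto
  ultimately have sub: "?R \<subseteq> connected_component_set (- S) z"
    by (intro connected_component_maximal) auto
  have "\<not> bounded ?R"
  proof
    assume "bounded ?R"
    then obtain K where K: "\<And>w. w \<in> ?R \<Longrightarrow> dist h w \<le> K" using bounded_any_center[of ?R h] by auto
    define s where "s = max 1 ((K + 1) / cmod (z - h))"
    have "dist h (h + of_real s * (z - h)) \<le> K" by (intro K image_eqI[OF refl]) (simp add: s_def)
    moreover have "dist h (h + of_real s * (z - h)) = s * cmod (z - h)"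
      by (simp add: dist_norm norm_mult s_def)
    moreover have "(K + 1) / cmod (z - h) * cmod (z - h) \<le> s * cmod (z - h)"
      by (intro mult_right_mono) (auto simp: s_def)
    ultimately show False using assms(2) by simp
  qed
  then show ?thesis
    using sub zR \<open>?R \<subseteq> - S\<close> bounded_subset unfolding outside by blast
qed

section \<open>The region bounded by the outer quadrilateral\<close>

context antiprism_drawing
begin

abbreviation rim :: "4 \<Rightarrow> complex \<Rightarrow> real" where "rim i \<equiv> orient (A i) (A (i + 1))"

text \<open>The rim line is affine, zero at the rim vertices and positive at \<open>h\<close> and
  \<open>b i\<close>, which settles the edges inside one sector. Inner edges, which leave the
  sector, are the delicate case.\<close>

lemma interior_below_rim:
  assumes e: "e \<in> E" "z \<in> edge_interior D e" and s: "sector i z"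
  shows "rim i z > 0 \<or> e = {a i, a (i + 1)} \<and> z \<in> open_segment (A i) (A (i + 1))"
proof -
  have H: "rim i H > 0" using ccw_aa[of i] by (simp add: orient_rotate)
  have B: "rim i (B i) > 0" using ccw_aab[of i] .
  have lower: "rim i z > 0" if eb: "e = {b (i - 1), b i}"
  proof -
    obtain t where t: "z = (1 - t) *\<^sub>R B (i - 1) + t *\<^sub>R B i" "0 < t" "t < 1"
      using e(2) eb by (auto simp: edge_interior_pair in_segment)
    have "orient (A i) (B i) (B (i - 1)) > 0" using ccw_bab[of "i - 1"] by (simp add: orient_rotate)
    then have "orient (A i) (B i) z > 0" unfolding t(1) orient_segment using t by simp
    \<comment> \<open>Barycentric expansion of \<open>rim i z\<close> over the triangle
      \<open>H\<close>, \<open>A i\<close>, \<open>B i\<close>; the term of \<open>A i\<close>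
      vanishes.\<close>
    then have "orient (A i) (B i) z * rim i H + orient H (A i) z * rim i (B i) > 0"
      using H B s by (simp add: sector_def add_pos_nonneg)
    also have "orient (A i) (B i) z * rim i H + orient H (A i) z * rim i (B i)
       = orient H (A i) (B i) * rim i z"
      by (simp add: orient_def algebra_simps)
    finally show ?thesis using ccw_ab[of i] by (simp add: zero_less_mult_iff)
  qed
  show ?thesis
    using e
  proof (cases rule: edge_interior_sector)
    case (1 j)
    then have "j = i" using s sector_unique by blast
    with 1 consider "e = {h, a i}" | "e = {b (i - 1), b i}" by blast
    then show ?thesis
    proof cases
      case 1
      then obtain t where t: "z = (1 - t) *\<^sub>R H + t *\<^sub>R A i" "0 < t" "t < 1"
        using e by (auto simp: edge_interior_pair in_segment)
      have "rim i z > 0" unfolding t(1) orient_segment using t H by simp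
      then show ?thesis ..
    qed (use lower in blast)
  next
    case (2 j)
    then have "j = i" using s sector_unique by blast
    from 2(3) consider "e = {h, b i}" | "e = {a i, a (i + 1)}" | "e = {a i, b i}" | "e = {a (i + 1),
      b i}" | "e = {b i, b (i + 1)}"
      | "e = {b (i - 1), b i}" unfolding \<open>j = i\<close> insert_iff empty_iff by iprover
    then show ?thesis
    proof cases
      case 1
      then obtain t where t: "z = (1 - t) *\<^sub>R H + t *\<^sub>R B i" "0 < t" "t < 1"
        using e by (auto simp: edge_interior_pair in_segment)
      have "rim i z > 0" unfolding t(1) orient_segment using t H B by (simp add:
        add_pos_pos)
      then show ?thesis ..
    next
      case 2
      then show ?thesis using e by (simp add: edge_interior_pair)
    next
      case 3
      then obtain t where t: "z = (1 - t) *\<^sub>R A i + t *\<^sub>R B i" "0 < t" "t < 1"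
        using e by (auto simp: edge_interior_pair in_segment)
      have "rim i z > 0" unfolding t(1) orient_segment using t B by simp
      then show ?thesis ..
    next
      case 4
      then obtain t where t: "z = (1 - t) *\<^sub>R A (i + 1) + t *\<^sub>R B i" "0 < t" "t < 1"
        using e by (auto simp: edge_interior_pair in_segment)
      have "rim i z > 0" unfolding t(1) orient_segment using t B by simp
      then show ?thesis ..
    next
      case 5
      then obtain t where t: "z = (1 - t) *\<^sub>R B i + t *\<^sub>R B (i + 1)" "0 < t" "t < 1"
        using e by (auto simp: edge_interior_pair in_segment)
      have "orient (B i) (A (i + 1)) z > 0" unfolding t(1) orient_segment using t ccw_bab[of i] by simp
      \<comment> \<open>The same expansion over the triangle \<open>H\<close>, \<open>B i\<close>,
        \<open>A (i + 1)\<close>.\<close>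
      then have "orient (B i) (A (i + 1)) z * rim i H + orient H z (A (i + 1)) *
        rim i (B i) > 0"
        using H B s by (simp add: sector_def add_pos_pos)
      also have "orient (B i) (A (i + 1)) z * rim i H + orient H z (A (i + 1)) *
        rim i (B i)
         = orient H (B i) (A (i + 1)) * rim i z"
        by (simp add: orient_def algebra_simps)
      finally show ?thesis using ccw_ba[of i] by (simp add: zero_less_mult_iff)
    qed (use lower in blast)
  qed
qed

abbreviation drawn :: "complex set" where "drawn \<equiv> \<Union>e\<in>E. edge_segment D e"

lemma beyond_rim_not_drawn:
  assumes s: "0 < orient H (A i) z" "0 < orient H z (A (i + 1))" and r: "rim i z < 0"
  shows "z \<notin> drawn"
proof
  have sec: "sector i z" using s by (simp add: sector_def)
  assume "z \<in> drawn"
  then obtain e where e: "e \<in> E" "z \<in> edge_segment D e" by blast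
  show False
  proof (cases "z \<in> D ` e")
    case False
    then have z: "z \<in> edge_interior D e" using e by (simp add: edge_interior_def)
    then show False
      using interior_below_rim[OF e(1) z sec] r by (auto simp: in_segment orient_segment)
  next
    case True
    then obtain v where v: "z = D v" by blast
    show False
    proof (cases v rule: vertex_cases)
      case 1 then show False using sec v not_sector_H by simp
    next
      case (2 j) then show False using sector_unique[OF sec, of j] sector_a[of j] v s by simp
    next
      case (3 j) then show False using sector_unique[OF sec, of j] sector_b[of j] v r ccw_aab[of j]
        by simp
    qed
  qed
qed

text \<open>Moving away from the hub stays in the cone and goes farther beyond the rim line, so the
  ray never meets the drawing.\<close>

lemma beyond_rim_outside:
  assumes s: "0 < orient H (A i) z" "0 < orient H z (A (i + 1))" and r: "rim i z < 0"
  shows "z \<in> outside drawn"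
proof (rule ray_in_outside[of H])
  show "z \<noteq> H" using s by auto
  fix t :: real assume t: "t \<ge> 1"
  let ?w = "H + of_real t * (z - H)"
  have "orient H (A i) ?w = t * orient H (A i) z" "orient H ?w (A (i + 1)) = t * orient H z (A (i + 1))"
    "rim i ?w = t * rim i z - (t - 1) * rim i H"
    by (simp_all add: orient_def algebra_simps)
  moreover have "rim i H > 0" using ccw_aa[of i] by (simp add: orient_rotate)
  then have "t * rim i z - (t - 1) * rim i H < 0"
    using t r by (smt (verit) mult_nonneg_nonneg mult_pos_neg)
  ultimately show "?w \<notin> drawn" using beyond_rim_not_drawn[of i ?w] s t by simp
qed

text \<open>Closed on both rays, unlike \<open>sector\<close>, so that the complement
  \<open>near\<close> of the four pieces is open; the overlaps on the rays are reconciled by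
  \<open>on_ray\<close>.\<close>

definition far_side :: "4 \<Rightarrow> complex set" where
  "far_side i = {z. 0 \<le> orient H (A i) z \<and> 0 \<le> orient H z (A (i + 1)) \<and> rim i z \<le> 0}"

lemma closed_far_side: "closed (far_side i)"
  unfolding far_side_def
  by (intro closed_Collect_conj closed_Collect_le continuous_orient continuous_on_const)

lemma closed_cone_cases:
  assumes "z \<noteq> H" "0 \<le> orient H (A i) z" "0 \<le> orient H z (A (i + 1))"
  shows "sector i z \<or> sector (i + 1) z \<and> orient H (A (i + 1)) z = 0"
proof (cases "orient H z (A (i + 1)) = 0")
  case False
  then show ?thesis using assms by (simp add: sector_def)
next
  case True
  then have 0: "orient H (A (i + 1)) z = 0" using orient_swap'[of H z "A (i + 1)"] by simp
  then have "orient H (A i) z \<noteq> 0" using orient_zero_two[OF ccw_aa[of i]] assms(1) by blast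
  then have "0 < orient H (A i) z * orient H (A (i + 1)) (A (i + 1 + 1))"
    using assms(2) ccw_aa[of "i + 1"] by simp
  also have "\<dots> = orient H z (A (i + 1 + 1)) * orient H (A i) (A (i + 1)) - orient H z (A (i + 1)) *
    orient H (A i) (A (i + 1 + 1))"
    by (simp add: orient_def algebra_simps)
  finally have "orient H z (A (i + 1 + 1)) > 0" using True ccw_aa[of i] by (simp add: zero_less_mult_iff)
  then show ?thesis using 0 by (simp add: sector_def)
qed

text \<open>On the line through \<open>H\<close> and \<open>A i\<close> the two adjacent rim
  functions are affine with the common zero \<open>A i\<close>, hence proportional; comparison at
  \<open>H\<close> gives the positive factors.\<close>

lemma on_ray:
  assumes "orient H (A i) z = 0"
  shows "orient H (A (i - 1)) (A i) * rim i z =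
    orient H (A i) (A (i + 1)) * orient (A (i - 1)) (A i) z"
proof -
  have "orient H (A (i - 1)) (A i) * rim i z - orient H (A i) (A (i + 1)) *
    orient (A (i - 1)) (A i) z
     = orient H (A i) z * (orient H (A i) (A (i - 1)) + orient H (A (i - 1)) (A (i + 1)) + orient H
       (A (i + 1)) (A i))"
    by (simp add: orient_def algebra_simps)
  then show ?thesis using assms by simp
qed

text \<open>A point needs to be tested against the rim edge of its own sector only: closed cones
  overlap in rays, where neighbouring tests agree.\<close>

lemma below_rim_iff:
  assumes "sector i z"
  shows "z \<notin> (\<Union>j. far_side j) \<longleftrightarrow> rim i z > 0"
proof
  assume "z \<notin> (\<Union>j. far_side j)"
  then have "z \<notin> far_side i" by blast
  then show "rim i z > 0" using assms by (auto simp: far_side_def sector_def)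
next
  assume pos: "rim i z > 0"
  show "z \<notin> (\<Union>j. far_side j)"
  proof
    assume "z \<in> (\<Union>j. far_side j)"
    then obtain j where j: "0 \<le> orient H (A j) z" "0 \<le> orient H z (A (j + 1))"
      "orient (A j) (A (j + 1)) z \<le> 0"
      by (auto simp: far_side_def)
    have "z \<noteq> H" using assms not_sector_H by auto
    with j closed_cone_cases consider "sector j z" | "sector (j + 1) z" "orient H (A (j + 1)) z = 0"
      by blast
    then show False
    proof cases
      case 1
      then show False using sector_unique[OF assms, of j] j pos by simp
    next
      case 2
      then have "i = j + 1" using sector_unique[OF assms] by simp
      then have "orient H (A j) (A i) * rim i z =
        orient H (A i) (A (i + 1)) * orient (A j) (A i) z"
        using on_ray[of i z] 2 by simp
      moreover have "orient H (A j) (A i) * rim i z > 0" using ccw_aa[of j]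
        pos \<open>i = j + 1\<close> by simp
      moreover have "orient H (A i) (A (i + 1)) * orient (A j) (A i) z \<le> 0"
        using ccw_aa[of i] j(3) \<open>i = j + 1\<close> by (simp add: mult_nonneg_nonpos)
      ultimately show False by simp
    qed
  qed
qed

lemma H_not_far: "H \<notin> (\<Union>j. far_side j)"
proof -
  have "orient (A j) (A (j + 1)) H > 0" for j using ccw_aa[of j] by (simp add: orient_rotate)
  then show ?thesis by (auto simp: far_side_def not_le)
qed

abbreviation near :: "complex set" where "near \<equiv> - (\<Union>j. far_side j)"

lemma open_near: "open near"
  using closed_far_side by (intro open_Compl closed_UN) auto

lemma near_subset: "near \<subseteq> (\<Union>i. convex hull {H, A i, A (i + 1)})"
proof
  fix z assume z: "z \<in> near"
  show "z \<in> (\<Union>i. convex hull {H, A i, A (i + 1)})"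
  proof (cases "z = H")
    case True
    then show ?thesis by (auto intro: hull_inc)
  next
    case False
    then obtain i where i: "sector i z" using sector_exists by blast
    then have "rim i z > 0" using below_rim_iff z by simp
    then have "z \<in> convex hull {H, A i, A (i + 1)}"
      using i by (intro triangle_subset_hull[OF ccw_aa]) (auto simp: sector_def)
    then show ?thesis by blast
  qed
qed

text \<open>A frontier point lies in one of the four closed triangles, which bounds
  \<open>rim\<close> from below, and not in \<open>near\<close>, which bounds it from above. So it
  lies on a rim edge.\<close>

lemma frontier_near: "frontier near \<subseteq> drawn"
proof
  fix z assume "z \<in> frontier near"
  then have z: "z \<in> closure near" "z \<notin> near" using open_near by (auto simp: frontier_def interior_open)
  have "closed (\<Union>i. convex hull {H, A i, A (i + 1)})"
    by (intro closed_UN ballI compact_imp_closed compact_convex_hull finite_imp_compact) auto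
  then have "closure near \<subseteq> (\<Union>i. convex hull {H, A i, A (i + 1)})"
    using near_subset by (rule closure_minimal[rotated])
  then obtain i where i: "z \<in> convex hull {H, A i, A (i + 1)}" using z by blast
  note tri = hull_subset_triangle[OF ccw_aa i]
  have "z \<noteq> H" using z H_not_far by auto
  have rim: "z \<in> edge_segment D {a j, a (j + 1)}" if "0 \<le> orient H (A j) z"
    "0 \<le> orient H z (A (j + 1))" "orient (A j) (A (j + 1)) z = 0" for j
  proof -
    let ?d = "orient H (A j) (A (j + 1))"
    have d: "?d > 0" using ccw_aa .
    have sum: "orient H z (A (j + 1)) + orient H (A j) z = ?d + - orient (A j) (A (j + 1)) z"
      by (simp add: orient_def algebra_simps)
    have "?d *\<^sub>R z = orient (A j) (A (j + 1)) z *\<^sub>R H + orient H z (A (j + 1)) *\<^sub>R A j + orient H (A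
      j) z *\<^sub>R A (j + 1)"
      by (simp add: complex_eq_iff orient_def algebra_simps)
    then have "(1 / ?d) *\<^sub>R (?d *\<^sub>R z) = (1 / ?d) *\<^sub>R (orient H z (A (j + 1)) *\<^sub>R A j + orient H (A
      j) z *\<^sub>R A (j + 1))" using that by simp
    then have "z = (orient H z (A (j + 1)) / ?d) *\<^sub>R A j + (orient H (A j) z / ?d) *\<^sub>R A (j + 1)"
      using d by (simp add: scaleR_add_right)
    moreover have "orient H z (A (j + 1)) / ?d = 1 - orient H (A j) z / ?d"
      using sum that(3) d by (simp add: field_simps)
    moreover have "0 \<le> orient H (A j) z / ?d" "orient H (A j) z / ?d \<le> 1"
      using sum that d by (simp_all add: field_simps)
    ultimately show ?thesis unfolding edge_segment_pair closed_segment_def by auto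
  qed
  have drawn: "z \<in> drawn" if "z \<in> edge_segment D {a j, a (j + 1)}" for j using that edges_mem(3) by blast
  consider "sector i z" | "sector (i + 1) z" "orient H (A (i + 1)) z = 0"
    using closed_cone_cases[OF \<open>z \<noteq> H\<close> tri(1,2)] by blast
  then show "z \<in> drawn"
  proof cases
    case 1
    have "\<not> rim i z > 0" using z(2) below_rim_iff[OF 1] by blast
    then have "rim i z = 0" using tri(3) by simp
    then show ?thesis using tri rim drawn by blast
  next
    case 2
    have "\<not> orient (A (i + 1)) (A (i + 1 + 1)) z > 0" using z(2) below_rim_iff[OF 2(1)] by blast
    then have "orient (A (i + 1)) (A (i + 1 + 1)) z \<le> 0" by simp
    moreover have "orient H (A i) (A (i + 1)) * orient (A (i + 1)) (A (i + 1 + 1)) z =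
      orient H (A (i + 1)) (A (i + 1 + 1)) * rim i z"
      using on_ray[OF 2(2)] by simp
    moreover have "orient H (A (i + 1)) (A (i + 1 + 1)) * rim i z \<ge> 0"
      using ccw_aa[of "i + 1"] tri(3) by simp
    ultimately have "orient H (A (i + 1)) (A (i + 1 + 1)) * rim i z = 0"
      using ccw_aa[of i] by (smt (verit) mult_nonneg_nonpos)
    then have "rim i z = 0" using ccw_aa[of "i + 1"] by simp
    then show ?thesis using tri rim drawn by blast
  qed
qed

text \<open>\<open>near\<close> is bounded and its frontier is drawn, so the unbounded face avoids
  it.\<close>

lemma near_not_outside: "near \<inter> outside drawn = {}"
proof -
  have "bounded (\<Union>i. convex hull {H, A i, A (i + 1)})"
    by (intro bounded_UN ballI compact_imp_bounded compact_convex_hull finite_imp_compact) auto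
  then have "bounded near" using near_subset bounded_subset by blast
  then have "outside (frontier near) \<subseteq> - closure near" by (rule outside_frontier_misses_closure)
  moreover have "outside drawn \<subseteq> outside (frontier near)" using frontier_near by (rule outside_mono)
  ultimately have "outside drawn \<subseteq> - closure near" by (rule order_trans[rotated])
  moreover have "X \<inter> Y = {}" if "Y \<subseteq> - closure X" for X Y :: "complex set"
    using closure_subset[of X] that by blast
  ultimately show ?thesis by (simp only:)
qed

lemma left_points_tendsto: "((\<lambda>t. midpoint p q + of_real t * \<i> * (q - p)) \<longlongrightarrow> midpoint p q) (at_right 0)"
proof -
  have "((\<lambda>t. midpoint p q + of_real t * \<i> * (q - p)) \<longlongrightarrow> midpoint p q + of_real 0 * \<i> * (q - p))
    (at_right 0)"
    by (intro tendsto_intros)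
  then show ?thesis by simp
qed

text \<open>Stated for parameters of both signs, so that negating \<open>t\<close> also covers the
  reversed dart.\<close>

lemma left_of_rim_dart:
  defines "w \<equiv> \<lambda>i t. midpoint (A i) (A (i + 1)) + of_real t * \<i> * (A (i + 1) - A i)"
  shows "\<forall>\<^sub>F t in at 0. 0 < orient H (A i) (w i t) \<and> 0 < orient H (w i t) (A (i + 1))"
    and "rim i (w i t) = t * (cmod (A (i + 1) - A i))\<^sup>2"
proof -
  let ?m = "midpoint (A i) (A (i + 1))"
  have mid: "?m = (1 - 1 / 2) *\<^sub>R A i + (1 / 2) *\<^sub>R A (i + 1)"
    by (simp add: midpoint_def scaleR_add_right)
  have "((\<lambda>t. w i t) \<longlongrightarrow> ?m + of_real 0 * \<i> * (A (i + 1) - A i)) (at 0)"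
    unfolding w_def by (intro tendsto_intros)
  then have lim: "(w i \<longlongrightarrow> ?m) (at 0)" by simp
  have "orient H (A i) ?m = orient H (A i) (A (i + 1)) / 2" "orient H ?m (A (i + 1)) =
    orient H (A i) (A (i + 1)) / 2"
    unfolding mid orient_segment by simp_all
  then have pos: "orient H (A i) ?m > 0" "orient H ?m (A (i + 1)) > 0" using ccw_aa[of i] by simp_all
  have "((\<lambda>t. orient H (A i) (w i t)) \<longlongrightarrow> orient H (A i) ?m) (at 0)"
    "((\<lambda>t. orient H (w i t) (A (i + 1))) \<longlongrightarrow> orient H ?m (A (i + 1))) (at 0)"
    unfolding orient_def by (intro tendsto_intros lim)+
  then show "\<forall>\<^sub>F t in at 0. 0 < orient H (A i) (w i t) \<and> 0 < orient H (w i t) (A (i + 1))"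
    using pos by (intro eventually_conj order_tendstoD)
  have add: "orient x y (m + v) = orient x y m + ((Re y - Re x) * Im v - (Im y - Im x) * Re v)"
    for x y m v
    by (simp add: orient_def algebra_simps)
  have "rim i ?m = 0" unfolding mid orient_segment by simp
  then show "rim i (w i t) = t * (cmod (A (i + 1) - A i))\<^sup>2"
    unfolding w_def cmod_power2 add by (simp add: power2_eq_square algebra_simps)
qed

lemma outer_dart_iff:
  assumes "(p, q) \<in> plane_darts E D"
  shows "(\<forall>\<^sub>F t in at_right 0. midpoint p q + of_real t * \<i> * (q - p) \<in> outside drawn) \<longleftrightarrow> (\<exists>i. p =
    A (i + 1) \<and> q = A i)"
proof -
  let ?w = "\<lambda>t. midpoint p q + of_real t * \<i> * (q - p)"
  have inner_dart: "\<not> (\<forall>\<^sub>F t in at_right 0. ?w t \<in> outside drawn)" if "\<forall>\<^sub>F t in at_right 0. ?w t \<in> near"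
  proof
    assume "\<forall>\<^sub>F t in at_right 0. ?w t \<in> outside drawn"
    with that have "\<forall>\<^sub>F t in at_right (0::real). False" by eventually_elim (use near_not_outside in
      blast)
    then show False by simp
  qed
  have pos: "\<forall>\<^sub>F t in at_right (0::real). 0 < t" by (rule eventually_at_right_less)
  obtain e where e: "e \<in> E" "p \<noteq> q" "closed_segment p q \<subseteq> edge_segment D e"
    "closed_segment p q \<inter> node_points E D = {p, q}"
    using assms by (auto simp: plane_darts_def)
  show ?thesis
  proof (cases "\<exists>i. e = {a i, a (i + 1)}")
    case True
    then obtain i where i: "e = {a i, a (i + 1)}" by blast
    have "A (i + 1) \<noteq> A i" using ccw_distinct[OF ccw_aa[of i]] by metis
    then have len: "(cmod (A (i + 1) - A i))\<^sup>2 > 0" by simp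
    have "{j. {a i, a (i + 1)} \<in> crossing_pair j} = {}"
      using h_neq a_neq_b by (auto simp: crossing_pair_def doubleton_eq_iff)
    then have "node_points E D \<inter> closed_segment (A i) (A (i + 1)) = {A i, A (i + 1)}"
      using nodes_on_edge[OF edges_mem(3)[of i]] by simp
    moreover have "A i \<noteq> A (i + 1)" using ccw_distinct[OF ccw_aa[of i]] by simp
    ultimately have "(p, q) \<in> {(A i, A (i + 1)), (A (i + 1), A i)}"
      using darts_on_uncrossed_segment[of "node_points E D" "A i" "A (i + 1)" p q]
        e i by (simp add: edge_segment_pair)
    then consider "p = A i" "q = A (i + 1)" | "p = A (i + 1)" "q = A i" by auto
    then show ?thesis
    proof cases
      case 1
      have "\<forall>\<^sub>F t in at_right 0. 0 < orient H (A i) (?w t) \<and> 0 < orient H (?w t) (A (i + 1))"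
        using left_of_rim_dart(1)[of i] unfolding 1 eventually_at_split by simp
      with pos have "\<forall>\<^sub>F t in at_right 0. ?w t \<in> near"
      proof eventually_elim
        case (elim t)
        have "sector i (?w t)" using elim by (simp add: sector_def)
        moreover have "rim i (?w t) > 0" using left_of_rim_dart(2)[of i t]
          elim len unfolding 1 by simp
        ultimately show ?case using below_rim_iff[of i "?w t"] by simp
      qed
      moreover have "\<nexists>j. p = A (j + 1) \<and> q = A j"
      proof
        assume "\<exists>j. p = A (j + 1) \<and> q = A j"
        then obtain j where "A i = A (j + 1)" "A (i + 1) = A j" using 1 by auto
        then have "i = j + 1" "i + 1 = j" using inj_D a_inj by (auto simp: inj_eq)
        then have "j + 1 + 1 = j" by simp
        then show False by (simp add: add.assoc)
      qed
      ultimately show ?thesis using inner_dart by blast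
    next
      case 2
      have w: "?w t = midpoint (A i) (A (i + 1)) + of_real (- t) * \<i> * (A (i + 1) - A i)" for t
        unfolding 2 by (simp add: midpoint_sym algebra_simps)
      have "\<forall>\<^sub>F t in at_left 0. 0 < orient H (A i) (midpoint (A i) (A (i + 1)) + of_real t * \<i> * (A
        (i + 1) - A i)) \<and>
          0 < orient H (midpoint (A i) (A (i + 1)) + of_real t * \<i> * (A (i + 1) - A i)) (A (i + 1))"
        using left_of_rim_dart(1)[of i] unfolding eventually_at_split by simp
      then have "\<forall>\<^sub>F t in at_right 0. 0 < orient H (A i) (?w t) \<and> 0 < orient H (?w t) (A (i + 1))"
        unfolding w by (simp add: eventually_at_left_to_right)
      with pos have "\<forall>\<^sub>F t in at_right 0. ?w t \<in> outside drawn"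
      proof eventually_elim
        case (elim t)
        have "rim i (?w t) < 0" using left_of_rim_dart(2)[of i "- t"]
          elim len unfolding w by simp
        then show ?case using elim by (intro beyond_rim_outside[of i]) simp_all
      qed
      then show ?thesis using 2 by blast
    qed
  next
    case False
    \<comment> \<open>Off the rim the midpoint itself belongs to the open set \<open>near\<close>,
      hence so do all nearby points on the left.\<close>
    let ?m = "midpoint p q"
    have m: "?m \<in> closed_segment p q" "?m \<noteq> p" "?m \<noteq> q" using e(2) by (simp_all add:
      midpoint_in_closed_segment)
    then have "?m \<notin> node_points E D" using e(4) by blast
    then have int: "?m \<in> edge_interior D e" using m e(3) by (auto simp: edge_interior_def
      node_points_def)
    obtain i where i: "sector i ?m" using e(1) int by (cases rule: edge_interior_sector)
    have "rim i ?m > 0" using interior_below_rim[OF e(1) int i] False by blast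
    then have "?m \<in> near" using below_rim_iff[OF i] by simp
    then have "\<forall>\<^sub>F t in at_right 0. ?w t \<in> near"
      using topological_tendstoD[OF left_points_tendsto open_near] by blast
    moreover have "\<nexists>j. p = A (j + 1) \<and> q = A j"
    proof
      assume "\<exists>j. p = A (j + 1) \<and> q = A j"
      then obtain j where j: "p = A (j + 1)" "q = A j" by blast
      have "A j \<in> edge_segment D e" "A (j + 1) \<in> edge_segment D e" using e(3) j by auto
      then have "a j \<in> e" "a (j + 1) \<in> e" using vertex_not_on_edge[OF e(1)] by blast+
      with e(1) have "e = {a j, a (j + 1)}"
        by (cases rule: edge_cases) (use a_neq_b h_neq a_inj in \<open>auto simp: insert_commute\<close>)
      with False show False by blast
    qed
    ultimately show ?thesis using inner_dart by blast
  qed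
qed

end

section \<open>Reflections and the two embeddings\<close>

context antiprism_drawing
begin

lemma outer_darts_embedding_of: "outer_darts (embedding_of E D) =
  outer_darts (antiprism_embedding h a b)"
proof -
  let ?outer = "\<lambda>p q. \<forall>\<^sub>F t in at_right 0. midpoint p q + of_real t * \<i> * (q - p) \<in> outside drawn"
  have d: "(A (i + 1), A i) \<in> plane_darts E D" for i
  proof -
    have "(Vertex (a (i + 1)), Vertex (a i)) \<in> node_darts" unfolding node_darts_def by blast
    from plane_dart_point[OF this] show ?thesis by simp
  qed
  have e: "outer_darts (embedding_of E D) = {(node_of E D p, node_of E D q) |p q. (p,
    q) \<in> plane_darts E D \<and> ?outer p q}"
    by (simp add: embedding_of_def)
  have o: "outer_darts (antiprism_embedding h a b) = range (\<lambda>i. (node_of E D (A (i + 1)),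
    node_of E D (A i)))"
    by (simp add: node_of_vertex antiprism_embedding_def)
  show ?thesis
  proof (intro equalityI subsetI)
    fix w assume "w \<in> outer_darts (embedding_of E D)"
    then obtain p q where pq: "w = (node_of E D p, node_of E D q)" "(p, q) \<in> plane_darts E D"
      "?outer p q"
      unfolding e by (elim CollectE exE conjE)
    then obtain i where "p = A (i + 1)" "q = A i" using outer_dart_iff[OF pq(2)]
      by (elim iffD1[THEN exE]) auto
    then show "w \<in> outer_darts (antiprism_embedding h a b)" unfolding o pq(1) by simp
  next
    fix w assume "w \<in> outer_darts (antiprism_embedding h a b)"
    then obtain i where w: "w = (node_of E D (A (i + 1)), node_of E D (A i))"
      unfolding o by (elim rangeE)
    have "?outer (A (i + 1)) (A i)" by (rule iffD2[OF outer_dart_iff[OF d]]) (rule exI[of _ i], simp)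
    with w d[of i] show "w \<in> outer_darts (embedding_of E D)"
      unfolding e mem_Collect_eq by (intro exI[of _ "A (i + 1)"] exI[of _ "A i"] conjI)
  qed
qed

lemma embedding_of_eq: "embedding_of E D = antiprism_embedding h a b"
  using darts_embedding_of rotation_embedding_of outer_darts_embedding_of by (intro
    embedding.equality) simp_all

lemma rac_drawing_if_orthogonal:
  assumes "\<And>i. orthogonal (A i - H) (B i - B (i - 1))"
  shows "rac_drawing E D"
  unfolding rac_drawing_def
proof (intro conjI allI impI straight_line)
  fix u v x y assume c: "{u, v} \<in> E \<and> {x, y} \<in> E \<and> edges_cross D {u, v} {x, y}"
  then obtain z where "{u, v} \<noteq> {x, y}" "z \<in> edge_interior D {u, v}" "z \<in> edge_interior D {x, y}"
    by (auto simp: edges_cross_def)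
  then obtain i where i: "{{u, v}, {x, y}} = crossing_pair i" using crossing_edges c by metis
  have o: "inner (A i - H) (B i - B (i - 1)) = 0" using assms[of i] by (simp add: orthogonal_def)
  consider "{u, v} = {h, a i}" "{x, y} = {b (i - 1), b i}" | "{x, y} = {h, a i}" "{u, v} =
    {b (i - 1), b i}"
    using i unfolding crossing_pair_def doubleton_eq_iff[of "{u, v}"] by blast
  then show "orthogonal (D u - D v) (D x - D y)"
    by cases (use o in \<open>auto simp: doubleton_eq_iff orthogonal_def inner_diff_left inner_diff_right
      inner_commute\<close>)
qed

end

section \<open>Reversed cyclic orders and reflected index maps\<close>

lemma cyclic_triple_rev: "cyclic_triple (rev L) x y z \<longleftrightarrow> cyclic_triple L z y x"
proof -
  have *: "cyclic_triple (rev L) z y x" if c: "cyclic_triple L x y z" for L :: "'a list" and x y z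
  proof -
    obtain i j k where ijk: "i < j" "j < k" "k < length L"
      "(x, y, z) \<in> {(L ! i, L ! j, L ! k), (L ! j, L ! k, L ! i), (L ! k, L ! i, L ! j)}"
      using c unfolding cyclic_triple_def by blast
    let ?n = "length L"
    have nth: "rev L ! (?n - Suc l) = L ! l" if "l < ?n" for l
      using that by (simp add: rev_nth)
    have "(z, y, x) \<in> {(rev L ! (?n - Suc k), rev L ! (?n - Suc j), rev L ! (?n - Suc i)),
        (rev L ! (?n - Suc j), rev L ! (?n - Suc i), rev L ! (?n - Suc k)),
        (rev L ! (?n - Suc i), rev L ! (?n - Suc k), rev L ! (?n - Suc j))}"
      using ijk by (auto simp: nth)
    then show ?thesis unfolding cyclic_triple_def
      using ijk by (intro exI[of _ "?n - Suc k"] exI[of _ "?n - Suc j"] exI[of _ "?n - Suc i"]) auto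
  qed
  show ?thesis using *[of "rev L" x y z] *[of L z y x] by auto
qed

lemma cyclic_triple_rotate1: "cyclic_triple (rotate1 L) x y z \<longleftrightarrow> cyclic_triple L x y z"
proof (cases L)
  case (Cons l xs)
  show ?thesis
  proof
    assume "cyclic_triple (rotate1 L) x y z"
    then obtain i j k where ijk: "i < j" "j < k" "k \<le> length xs"
      "(x, y, z) \<in> {((xs @ [l]) ! i, (xs @ [l]) ! j, (xs @ [l]) ! k), ((xs @ [l]) ! j,
        (xs @ [l]) ! k, (xs @ [l]) ! i),
         ((xs @ [l]) ! k, (xs @ [l]) ! i, (xs @ [l]) ! j)}"
      unfolding cyclic_triple_def Cons by auto
    show "cyclic_triple L x y z"
    proof (cases "k = length xs")
      case True
      then show ?thesis unfolding cyclic_triple_def Cons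
        using ijk by (intro exI[of _ 0] exI[of _ "Suc i"] exI[of _ "Suc j"]) (auto simp: nth_append)
    next
      case False
      then show ?thesis unfolding cyclic_triple_def Cons
        using ijk by (intro exI[of _ "Suc i"] exI[of _ "Suc j"]
          exI[of _ "Suc k"]) (auto simp: nth_append)
    qed
  next
    assume "cyclic_triple L x y z"
    then obtain i j k where ijk: "i < j" "j < k" "k \<le> length xs"
      "(x, y, z) \<in> {((l # xs) ! i, (l # xs) ! j, (l # xs) ! k), ((l # xs) ! j, (l # xs) ! k,
        (l # xs) ! i),
         ((l # xs) ! k, (l # xs) ! i, (l # xs) ! j)}"
      unfolding cyclic_triple_def Cons by (auto simp: less_Suc_eq_le)
    show "cyclic_triple (rotate1 L) x y z"
    proof (cases i)
      case 0
      then show ?thesis unfolding cyclic_triple_def Cons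
        using ijk by (intro exI[of _ "j - 1"] exI[of _ "k - 1"]
          exI[of _ "length xs"]) (auto simp: nth_append nth_Cons')
    next
      case (Suc i')
      then show ?thesis unfolding cyclic_triple_def Cons
        using ijk by (intro exI[of _ "i - 1"] exI[of _ "j - 1"]
          exI[of _ "k - 1"]) (auto simp: nth_append nth_Cons')
    qed
  qed
qed simp

text \<open>\<open>b i\<close> sits between \<open>a i\<close> and \<open>a (i + 1)\<close>. After
  negating the indices of \<open>a\<close>, the vertex between \<open>a (- i)\<close> and
  \<open>a (- i - 1)\<close> is \<open>b (- i - 1)\<close>, whence the extra shift in
  \<open>flop\<close>.\<close>

abbreviation flip :: "(4 \<Rightarrow> 'v) \<Rightarrow> 4 \<Rightarrow> 'v" where "flip a \<equiv> \<lambda>i. a (- i)"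
abbreviation flop :: "(4 \<Rightarrow> 'v) \<Rightarrow> 4 \<Rightarrow> 'v" where "flop b \<equiv> \<lambda>i. b (- i - 1)"

lemma crossing_node_reflect: "crossing_node h (flip a) (flop b) i =
  crossing_node h a b (- i)"
  by (simp add: crossing_node_def insert_commute)

lemma four_neg: "- (1::4) = 3" "- (2::4) = 2" "- (3::4) = 1" "3 - (i::4) = - i - 1"
  by simp_all

text \<open>Lists represent cyclic orders. At \<open>a i\<close> the reflected list is the exact
  reversal; at the other nodes both lists begin with the same neighbour, and they differ from a
  reversal by one rotation.\<close>

lemma antiprism_rotation_reflect:
  assumes "(n, L) \<in> antiprism_rotation h a b"
  obtains L' where "(n, L') \<in> antiprism_rotation h (flip a) (flop b)" "set L' = set L"
    "\<And>x y z. cyclic_triple L' x y z \<longleftrightarrow> cyclic_triple L z y x"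
proof -
  let ?R = "antiprism_rotation h (flip a) (flop b)"
  let ?X = "crossing_node h a b"
  have R: "(Vertex h, [?X 0, Vertex (b 3), ?X 3, Vertex (b 2), ?X 2, Vertex (b 1), ?X 1,
    Vertex (b 0)]) \<in> ?R"
    "(Vertex (a i), [Vertex (a (i - 1)), Vertex (b (i - 1)), ?X i, Vertex (b i),
      Vertex (a (i + 1))]) \<in> ?R"
    "(Vertex (b i), [Vertex h, ?X (i + 1), Vertex (a (i + 1)), Vertex (a i), ?X i]) \<in> ?R"
    "(?X i, [Vertex h, Vertex (b i), Vertex (a i), Vertex (b (i - 1))]) \<in> ?R" for i
  proof -
    let ?U = "\<lambda>i. {(Vertex (a (- i)), [Vertex (a (- i - 1)), Vertex (b (- i - 1)), ?X (- i),
      Vertex (b (- i)), Vertex (a (1 - i))]),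
           (Vertex (b (- i - 1)), [Vertex h, ?X (- i), Vertex (a (- i)), Vertex (a (- i - 1)),
             ?X (- i - 1)]),
           (?X (- i), [Vertex h, Vertex (b (- i)), Vertex (a (- i)), Vertex (b (- i - 1))])}"
    have e: "?R = insert (Vertex h, [?X 0, Vertex (b 3), ?X 3, Vertex (b 2), ?X 2, Vertex (b 1),
      ?X 1, Vertex (b 0)]) (\<Union>i. ?U i)"
      unfolding antiprism_rotation_def Let_def crossing_node_reflect by (simp add: four_neg)
    show "(Vertex h, [?X 0, Vertex (b 3), ?X 3, Vertex (b 2), ?X 2, Vertex (b 1), ?X 1,
      Vertex (b 0)]) \<in> ?R"
      unfolding e by simp
    have "?U (- i) \<subseteq> ?R" "?U (- i - 1) \<subseteq> ?R" unfolding e by blast+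
    then show "(Vertex (a i), [Vertex (a (i - 1)), Vertex (b (i - 1)), ?X i, Vertex (b i),
      Vertex (a (i + 1))]) \<in> ?R"
      "(Vertex (b i), [Vertex h, ?X (i + 1), Vertex (a (i + 1)), Vertex (a i), ?X i]) \<in> ?R"
      "(?X i, [Vertex h, Vertex (b i), Vertex (a i), Vertex (b (i - 1))]) \<in> ?R"
      by (simp_all add: add.commute)
  qed
  have "\<exists>L'. (n, L') \<in> ?R \<and> (L' = rev L \<or> rotate1 L' = rev L)"
    using assms[unfolded antiprism_rotation_def Let_def]
  proof (elim insertE UN_E emptyE)
    fix i assume "(n, L) = (Vertex (a i), [Vertex (a (i + 1)), Vertex (b i), ?X i,
      Vertex (b (i - 1)), Vertex (a (i - 1))])"
    then have "n = Vertex (a i)" "L = [Vertex (a (i + 1)), Vertex (b i), ?X i, Vertex (b (i - 1)),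
      Vertex (a (i - 1))]" by simp_all
    then show ?thesis by (simp only:) (rule exI, rule conjI[OF R(2)],
      simp only: rev.simps append.simps simp_thms)
  next
    fix i assume "(n, L) = (Vertex (b i), [Vertex h, ?X i, Vertex (a i), Vertex (a (i + 1)),
      ?X (i + 1)])"
    then have "n = Vertex (b i)" "L = [Vertex h, ?X i, Vertex (a i), Vertex (a (i + 1)),
      ?X (i + 1)]" by simp_all
    then show ?thesis by (simp only:) (rule exI, rule conjI[OF R(3)],
      simp only: rev.simps append.simps rotate1.simps simp_thms)
  next
    fix i assume "(n, L) = (?X i, [Vertex h, Vertex (b (i - 1)), Vertex (a i), Vertex (b i)])"
    then have "n = ?X i" "L = [Vertex h, Vertex (b (i - 1)), Vertex (a i), Vertex (b i)]" by simp_all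
    then show ?thesis by (simp only:) (rule exI, rule conjI[OF R(4)],
      simp only: rev.simps append.simps rotate1.simps simp_thms)
  next
    assume "(n, L) = (Vertex h, [?X 0, Vertex (b 0), ?X 1, Vertex (b 1), ?X 2, Vertex (b 2), ?X 3,
      Vertex (b 3)])"
    then have "n = Vertex h" "L = [?X 0, Vertex (b 0), ?X 1, Vertex (b 1), ?X 2, Vertex (b 2), ?X 3,
      Vertex (b 3)]" by simp_all
    then show ?thesis by (simp only:) (rule exI, rule conjI[OF R(1)],
      simp only: rev.simps append.simps rotate1.simps simp_thms)
  qed
  then obtain L' where L': "(n, L') \<in> ?R" "L' = rev L \<or> rotate1 L' = rev L" by blast
  show ?thesis
  proof (rule that[OF L'(1)])
    show "set L' = set L" using L'(2) by (elim disjE) (simp, metis set_rev set_rotate1)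
    fix x y z
    have "cyclic_triple (rev L) x y z \<longleftrightarrow> cyclic_triple L' x y z"
      using L'(2) cyclic_triple_rotate1[of L' x y z] by (elim disjE) simp_all
    then show "cyclic_triple L' x y z \<longleftrightarrow> cyclic_triple L z y x" by (simp add: cyclic_triple_rev)
  qed
qed

lemma range_shift4: "range (\<lambda>i::4. f (i + 1)) = range f" "range (\<lambda>i::4. f (- i - 1)) = range f"
  "range (\<lambda>i::4. f (- i)) = range f"
proof -
  have "surj (\<lambda>i::4. i + 1)" by (rule surjI[of _ "\<lambda>i. i - 1"]) simp
  moreover have "surj (\<lambda>i::4. - i - 1)" by (rule surjI[of _ "\<lambda>i. - i - 1"]) simp
  moreover have "surj (\<lambda>i::4. - i)" by (rule surjI[of _ "\<lambda>i. - i"]) simp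
  moreover have "range (\<lambda>i. f (g i)) = range f" if "surj g" for g :: "4 \<Rightarrow> 4"
  proof -
    have "range (\<lambda>i. f (g i)) = f ` range g" by (simp only: image_image)
    then show ?thesis using that by (simp only:)
  qed
  ultimately show "range (\<lambda>i::4. f (i + 1)) = range f" "range (\<lambda>i::4. f (- i - 1)) = range f"
    "range (\<lambda>i::4. f (- i)) = range f"
    by blast+
qed

text \<open>One inclusion suffices, since \<open>flip\<close> and \<open>flop\<close> are
  involutions.\<close>

lemma darts_reflect:
  "darts (antiprism_embedding h a b) \<subseteq> darts (antiprism_embedding h (flip a) (flop b))"
proof
  fix w assume "w \<in> darts (antiprism_embedding h a b)"
  then obtain n m L where w: "w = (n, m)" "m \<in> set L" and L: "(n, L) \<in> antiprism_rotation h a b"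
    unfolding antiprism_embedding_def by auto
  from antiprism_rotation_reflect[OF L] obtain L' where
    "(n, L') \<in> antiprism_rotation h (flip a) (flop b)" "set L' = set L" by metis
  with w have "\<exists>L'. (n, L') \<in> antiprism_rotation h (flip a) (flop b) \<and> m \<in> set L'"
    by (intro exI[of _ L'] conjI) (assumption, simp only:)
  then show "w \<in> darts (antiprism_embedding h (flip a) (flop b))"
    unfolding antiprism_embedding_def w(1) by (simp only: embedding.simps mem_Collect_eq case_prod_conv)
qed

lemma rotation_reflect:
  assumes "(n, z, y, x) \<in> rotation (antiprism_embedding h a b)"
  shows "(n, x, y, z) \<in> rotation (antiprism_embedding h (flip a) (flop b))"
proof -
  obtain L where L: "(n, L) \<in> antiprism_rotation h a b" "cyclic_triple L z y x"
    using assms unfolding antiprism_embedding_def by auto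
  from antiprism_rotation_reflect[OF L(1)] obtain L' where
    "(n, L') \<in> antiprism_rotation h (flip a) (flop b)"
      "\<And>x y z. cyclic_triple L' x y z \<longleftrightarrow> cyclic_triple L z y x" by metis
  with L have "\<exists>L'. (n, L') \<in> antiprism_rotation h (flip a) (flop b) \<and>
    cyclic_triple L' x y z"
    by (intro exI[of _ L'] conjI) (assumption, simp only:)
  then show ?thesis
    unfolding antiprism_embedding_def by (simp only: embedding.simps mem_Collect_eq case_prod_conv)
qed

lemma mirror_antiprism_embedding:
  "mirror (antiprism_embedding h a b) = antiprism_embedding h (flip a) (flop b)"
proof -
  let ?a = "\<lambda>i. a (- i)" and ?b = "\<lambda>i. b (- i - 1)"
  have twice: "(\<lambda>i. ?a (- i)) = a" "(\<lambda>i. ?b (- i - 1)) = b" by simp_all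
  have "darts (antiprism_embedding h a b) = darts (antiprism_embedding h ?a ?b)"
    using darts_reflect[of h a b] darts_reflect[of h ?a ?b, unfolded twice] by (rule equalityI)
  moreover have "{(n, x, y, z). (n, z, y, x) \<in> rotation (antiprism_embedding h a b)} =
    rotation (antiprism_embedding h ?a ?b)"
  proof (intro equalityI subsetI)
    fix w assume "w \<in> {(n, x, y, z). (n, z, y, x) \<in> rotation (antiprism_embedding h a b)}"
    then show "w \<in> rotation (antiprism_embedding h ?a ?b)" using rotation_reflect by (cases w) auto
  next
    fix w assume "w \<in> rotation (antiprism_embedding h ?a ?b)"
    then show "w \<in> {(n, x, y, z). (n, z, y, x) \<in> rotation (antiprism_embedding h a b)}"
      using rotation_reflect[of _ _ _ _ h ?a ?b, unfolded twice] by (cases w) auto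
  qed
  moreover have "(outer_darts (antiprism_embedding h a b))\<inverse> = outer_darts (antiprism_embedding h ?a ?b)"
  proof -
    have "(outer_darts (antiprism_embedding h a b))\<inverse> = range (\<lambda>i. (Vertex (a i), Vertex (a (i + 1))))"
      by (auto simp: antiprism_embedding_def)
    also have "\<dots> = range (\<lambda>i. (Vertex (a (- i - 1)), Vertex (a (- i - 1 + 1))))"
      by (rule range_shift4(2)[symmetric])
    finally show ?thesis by (simp add: antiprism_embedding_def)
  qed
  ultimately show ?thesis unfolding mirror_def by (intro embedding.equality) simp_all
qed

lemma antiprism_edges_ranges:
  "(\<Union>i::4. {{h, a i}, {h, b i}, {a i, a (i + 1)}, {b i, b (i + 1)}, {a i, b i}, {a (i + 1), b i}}) =
   range (\<lambda>i. {h, a i}) \<union> range (\<lambda>i. {h, b i}) \<union> range (\<lambda>i. {a i, a (i + 1)}) \<union> range (\<lambda>i. {b i,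
     b (i + 1)}) \<union>
   range (\<lambda>i. {a i, b i}) \<union> range (\<lambda>i. {a (i + 1), b i})"
  by auto

lemma antiprism_drawing_reflect:
  assumes "antiprism_drawing E (cnj \<circ> D) h a b"
  shows "antiprism_drawing E D h (flip a) (flop b)"
proof -
  interpret c: antiprism_drawing E "cnj \<circ> D" h a b by fact
  have rev: "orient (cnj x) (cnj y) (cnj z) = orient x z y" for x y z
    by (simp add: orient_cnj orient_swap'[of x z y])
  note s = c.ccw_ab c.ccw_ba c.ccw_aa c.ccw_bb c.ccw_aab c.ccw_bab
  note s = s[unfolded o_apply rev]
  show ?thesis
  proof
    show "E = (\<Union>i. {{h, a (- i)}, {h, b (- i - 1)}, {a (- i), a (- (i + 1))}, {b (- i - 1),
      b (- (i + 1) - 1)},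
        {a (- i), b (- i - 1)}, {a (- (i + 1)), b (- i - 1)}})"
    proof -
      have r: "range (\<lambda>i. {h, a (- i)}) = range (\<lambda>i. {h, a i})" "range (\<lambda>i. {h, b (- i - 1)}) =
        range (\<lambda>i. {h, b i})"
        by (rule range_shift4)+
      have r': "range (\<lambda>i. {a (- i), a (- (i + 1))}) = range (\<lambda>i. {a i, a (i + 1)})"
        "range (\<lambda>i. {b (- i - 1), b (- (i + 1) - 1)}) = range (\<lambda>i. {b i, b (i + 1)})"
        "range (\<lambda>i. {a (- i), b (- i - 1)}) = range (\<lambda>i. {a (i + 1), b i})"
        "range (\<lambda>i. {a (- (i + 1)), b (- i - 1)}) = range (\<lambda>i. {a i, b i})"
        using range_shift4(2)[of "\<lambda>i. {a i, a (i + 1)}"]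
          range_shift4(2)[of "\<lambda>i. {b (i - 1), b i}"] range_shift4(1)[of "\<lambda>i. {b (i - 1), b i}"]
          range_shift4(2)[of "\<lambda>i. {a (i + 1), b i}"] range_shift4(2)[of "\<lambda>i. {a i, b i}"]
        by (simp_all add: insert_commute)
      show ?thesis
        unfolding c.edges antiprism_edges_ranges[of h a b] antiprism_edges_ranges[of h "\<lambda>i. a (- i)"
          "\<lambda>i. b (- i - 1)"] r r'
        by (simp only: Un_ac)
    qed
    show "UNIV = insert h (range (\<lambda>i. a (- i)) \<union> range (\<lambda>i. b (- i - 1)))"
      using c.vertices range_shift4(3)[of a] range_shift4(2)[of b] by simp
    fix i :: 4
    have e: "- (i + 1) = - i - 1" "- i - 1 - 1 + 1 = - i - 1" "- i - 1 + 1 = - i" by simp_all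
    show "ccw (D h) (D (a (- i))) (D (b (- i - 1)))" using s(2)[of "- i - 1"] unfolding e .
    show "ccw (D h) (D (b (- i - 1))) (D (a (- (i + 1))))" using s(1)[of "- i - 1"] unfolding e .
    show "ccw (D h) (D (a (- i))) (D (a (- (i + 1))))" using s(3)[of "- i - 1"] unfolding e .
    show "ccw (D h) (D (b (- i - 1))) (D (b (- (i + 1) - 1)))" using s(4)[of "- i - 1 - 1"] unfolding e .
    show "ccw (D (a (- i))) (D (a (- (i + 1)))) (D (b (- i - 1)))"
      using s(5)[of "- i - 1"] unfolding e by (simp only: orient_rotate orient_rotate')
    show "ccw (D (b (- i - 1))) (D (a (- (i + 1)))) (D (b (- (i + 1) - 1)))"
      using s(6)[of "- i - 1 - 1"] unfolding e by (simp only: orient_rotate orient_rotate')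
  qed
qed

section \<open>The two orientation patterns and the drawings that realize them\<close>

definition outer_odd :: "(nat \<Rightarrow> complex) \<Rightarrow> bool" where
  "outer_odd p \<longleftrightarrow>
     ccw_at p 0 1 2 \<and>
     ccw_at p 0 2 3 \<and>
     ccw_at p 0 3 4 \<and>
     ccw_at p 0 4 5 \<and>
     ccw_at p 0 5 6 \<and>
     ccw_at p 0 6 7 \<and>
     ccw_at p 0 7 8 \<and>
     ccw_at p 0 8 1 \<and>
     ccw_at p 0 1 3 \<and>
     ccw_at p 0 2 4 \<and>
     ccw_at p 0 3 5 \<and>
     ccw_at p 0 4 6 \<and>
     ccw_at p 0 5 7 \<and>
     ccw_at p 0 6 8 \<and>
     ccw_at p 0 7 1 \<and>
     ccw_at p 0 8 2 \<and>
     ccw_at p 1 3 2 \<and>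
     ccw_at p 2 3 4 \<and>
     ccw_at p 3 5 4 \<and>
     ccw_at p 4 5 6 \<and>
     ccw_at p 5 7 6 \<and>
     ccw_at p 6 7 8 \<and>
     ccw_at p 7 1 8 \<and>
     ccw_at p 8 1 2"

definition outer_even :: "(nat \<Rightarrow> complex) \<Rightarrow> bool" where
  "outer_even p \<longleftrightarrow>
     ccw_at p 0 1 2 \<and>
     ccw_at p 0 2 3 \<and>
     ccw_at p 0 3 4 \<and>
     ccw_at p 0 4 5 \<and>
     ccw_at p 0 5 6 \<and>
     ccw_at p 0 6 7 \<and>
     ccw_at p 0 7 8 \<and>
     ccw_at p 0 8 1 \<and>
     ccw_at p 0 1 3 \<and>
     ccw_at p 0 2 4 \<and>
     ccw_at p 0 3 5 \<and>
     ccw_at p 0 4 6 \<and>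
     ccw_at p 0 5 7 \<and>
     ccw_at p 0 6 8 \<and>
     ccw_at p 0 7 1 \<and>
     ccw_at p 0 8 2 \<and>
     ccw_at p 1 2 3 \<and>
     ccw_at p 2 4 3 \<and>
     ccw_at p 3 4 5 \<and>
     ccw_at p 4 6 5 \<and>
     ccw_at p 5 6 7 \<and>
     ccw_at p 6 8 7 \<and>
     ccw_at p 7 8 1 \<and>
     ccw_at p 8 2 1"

text \<open>Once the rim turns counterclockwise, alternation leaves a single free sign, that of 1 2
  3; it decides which quadrilateral is outside.\<close>

lemma (in antiprism_config) outer_cases:
  assumes "ccw_at p 0 1 2"
  shows "outer_odd p \<or> outer_even p"
proof -
  have n: "ccw_at p 1 3 2 \<longleftrightarrow> \<not> ccw_at p 1 2 3"
    "ccw_at p 2 4 3 \<longleftrightarrow> \<not> ccw_at p 2 3 4"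
    "ccw_at p 3 5 4 \<longleftrightarrow> \<not> ccw_at p 3 4 5"
    "ccw_at p 4 6 5 \<longleftrightarrow> \<not> ccw_at p 4 5 6"
    "ccw_at p 5 7 6 \<longleftrightarrow> \<not> ccw_at p 5 6 7"
    "ccw_at p 6 8 7 \<longleftrightarrow> \<not> ccw_at p 6 7 8"
    "ccw_at p 7 1 8 \<longleftrightarrow> \<not> ccw_at p 7 8 1"
    "ccw_at p 8 2 1 \<longleftrightarrow> \<not> ccw_at p 8 1 2"
    by (rule ccw_neg'; simp)+
  show ?thesis
  proof (cases "ccw_at p 1 2 3")
    case True
    have "outer_even p"
      unfolding outer_even_def n by (simp only: angular_order[OF assms] alternating[OF assms]
        True simp_thms)
    then show ?thesis ..
  next
    case False
    have "outer_odd p"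
      unfolding outer_odd_def n by (simp only: angular_order[OF assms] alternating[OF assms]
        False simp_thms)
    then show ?thesis ..
  qed
qed

lemma augmented_antiprism_edges:
  "augmented_antiprism = (\<Union>i. {{v\<^sub>0, va i}, {v\<^sub>0, vb i}, {va i, va (i + 1)}, {vb i, vb (i + 1)},
    {va i, vb i}, {va (i + 1), vb i}})"
proof -
  have v: "{x. x \<noteq> v\<^sub>0} = range va \<union> range vb"
  proof (intro equalityI subsetI)
    fix x assume "x \<in> {x. x \<noteq> v\<^sub>0}"
    then show "x \<in> range va \<union> range vb" by (cases x) auto
  qed auto
  have "{{v\<^sub>0, x} |x. x \<noteq> v\<^sub>0} = (\<lambda>x. {v\<^sub>0, x}) ` {x. x \<noteq> v\<^sub>0}" by (rule setcompr_eq_image)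
  then have spokes: "{{v\<^sub>0, x} |x. x \<noteq> v\<^sub>0} = range (\<lambda>i. {v\<^sub>0, va i}) \<union> range (\<lambda>i. {v\<^sub>0, vb i})"
    unfolding v by (simp only: image_Un image_image)
  have ranges: "(\<Union>i. {f i, g i, k i, l i}) = range f \<union> range g \<union> range k \<union> range l"
    for f g k l :: "4 \<Rightarrow> antiprism_vertex set"
    by auto
  show ?thesis unfolding augmented_antiprism_def spokes ranges antiprism_edges_ranges[of v\<^sub>0 va vb]
    by (simp only: Un_ac)
qed

text \<open>Exchanges the roles of the quadrilaterals: the vertex following \<open>vb i\<close> in
  the 8-cycle is \<open>va (i + 1)\<close>, so the new inner cycle is shifted by one.\<close>

lemma augmented_antiprism_edges':
  "augmented_antiprism = (\<Union>i. {{v\<^sub>0, vb i}, {v\<^sub>0, va (i + 1)}, {vb i, vb (i + 1)}, {va (i + 1),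
    va (i + 1 + 1)}, {vb i, va (i + 1)},
     {vb (i + 1), va (i + 1)}})"
proof -
  have r: "range (\<lambda>i. {v\<^sub>0, va (i + 1)}) = range (\<lambda>i. {v\<^sub>0, va i})"
    "range (\<lambda>i. {va (i + 1), va (i + 1 + 1)}) = range (\<lambda>i. {va i, va (i + 1)})"
    "range (\<lambda>i. {vb (i + 1), va (i + 1)}) = range (\<lambda>i. {vb i, va i})"
    by (rule range_shift4)+
  have c: "{vb i, va j} = {va j, vb i}" for i j by (rule insert_commute)
  show ?thesis
    unfolding augmented_antiprism_edges antiprism_edges_ranges[of v\<^sub>0 va vb]
      antiprism_edges_ranges[of v\<^sub>0 vb "\<lambda>i. va (i + 1)"] r
    unfolding c by (simp only: Un_ac)
qed

lemma UNIV_antiprism_vertex: "UNIV = insert v\<^sub>0 (range va \<union> range vb)"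
proof -
  have "x \<in> insert v\<^sub>0 (range va \<union> range vb)" for x by (cases x) auto
  then show ?thesis by blast
qed

lemma exhaust_4': "(i::4) = 0 \<or> i = 1 \<or> i = 2 \<or> i = 3"
  using exhaust_4[of i] by (auto simp: four_eq_0)

lemma four_add: "(1::4) + 1 = 2" "(2::4) + 1 = 3" "(3::4) + 1 = 0" "(0::4) + 1 = 1"
  by simp_all

lemma antiprism_drawing_odd:
  assumes "outer_odd (\<lambda>i. D (label i))"
  shows "antiprism_drawing augmented_antiprism D v\<^sub>0 va vb"
proof
  note s = assms[unfolded outer_odd_def label_simps]
  show "augmented_antiprism = (\<Union>i. {{v\<^sub>0, va i}, {v\<^sub>0, vb i}, {va i, va (i + 1)}, {vb i,
    vb (i + 1)}, {va i, vb i}, {va (i + 1), vb i}})"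
    by (rule augmented_antiprism_edges)
  show "UNIV = insert v\<^sub>0 (range va \<union> range vb)" by (rule UNIV_antiprism_vertex)
  fix i :: 4
  show "ccw (D v\<^sub>0) (D (va i)) (D (vb i))" "ccw (D v\<^sub>0) (D (vb i)) (D (va (i + 1)))"
    "ccw (D v\<^sub>0) (D (va i)) (D (va (i + 1)))"
    "ccw (D v\<^sub>0) (D (vb i)) (D (vb (i + 1)))" "ccw (D (va i)) (D (va (i + 1))) (D (vb i))"
      "ccw (D (vb i)) (D (va (i + 1))) (D (vb (i + 1)))"
    using exhaust_4'[of i] s by (elim disjE; simp only: four_add)+
qed

lemma antiprism_drawing_even:
  assumes "outer_even (\<lambda>i. D (label i))"
  shows "antiprism_drawing augmented_antiprism D v\<^sub>0 vb (\<lambda>i. va (i + 1))"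
proof
  note s = assms[unfolded outer_even_def label_simps]
  show "augmented_antiprism = (\<Union>i. {{v\<^sub>0, vb i}, {v\<^sub>0, va (i + 1)}, {vb i, vb (i + 1)}, {va (i + 1),
    va (i + 1 + 1)}, {vb i, va (i + 1)},
     {vb (i + 1), va (i + 1)}})"
    by (rule augmented_antiprism_edges')
  show "UNIV = insert v\<^sub>0 (range vb \<union> range (\<lambda>i. va (i + 1)))"
    using UNIV_antiprism_vertex range_shift4(1)[of va] by (simp add: Un_commute)
  fix i :: 4
  show "ccw (D v\<^sub>0) (D (vb i)) (D (va (i + 1)))" "ccw (D v\<^sub>0) (D (va (i + 1))) (D (vb (i + 1)))"
    "ccw (D v\<^sub>0) (D (vb i)) (D (vb (i + 1)))"
    "ccw (D v\<^sub>0) (D (va (i + 1))) (D (va (i + 1 + 1)))" "ccw (D (vb i)) (D (vb (i + 1))) (D (va (i +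
      1)))"
    "ccw (D (va (i + 1))) (D (vb (i + 1))) (D (va (i + 1 + 1)))"
    using exhaust_4'[of i] s by (elim disjE; simp only: four_add)+
qed

lemma orient_zero_imp_on_segment:
  assumes "orient x y z = 0"
  shows "x \<in> closed_segment y z \<or> y \<in> closed_segment x z \<or> z \<in> closed_segment x y"
proof (cases "x = y")
  case False
  define n where "n = (Re y - Re x)\<^sup>2 + (Im y - Im x)\<^sup>2"
  define t where "t = inner (y - x) (z - x) / n"
  have n: "n \<noteq> 0" using False by (auto simp: n_def sum_power2_eq_zero_iff complex_eq_iff)
  \<comment> \<open>Components of \<open>z - x\<close> along \<open>y - x\<close> and along its
    rotation by a right angle; the latter is the orientation.\<close>
  have "n *\<^sub>R (z - x) = inner (y - x) (z - x) *\<^sub>R (y - x) + orient x y z *\<^sub>R (\<i> * (y - x))"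
    by (simp add: n_def complex_eq_iff orient_def inner_complex_def power2_eq_square algebra_simps)
  then have "(1 / n) *\<^sub>R (n *\<^sub>R (z - x)) = (1 / n) *\<^sub>R (inner (y - x) (z - x) *\<^sub>R (y - x))"
    using assms by simp
  then have "z - x = t *\<^sub>R (y - x)" using n by (simp add: t_def)
  then have "z = (1 - t) *\<^sub>R x + (1 - (1 - t)) *\<^sub>R y" by (simp add: algebra_simps)
  then have "collinear {x, z, y}" unfolding collinear_3_expand by blast
  then show ?thesis by (auto simp: collinear_between_cases between_mem_segment closed_segment_commute)
qed simp

lemma drawn_triangle_not_collinear:
  assumes "straight_line_drawing E D" "{x, y} \<in> E" "{y, z} \<in> E" "{x, z} \<in> E" "x \<noteq> y" "y \<noteq> z" "x \<noteq> z"
  shows "orient (D x) (D y) (D z) \<noteq> 0"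
proof
  assume "orient (D x) (D y) (D z) = 0"
  moreover have "D x \<notin> closed_segment (D y) (D z)" "D y \<notin> closed_segment (D x) (D z)"
    "D z \<notin> closed_segment (D x) (D y)"
    using assms unfolding straight_line_drawing_def edge_segment_pair[symmetric] by auto
  ultimately show False using orient_zero_imp_on_segment by blast
qed

text \<open>Both patterns list precisely the edge triangles, 16 at the hub and 8 on the rim, so they
  can be carried back from perturbed points.\<close>

lemma outer_transfer:
  assumes "\<And>i j k. triangle i j k \<Longrightarrow> ccw (q i) (q j) (q k) \<Longrightarrow> ccw_at p i j k"
  shows "outer_odd q \<Longrightarrow> outer_odd p" "outer_even q \<Longrightarrow> outer_even p"
  unfolding outer_odd_def outer_even_def
  by (intro conjI assms; simp add: triangle_def adj_def)+

text \<open>Two choices of the outer quadrilateral times two senses in which it runs.\<close>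

lemma rac_drawing_cases:
  assumes rac: "rac_drawing augmented_antiprism D"
  obtains "antiprism_drawing augmented_antiprism D v\<^sub>0 va vb"
    | "antiprism_drawing augmented_antiprism D v\<^sub>0 (\<lambda>i. va (- i)) (\<lambda>i. vb (- i - 1))"
    | "antiprism_drawing augmented_antiprism D v\<^sub>0 vb (\<lambda>i. va (i + 1))"
    | "antiprism_drawing augmented_antiprism D v\<^sub>0 (\<lambda>i. vb (- i)) (\<lambda>i. va (- i - 1 + 1))"
proof -
  obtain q where q: "antiprism_config q"
    "\<And>i j k. i \<le> 8 \<Longrightarrow> j \<le> 8 \<Longrightarrow> k \<le> 8 \<Longrightarrow> ccw (D (label i)) (D (label j)) (D (label k)) \<Longrightarrow>
      ccw (q i) (q j) (q k)"
    using rac_drawing_perturbation[OF rac] by blast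
  interpret antiprism_config q by (rule q(1))
  have sld: "straight_line_drawing augmented_antiprism D" using rac by (simp add: rac_drawing_def)
  \<comment> \<open>Perturbation preserves nonzero signs, and an edge triangle of the drawing has
    one; the perturbed sign therefore reveals it.\<close>
  have transfer: "ccw (D (label i)) (D (label j)) (D (label k))" if "triangle i j k"
    "ccw (q i) (q j) (q k)" for i j k
  proof -
    have adj: "adj i j" "adj j k" "adj i k" using that(1) adj_sym by (auto simp: triangle_def)
    have le: "i \<le> 8" "j \<le> 8" "k \<le> 8" "i \<noteq> j" "j \<noteq> k" "i \<noteq> k" using adj adj_le by auto
    have "orient (D (label i)) (D (label j)) (D (label k)) \<noteq> 0"
      using drawn_triangle_not_collinear[OF sld label_adj[OF adj(1)] label_adj[OF adj(2)]
        label_adj[OF adj(3)]]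
        le inj_onD[OF label_inj] by auto
    moreover have "\<not> ccw (D (label j)) (D (label i)) (D (label k))"
      using q(2)[of j i k] le that(2) orient_swap[of "q i" "q j" "q k"] by auto
    ultimately show ?thesis using orient_swap[of "D (label i)" "D (label j)" "D (label k)"] by linarith
  qed
  show ?thesis
  proof (cases "ccw (q 0) (q 1) (q 2)")
    case True
    from outer_cases[OF this] show ?thesis
      using outer_transfer[of q "\<lambda>i. D (label i)"] transfer antiprism_drawing_odd
        antiprism_drawing_even that(1,3) by blast
  next
    case False
    then have "ccw ((cnj \<circ> q) 0) ((cnj \<circ> q) 1) ((cnj \<circ> q) 2)"
      using general_position[of 0 1 2] by (simp add: orient_cnj)
    from antiprism_config.outer_cases[OF antiprism_config_cnj this]
    have c: "outer_odd (cnj \<circ> q) \<or> outer_even (cnj \<circ> q)" .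
    have tr: "ccw ((cnj \<circ> D) (label i)) ((cnj \<circ> D) (label j)) ((cnj \<circ> D) (label k))"
      if t: "triangle i j k" "ccw ((cnj \<circ> q) i) ((cnj \<circ> q) j) ((cnj \<circ> q) k)" for i j k
    proof -
      have "triangle j i k" using t(1) adj_sym by (auto simp: triangle_def)
      moreover have "ccw (q j) (q i) (q k)" using t(2) orient_swap[of "q i" "q j" "q k"]
        by (simp add: orient_cnj)
      ultimately show ?thesis
        using transfer[of j i k] orient_swap[of "D (label i)" "D (label j)" "D (label k)"]
          by (simp add: orient_cnj)
    qed
    note ot = outer_transfer[of "cnj \<circ> q" "\<lambda>i. (cnj \<circ> D) (label i)", OF tr]
    from c show ?thesis
    proof
      assume "outer_odd (cnj \<circ> q)"
      from antiprism_drawing_reflect[OF antiprism_drawing_odd[OF ot(1)[OF _ _ this]]]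
        show ?thesis using that(2) by simp
    next
      assume "outer_even (cnj \<circ> q)"
      from antiprism_drawing_reflect[OF antiprism_drawing_even[OF ot(2)[OF _ _ this]]]
        show ?thesis using that(4) by simp
    qed
  qed
qed

text \<open>The outer corners lie on the axes, so spokes to them meet the sides of the axis-parallel
  inner square at right angles. The inner corner (1, 1) is inside because 1 + 1 < 3, the rim line
  being x + y = 3.\<close>

definition outer_square :: "4 \<Rightarrow> complex" where
  "outer_square i = (if i = 0 then 3 else if i = 1 then 3 * \<i> else if i = 2 then -3 else -3 * \<i>)"

definition inner_square :: "4 \<Rightarrow> complex" where
  "inner_square i = (if i = 0 then 1 + \<i> else if i = 1 then \<i> - 1 else if i = 2 then -1 - \<i> else 1 - \<i>)"

lemma square_drawing:
  assumes "E = (\<Union>i. {{h, a i}, {h, b i}, {a i, a (i + 1)}, {b i, b (i + 1)}, {a i, b i}, {a (i + 1),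
    b i}})"
    and "UNIV = insert h (range a \<union> range b)"
    and D: "D h = 0" "\<And>i. D (a i) = outer_square i" "\<And>i. D (b i) = inner_square i"
  shows "antiprism_drawing E D h a b" "rac_drawing E D"
proof -
  show ad: "antiprism_drawing E D h a b"
  proof
    fix i :: 4
    show "ccw (D h) (D (a i)) (D (b i))" "ccw (D h) (D (b i)) (D (a (i + 1)))"
      "ccw (D h) (D (a i)) (D (a (i + 1)))"
      "ccw (D h) (D (b i)) (D (b (i + 1)))" "ccw (D (a i)) (D (a (i + 1))) (D (b i))"
        "ccw (D (b i)) (D (a (i + 1))) (D (b (i + 1)))"
      unfolding D using exhaust_4'[of i] by (elim disjE; simp add: outer_square_def inner_square_def
        orient_def)+
  qed fact+
  interpret antiprism_drawing E D h a b by (rule ad)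
  have "orthogonal (D (a i) - D h) (D (b i) - D (b (i - 1)))" for i
    unfolding D using exhaust_4'[of i] by (elim disjE) (simp_all add: outer_square_def
      inner_square_def orthogonal_def inner_complex_def)
  then show "rac_drawing E D" by (rule rac_drawing_if_orthogonal)
qed

theorem theorem1:
  shows "card (combinatorial_embedding augmented_antiprism `
           {D. rac_drawing augmented_antiprism D}) = 2"
proof -
  let ?E = augmented_antiprism
  let ?M = "antiprism_embedding v\<^sub>0 va vb" and ?N = "antiprism_embedding v\<^sub>0 vb (\<lambda>i. va (i + 1))"
  have inv: "mirror (antiprism_embedding v\<^sub>0 (flip a) (flop b)) =
    antiprism_embedding v\<^sub>0 a b" for a b
    unfolding mirror_antiprism_embedding by simp
  have emb: "combinatorial_embedding ?E D \<in> {{?M, mirror ?M}, {?N, mirror ?N}}"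
    if "rac_drawing ?E D" for D
    using that
  proof (cases rule: rac_drawing_cases)
    case 1
    then show ?thesis by (simp add: combinatorial_embedding_def antiprism_drawing.embedding_of_eq)
  next
    case 2
    then show ?thesis unfolding combinatorial_embedding_def antiprism_drawing.embedding_of_eq[OF 2] inv
      by (simp add: mirror_antiprism_embedding insert_commute)
  next
    case 3
    then show ?thesis by (simp add: combinatorial_embedding_def antiprism_drawing.embedding_of_eq)
  next
    case 4
    then show ?thesis unfolding combinatorial_embedding_def antiprism_drawing.embedding_of_eq[OF 4]
      inv[of vb "\<lambda>i. va (i + 1)"]
      by (simp add: mirror_antiprism_embedding[of v\<^sub>0 vb "\<lambda>i. va (i + 1)"] insert_commute)
  qed
  have "{?M, mirror ?M} \<in> combinatorial_embedding ?E ` {D. rac_drawing ?E D}"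
  proof -
    let ?D = "case_antiprism_vertex 0 outer_square inner_square"
    have d: "antiprism_drawing ?E ?D v\<^sub>0 va vb" "rac_drawing ?E ?D"
      using square_drawing[OF augmented_antiprism_edges UNIV_antiprism_vertex, of ?D] by simp_all
    then show ?thesis
      by (intro image_eqI[of _ _ ?D]) (simp_all add: combinatorial_embedding_def
        antiprism_drawing.embedding_of_eq)
  qed
  moreover have "{?N, mirror ?N} \<in> combinatorial_embedding ?E ` {D. rac_drawing ?E D}"
  proof -
    \<comment> \<open>The shift by -1 cancels the shift of \<open>va\<close> in the exchanged
      roles.\<close>
    let ?D = "case_antiprism_vertex 0 (\<lambda>i. inner_square (i - 1)) outer_square"
    have u: "UNIV = insert v\<^sub>0 (range vb \<union> range (\<lambda>i. va (i + 1)))"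
      using UNIV_antiprism_vertex range_shift4(1)[of va] by (simp add: Un_commute)
    have d: "antiprism_drawing ?E ?D v\<^sub>0 vb (\<lambda>i. va (i + 1))" "rac_drawing ?E ?D"
      using square_drawing[OF augmented_antiprism_edges' u, of ?D] by simp_all
    then show ?thesis
      by (intro image_eqI[of _ _ ?D]) (simp_all add: combinatorial_embedding_def
        antiprism_drawing.embedding_of_eq)
  qed
  ultimately have "combinatorial_embedding ?E ` {D. rac_drawing ?E D} = {{?M, mirror ?M}, {?N,
    mirror ?N}}"
    using emb by blast
  moreover have "?M \<noteq> ?N" "?M \<noteq> mirror ?N"
  proof -
    \<comment> \<open>The outer face tells the embeddings apart: the outer darts of
      \<open>?N\<close> and of its mirror image join vertices \<open>vb\<close> only.\<close>
    have "(Vertex (va 1), Vertex (va 0)) \<in> outer_darts ?M" unfolding antiprism_embedding_def by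
      (auto intro: range_eqI[of _ _ 0])
    moreover have "(Vertex (va 1), Vertex (va 0)) \<notin> outer_darts ?N" "(Vertex (va 1),
      Vertex (va 0)) \<notin> outer_darts (mirror ?N)"
      by (auto simp: antiprism_embedding_def mirror_def)
    ultimately show "?M \<noteq> ?N" "?M \<noteq> mirror ?N" by metis+
  qed
  then have "{?M, mirror ?M} \<noteq> {?N, mirror ?N}" by blast
  ultimately show ?thesis by simp
qed

end
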